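(* Let $e,f\in\mathbb{N}$ and set $n=ef$. Let $W^{\triangleleft}_{e,f}(X,Y)\in\mathbb{Q}(X,Y)$ be the rational function with the property that $\zeta^{\triangleleft}_{H(R)}(s)=W^{\triangleleft}_{e,f}(p,p^{-s})$ for every prime $p$ and every finite extension $R$ of $\mathbb{Z}_p$ with ramification index $e$ and inertia degree $f$. Then $$W^{\triangleleft}_{e,f}(X^{-1},Y^{-1}) = (-1)^{3n}\, X^{\binom{3n}{2}}\,Y^{5n+2(e-1)f}\,W^{\triangleleft}_{e,f}(X,Y).$$
   Context: A finite extension $R$ of $\mathbb{Z}_p$ means a compact discrete valuation ring of characteristic zero with residue characteristic $p$ (equivalently, the ring of integers of a finite extension of $\mathbb{Q}_p$). If $\mathfrak{m}$ is its maximal ideal, the inertia degree is $f=[R/\mathfrak{m}:\mathbb{F}_p]$ and the ramification index $e$ is given by $pR=\mathfrak{m}^e$; $R$ is a free $\mathbb{Z}_p$-module of rank $n=ef$. For a ring $\mathcal{R}$, the Heisenberg group $H(\mathcal{R})$ is the group of upper unitriangular $3\times 3$ matrices over $\mathcal{R}$. For a finitely generated profinite group $G$, the normal zeta function is $\zeta^{\triangleleft}_G(s)=\sum_{m=1}^\infty a^{\triangleleft}_m(G)m^{-s}$, where $a^{\triangleleft}_m(G)$ is the number of open normal subgroups of $G$ of index $m$ and $s$ is a complex variable (with sufficiently large real part). For given $e,f$, a rational function $W^{\triangleleft}_{e,f}(X,Y)$ as in the claim is known to exist (Grunewald--Segal--Smith), and it is uniquely determined. *)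

theory Defs
  imports
    "HOL-Analysis.Analysis"
    "HOL-Computational_Algebra.Polynomial_Factorial"
    "HOL-Algebra.Coset"
    "HOL-Algebra.QuotRing"
    "HOL-Algebra.Ideal_Product"
    "HOL-Algebra.Ring_Divisibility"
    "HOL-Algebra.Embedded_Algebras"
begin

section \<open>Finite extensions of the p-adic integers\<close>

definition discrete_valuation_ring :: "('a, 'b) ring_scheme \<Rightarrow> bool" where
  "discrete_valuation_ring R \<longleftrightarrow>
     principal_domain R \<and> \<not> field R \<and> (\<exists>!\<mm>. maximalideal \<mm> R)"

definition max_ideal :: "('a, 'b) ring_scheme \<Rightarrow> 'a set" where
  "max_ideal R = (THE \<mm>. maximalideal \<mm> R)"

abbreviation residue_field :: "('a, 'b) ring_scheme \<Rightarrow> 'a set ring" where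
  "residue_field R \<equiv> R Quot (max_ideal R)"

definition has_characteristic :: "('a, 'b) ring_scheme \<Rightarrow> nat \<Rightarrow> bool" where
  "has_characteristic R c \<longleftrightarrow>
     (\<forall>k::nat. [k] \<cdot>\<^bsub>R\<^esub> \<one>\<^bsub>R\<^esub> = \<zero>\<^bsub>R\<^esub> \<longleftrightarrow> c dvd k)"

text \<open>The \<open>\<aa>\<close>-adic topology on \<open>R\<close>; \<open>ideals_set R\<close> is the monoid of ideals under
  ideal multiplication, with \<open>\<aa>\<^sup>0 = R\<close>.\<close>

definition adic_topology :: "('a, 'b) ring_scheme \<Rightarrow> 'a set \<Rightarrow> 'a topology" where
  "adic_topology R \<aa> = topology (\<lambda>U. U \<subseteq> carrier R \<and>
     (\<forall>x\<in>U. \<exists>k::nat. (\<aa> [^]\<^bsub>ideals_set R\<^esub> k) +>\<^bsub>R\<^esub> x \<subseteq> U))"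

lemma ideal_pow:
  assumes "cring R" "ideal \<aa> R"
  shows "ideal (\<aa> [^]\<^bsub>ideals_set R\<^esub> (k::nat)) R"
    and "\<aa> [^]\<^bsub>ideals_set R\<^esub> Suc k \<subseteq> \<aa> [^]\<^bsub>ideals_set R\<^esub> k"
proof -
  interpret cring R by fact
  interpret I: comm_monoid "ideals_set R" by (rule ideals_set_is_comm_monoid)
  have *: "ideal (\<aa> [^]\<^bsub>ideals_set R\<^esub> (j::nat)) R" for j
    using I.nat_pow_closed[of \<aa> j] assms(2) by (simp add: ideals_set_def)
  show "ideal (\<aa> [^]\<^bsub>ideals_set R\<^esub> k) R" by (rule *)
  show "\<aa> [^]\<^bsub>ideals_set R\<^esub> Suc k \<subseteq> \<aa> [^]\<^bsub>ideals_set R\<^esub> k"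
    using ideal_prod_inter[OF *[of k] assms(2)] by (simp add: ideals_set_def)
qed

lemma openin_adic_topology:
  assumes "cring R" "ideal \<aa> R"
  shows "openin (adic_topology R \<aa>) U \<longleftrightarrow> U \<subseteq> carrier R \<and>
     (\<forall>x\<in>U. \<exists>k::nat. (\<aa> [^]\<^bsub>ideals_set R\<^esub> k) +>\<^bsub>R\<^esub> x \<subseteq> U)"
proof -
  let ?P = "\<lambda>k. \<aa> [^]\<^bsub>ideals_set R\<^esub> (k::nat)"
  let ?L = "\<lambda>U. U \<subseteq> carrier R \<and> (\<forall>x\<in>U. \<exists>k. ?P k +>\<^bsub>R\<^esub> x \<subseteq> U)"
  have mono: "?P j \<subseteq> ?P i" if "i \<le> j" for i j
    using that by (induction rule: dec_induct) (use ideal_pow(2)[OF assms] in blast)+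
  have coset: "?P j +>\<^bsub>R\<^esub> x \<subseteq> ?P i +>\<^bsub>R\<^esub> x" if "i \<le> j" for i j x
    using mono[OF that] by (auto simp: a_r_coset_def')
  have inter: "?L (S \<inter> T)" if S: "?L S" and T: "?L T" for S T
  proof (intro conjI ballI)
    show "S \<inter> T \<subseteq> carrier R" using S by blast
    fix x assume "x \<in> S \<inter> T"
    then obtain i j where "?P i +>\<^bsub>R\<^esub> x \<subseteq> S" "?P j +>\<^bsub>R\<^esub> x \<subseteq> T" using S T by blast
    then have "?P (max i j) +>\<^bsub>R\<^esub> x \<subseteq> S \<inter> T"
      using coset[of i "max i j" x] coset[of j "max i j" x] by auto
    then show "\<exists>k. ?P k +>\<^bsub>R\<^esub> x \<subseteq> S \<inter> T" ..
  qed
  have union: "?L (\<Union>\<K>)" if "\<forall>K\<in>\<K>. ?L K" for \<K>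
    using that by (meson Sup_least Union_iff Union_upper subset_trans)
  have "istopology ?L"
    unfolding istopology_def using inter union by blast
  then show ?thesis unfolding adic_topology_def by (simp add: topology_inverse')
qed

text \<open>A compact discrete valuation ring of characteristic 0 and residue characteristic \<open>p\<close>.
  Such a ring has the cardinality of the continuum, so quantifying over all of them with carrier
  in the type \<open>nat \<Rightarrow> int\<close> covers every isomorphism class.\<close>

definition finite_extension_of_Zp :: "nat \<Rightarrow> ('a, 'b) ring_scheme \<Rightarrow> bool" where
  "finite_extension_of_Zp p R \<longleftrightarrow>
     discrete_valuation_ring R \<and>
     compact_space (adic_topology R (max_ideal R)) \<and>
     has_characteristic R 0 \<and>
     has_characteristic (residue_field R) p"

definition has_ramification_index :: "nat \<Rightarrow> ('a, 'b) ring_scheme \<Rightarrow> nat \<Rightarrow> bool" where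
  "has_ramification_index p R e \<longleftrightarrow>
     PIdl\<^bsub>R\<^esub> ([p] \<cdot>\<^bsub>R\<^esub> \<one>\<^bsub>R\<^esub>) = max_ideal R [^]\<^bsub>ideals_set R\<^esub> e"

text \<open>In residue characteristic \<open>p\<close>, the image of the integers in the residue field is its
  prime field \<open>\<bbbF>\<^sub>p\<close>, and \<open>f\<close> is the dimension of the residue field over it.\<close>

definition has_inertia_degree :: "('a, 'b) ring_scheme \<Rightarrow> nat \<Rightarrow> bool" where
  "has_inertia_degree R f \<longleftrightarrow>
     ring.dimension (residue_field R) f
       (range (\<lambda>k::int. [k] \<cdot>\<^bsub>residue_field R\<^esub> \<one>\<^bsub>residue_field R\<^esub>))
       (carrier (residue_field R))"


section \<open>The Heisenberg group\<close>

text \<open>A \<open>3 \<times> 3\<close> matrix is a function on index pairs, \<open>undefined\<close> outside \<open>{1..3} \<times> {1..3}\<close>.\<close>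

definition heisenberg :: "('a, 'b) ring_scheme \<Rightarrow> (nat \<times> nat \<Rightarrow> 'a) monoid" where
  "heisenberg R =
     \<lparr> carrier = {A \<in> {1..3} \<times> {1..3} \<rightarrow>\<^sub>E carrier R.
         (\<forall>i\<in>{1..3}. A (i, i) = \<one>\<^bsub>R\<^esub>) \<and>
         (\<forall>i\<in>{1..3}. \<forall>j\<in>{1..3}. j < i \<longrightarrow> A (i, j) = \<zero>\<^bsub>R\<^esub>)},
       mult = (\<lambda>A B. \<lambda>(i, j)\<in>{1..3} \<times> {1..3}.
         \<Oplus>\<^bsub>R\<^esub>k\<in>{1..3}. A (i, k) \<otimes>\<^bsub>R\<^esub> B (k, j)),
       one = (\<lambda>(i, j)\<in>{1..3} \<times> {1..3}. if i = j then \<one>\<^bsub>R\<^esub> else \<zero>\<^bsub>R\<^esub>) \<rparr>"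

definition heisenberg_topology :: "('a, 'b) ring_scheme \<Rightarrow> (nat \<times> nat \<Rightarrow> 'a) topology" where
  "heisenberg_topology R =
     subtopology (product_topology (\<lambda>_. adic_topology R (max_ideal R)) ({1..3} \<times> {1..3}))
       (carrier (heisenberg R))"


section \<open>Normal zeta functions\<close>

definition num_open_normal_subgroups ::
    "('g, 'b) monoid_scheme \<Rightarrow> 'g topology \<Rightarrow> nat \<Rightarrow> nat" where
  "num_open_normal_subgroups G T m =
     card {N. N \<lhd> G \<and> openin T N \<and> card (rcosets\<^bsub>G\<^esub> N) = m}"

text \<open>Term \<open>k\<close> is the summand for index \<open>m = k + 1\<close>.\<close>

definition normal_zeta_term ::
    "('g, 'b) monoid_scheme \<Rightarrow> 'g topology \<Rightarrow> complex \<Rightarrow> nat \<Rightarrow> complex" where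
  "normal_zeta_term G T s k =
     of_nat (num_open_normal_subgroups G T (Suc k)) * of_nat (Suc k) powr (- s)"

definition normal_zeta :: "('g, 'b) monoid_scheme \<Rightarrow> 'g topology \<Rightarrow> complex \<Rightarrow> complex" where
  "normal_zeta G T s = (\<Sum>k. normal_zeta_term G T s k)"


section \<open>Rational functions in two variables\<close>

text \<open>\<open>\<rat>(X, Y)\<close> is the fraction field of \<open>\<rat>[X][Y]\<close>: the outer polynomial variable is \<open>Y\<close>.\<close>

type_synonym ratfun2 = "rat poly poly fract"

definition ratfun_X :: ratfun2 where "ratfun_X = to_fract [:[:0, 1:]:]"

definition ratfun_Y :: ratfun2 where "ratfun_Y = to_fract [:0, 1:]"

instance fract :: ("{idom, ring_char_0}") field_char_0
proof
  have "of_nat n = to_fract (of_nat n :: 'a)" for n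
    by (induction n) (simp_all add: add.commute)
  then show "inj (of_nat :: nat \<Rightarrow> 'a fract)"
    by (auto simp: inj_def)
qed

definition eval2 :: "rat poly poly \<Rightarrow> 'a \<Rightarrow> 'a \<Rightarrow> 'a::field_char_0" where
  "eval2 P x y = poly (map_poly (\<lambda>c. poly (map_poly of_rat c) x) P) y"

text \<open>\<open>W\<close> can be evaluated at \<open>(x, y)\<close> if some denominator of \<open>W\<close> does not vanish there; the
  value does not depend on the chosen representation (see \<open>ratfun_eval_eq\<close> below).
  Taking \<open>x, y\<close> in \<open>\<rat>(X, Y)\<close> itself yields substitution of rational functions.\<close>

definition ratfun_defined_at :: "ratfun2 \<Rightarrow> 'a::field_char_0 \<Rightarrow> 'a \<Rightarrow> bool" where
  "ratfun_defined_at W x y \<longleftrightarrow>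
     (\<exists>A B. W = Fraction_Field.Fract A B \<and> B \<noteq> 0 \<and> eval2 B x y \<noteq> 0)"

definition ratfun_eval :: "ratfun2 \<Rightarrow> 'a \<Rightarrow> 'a \<Rightarrow> 'a::field_char_0" where
  "ratfun_eval W x y =
     (THE v. \<exists>A B. W = Fraction_Field.Fract A B \<and> B \<noteq> 0 \<and> eval2 B x y \<noteq> 0 \<and>
        v = eval2 A x y / eval2 B x y)"

lemma map_poly_hom_mult:
  fixes h :: "'b::comm_ring_1 \<Rightarrow> 'c::comm_ring_1"
  assumes "h 0 = 0" "\<And>a b. h (a + b) = h a + h b" "\<And>a b. h (a * b) = h a * h b"
  shows "map_poly h (p * q) = map_poly h p * map_poly h q"
proof -
  have s: "h (sum g S) = (\<Sum>i\<in>S. h (g i))" if "finite S" for g :: "nat \<Rightarrow> 'b" and S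
    using that by (induction) (simp_all add: assms)
  show ?thesis
    by (rule poly_eqI) (simp add: coeff_map_poly assms(1,3) coeff_mult s)
qed

lemma map_poly_hom_add:
  fixes h :: "'b::comm_ring_1 \<Rightarrow> 'c::comm_ring_1"
  assumes "h 0 = 0" "\<And>a b. h (a + b) = h a + h b"
  shows "map_poly h (p + q) = map_poly h p + map_poly h q"
  by (rule poly_eqI) (simp add: coeff_map_poly assms)

lemma eval2_mult: "eval2 (P * Q) x y = eval2 P x y * eval2 Q x y"
  unfolding eval2_def
  by (subst map_poly_hom_mult)
     (simp_all add: map_poly_hom_mult map_poly_hom_add of_rat_add of_rat_mult)

lemma ratfun_eval_eq:
  assumes "W = Fraction_Field.Fract A B" "B \<noteq> 0" "eval2 B x y \<noteq> 0"
  shows "ratfun_eval W x y = eval2 A x y / eval2 B x y"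
  unfolding ratfun_eval_def
proof (rule the_equality)
  show "\<exists>A' B'. W = Fraction_Field.Fract A' B' \<and> B' \<noteq> 0 \<and> eval2 B' x y \<noteq> 0 \<and>
      eval2 A x y / eval2 B x y = eval2 A' x y / eval2 B' x y"
    using assms by blast
next
  fix v assume "\<exists>A' B'. W = Fraction_Field.Fract A' B' \<and> B' \<noteq> 0 \<and> eval2 B' x y \<noteq> 0 \<and>
      v = eval2 A' x y / eval2 B' x y"
  then obtain A' B' where *: "W = Fraction_Field.Fract A' B'" "B' \<noteq> 0" "eval2 B' x y \<noteq> 0"
    "v = eval2 A' x y / eval2 B' x y" by blast
  then have "A * B' = A' * B" using assms by (simp add: eq_fract)
  then have "eval2 A x y * eval2 B' x y = eval2 A' x y * eval2 B x y"
    by (metis eval2_mult)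
  then show "v = eval2 A x y / eval2 B x y"
    using assms(3) * by (metis nonzero_eq_divide_eq nonzero_divide_eq_eq frac_eq_eq)
qed

end

theory Submission
  imports Defs "HOL-Number_Theory.Number_Theory" "HOL-Computational_Algebra.Field_as_Ring"
begin

text \<open>
  Via the entries \<open>(1,2)\<close>, \<open>(2,3)\<close>, \<open>(1,3)\<close>, the open normal subgroups of \<open>H(R)\<close> are the open
  additive subgroups \<open>N\<close> of \<open>R\<^sup>3\<close> of the same index that contain \<open>(0, 0, r v\<^sub>1)\<close> and \<open>(0, 0, r v\<^sub>2)\<close> for
  all \<open>v \<in> N\<close> and \<open>r \<in> R\<close>. Let \<open>w\<close> be a uniformizer, \<open>y = p\<^bsup>-s\<^esup>\<close>, and let \<open>k\<close> be maximal such that the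
  first two coordinates of \<open>N\<close> are divisible by \<open>w\<^sup>k\<close>. Then normality says that \<open>N\<close> contains
  \<open>P\<^sub>k = 0 \<oplus> 0 \<oplus> w\<^sup>kR\<close>, and dividing the first two coordinates by \<open>w\<^sup>k\<close> shows that the zeta function is
  \<open>(1 - y\<^bsup>2f\<^esup>) \<Sum>\<^sub>k y\<^bsup>2fk\<^esup> L\<^sub>k\<close>, where \<open>L\<^sub>k\<close> counts all lattices containing \<open>P\<^sub>k\<close>.

  Refine \<open>L\<^sub>k\<close> to a vector \<open>V\<^sub>k\<close> by the dimension of \<open>R\<^sup>3/(N + pR\<^sup>3)\<close>. Passing from \<open>N\<close> to
  \<open>{v. pv \<in> N}\<close> gives \<open>V\<^sub>k = T V\<^bsub>max(k-e,0)\<^esub>\<close> with the lower triangular matrix \<open>T\<close> of size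
  \<open>2n + min(k,e) f\<close> whose entries count subspaces over \<open>\<bbbF>\<^sub>p\<close>, and \<open>V\<^sub>0\<close> is a fixed vector of \<open>T\<close>. This
  expresses the zeta function as a rational function of \<open>p\<close> and \<open>y\<close>. The functional equation
  holds because inverting \<open>p\<close> and \<open>y\<close> replaces \<open>T\<close> by its inverse, up to a diagonal conjugation.

  Two rational functions agree once they agree at infinitely many \<open>y\<close> for infinitely many \<open>p\<close>.
  So it suffices to have one ring \<open>R\<close> for each prime \<open>p \<equiv> 1\<close> modulo \<open>f\<close>; it is
  \<open>\<int>[X][[Y]]/(X\<^sup>f - a, Y\<^sup>e - p)\<close> for suitable \<open>a\<close>.
\<close>

section \<open>Gaussian binomials and the transfer matrix\<close>

text \<open>Write u = y^(2f), T_m for the transfer operator of size m, Z = V_0 and N = sum_k u^k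
  V_k. The truncation in max(k - e, 0) singles out the first e vectors, so N solves an inhomogeneous
  equation N = sum_(b<e) u^b T_(2n+bf) Z + u^e T_(3n) N with operators of several sizes. It survives
  inversion because these sizes are linked by an operator \<open>dn\<close>, independent of m, with
  T_(m+1) dn = T_m on vectors supported up to m: applying T_(3n) to the inverted equation reverses
  the order of its e terms, and its solution, rescaled by the diagonal \<open>gsc\<close>, turns out
  to be Z - N.

  Coordinate 3n, where Z vanishes, equals u^e y^(3n) times the sum of all coordinates of N.
  Comparing both sides there produces every constant: \<open>gsc\<close> at 3n gives the sign, the
  power of X and y^(-3n); the last rows give u^(2e) y^(6n); and 1 - 1/u = -(1 - u)/u takes one u
  away. The exponent of y is therefore 3n + 2f(2e - 1) = 5n + 2(e - 1)f.\<close>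

fun qbin :: "'a::comm_ring_1 \<Rightarrow> nat \<Rightarrow> nat \<Rightarrow> 'a" where
  "qbin q n 0 = 1"
| "qbin q 0 (Suc k) = 0"
| "qbin q (Suc n) (Suc k) = qbin q n k + q ^ Suc k * qbin q n (Suc k)"

lemma qbin_eq_0: "n < k \<Longrightarrow> qbin q n k = 0"
  by (induction q n k rule: qbin.induct) auto

lemma qbin_self [simp]: "qbin q n n = 1"
  by (induction n) (auto simp: qbin_eq_0)

text \<open>The other Pascal identity. The defining one compares neighbouring columns of the
  transfer matrix and gives \<open>dn\<close>; this one compares neighbouring rows and gives
  \<open>up\<close>. Counting subspaces along a hyperplane also leads to this form.\<close>

lemma qbin_Suc_Suc':
  "k \<le> n \<Longrightarrow> qbin q (Suc n) (Suc k) = q ^ (n - k) * qbin q n k + qbin q n (Suc k)"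
proof (induction n arbitrary: k)
  case 0
  then show ?case by simp
next
  case (Suc n)
  show ?case
  proof (cases k)
    case 0
    have "qbin q (Suc n) 1 = q ^ n + qbin q n 1"
      using Suc.IH[of 0] by simp
    then have "q * qbin q (Suc n) 1 = q ^ Suc n + q * qbin q n 1"
      by (simp add: algebra_simps)
    with \<open>k = 0\<close> show ?thesis by (simp add: algebra_simps)
  next
    case (Suc l)
    show ?thesis
    proof (cases "k = Suc n")
      case True
      then show ?thesis by (simp add: qbin_eq_0)
    next
      case False
      with Suc.prems Suc have kn: "k \<le> n" "l < n" by auto
      have e: "q ^ k * q ^ (n - k) = q ^ n" "q ^ Suc k * q ^ (n - k) = q ^ Suc n"
        "q ^ (n - l) * q ^ k = q ^ Suc n"
        using kn Suc by (simp_all flip: power_add power_Suc)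
      have nl: "Suc n - k = n - l" using Suc by simp
      have "qbin q (Suc (Suc n)) (Suc k)
          = (q ^ (n - l) * qbin q n l + qbin q n k) + q ^ Suc k * (q ^ (n - k) * qbin q n k + qbin q n (Suc k))"
        using Suc.IH[of l] Suc.IH[of k] kn Suc by simp
      also have "\<dots> = q ^ (n - l) * qbin q n l + qbin q n k + q ^ Suc n * qbin q n k + q ^ Suc k * qbin q n (Suc k)"
        unfolding e(2)[symmetric] by (simp only: algebra_simps)
      also have "\<dots> = q ^ (n - l) * (qbin q n l + q ^ Suc l * qbin q n (Suc l)) + (qbin q n k + q ^ Suc k * qbin q n (Suc k))"
      proof -
        have z: "q ^ (n - l) * (q ^ Suc l * qbin q n (Suc l)) = q ^ Suc n * qbin q n (Suc l)"
          using e(3) Suc by (simp only: mult.assoc[symmetric])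
        show ?thesis unfolding Suc distrib_left z by (simp only: ac_simps)
      qed
      also have "\<dots> = q ^ (Suc n - k) * qbin q (Suc n) k + qbin q (Suc n) (Suc k)"
        using Suc nl by simp
      finally show ?thesis .
    qed
  qed
qed

text \<open>The number of \<open>c\<close>-dimensional subspaces of an \<open>m\<close>-dimensional space over a field with
  \<open>x\<close> elements that meet a given \<open>j\<close>-dimensional subspace trivially is
  \<open>x ^ (j * c) * qbin x (m - j) c\<close>; here \<open>c = m - i\<close>.\<close>

definition transfer_coeff :: "'a::comm_ring_1 \<Rightarrow> 'a \<Rightarrow> nat \<Rightarrow> nat \<Rightarrow> nat \<Rightarrow> 'a" where
  "transfer_coeff x y m i j = y ^ i * x ^ (j * (m - i)) * qbin x (m - j) (m - i)"

text \<open>Cut off to 0 above m, so that matrices of different sizes act on one space of sequences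
  and can be composed.\<close>

definition transfer :: "'a::comm_ring_1 \<Rightarrow> 'a \<Rightarrow> nat \<Rightarrow> (nat \<Rightarrow> 'a) \<Rightarrow> nat \<Rightarrow> 'a" where
  "transfer x y m v i = (if i \<le> m then \<Sum>j\<le>i. transfer_coeff x y m i j * v j else 0)"

definition supp_le :: "nat \<Rightarrow> (nat \<Rightarrow> 'a::zero) \<Rightarrow> bool" where
  "supp_le m v \<longleftrightarrow> (\<forall>i>m. v i = 0)"

lemma transfer_coeff_upper: "i < j \<Longrightarrow> j \<le> m \<Longrightarrow> transfer_coeff x y m i j = 0"
  by (simp add: transfer_coeff_def qbin_eq_0)

lemma supp_le_tmat [simp]: "supp_le m (transfer x y m v)"
  by (simp add: supp_le_def transfer_def)

lemma supp_le_mono: "supp_le m v \<Longrightarrow> m \<le> n \<Longrightarrow> supp_le n v"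
  by (simp add: supp_le_def)

lemma transfer_add: "transfer x y m (\<lambda>i. v i + w i) i = transfer x y m v i + transfer x y m w i"
  by (simp add: transfer_def algebra_simps sum.distrib)

lemma transfer_scale: "transfer x y m (\<lambda>i. c * v i) i = c * transfer x y m v i"
  by (simp add: transfer_def algebra_simps sum_distrib_left)

lemma transfer_diff: "transfer x y m (\<lambda>i. v i - w i) i = transfer x y m v i - transfer x y m w i"
  by (simp add: transfer_def algebra_simps sum_subtractf)

lemma transfer_sum: "transfer x y m (\<lambda>i. \<Sum>b\<in>B. v b i) i = (\<Sum>b\<in>B. transfer x y m (v b) i)"
  by (induction B rule: infinite_finite_induct) (simp_all add: transfer_add, simp_all add: transfer_def)

lemma transfer_0: "transfer x y m v 0 = v 0"
  by (simp add: transfer_def transfer_coeff_def)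

lemma transfer_last: "transfer x y m v m = y ^ m * (\<Sum>j\<le>m. v j)"
  by (simp add: transfer_def transfer_coeff_def sum_distrib_left)

section \<open>Operators linking transfer matrices of consecutive sizes\<close>

definition up :: "'a::comm_ring_1 \<Rightarrow> 'a \<Rightarrow> (nat \<Rightarrow> 'a) \<Rightarrow> nat \<Rightarrow> 'a" where
  "up x y v i = x ^ i * v i + (if i = 0 then 0 else y * v (i - 1))"

text \<open>The operator \<open>up\<close> does not depend on m. For i <= m the identity is
  \<open>qbin_Suc_Suc'\<close> entry by entry; the new last row has all entries y^(m+1) and only
  sums the coordinates, so it gives y times the last coordinate of the smaller image.\<close>

lemma transfer_Suc:
  assumes "supp_le m v"
  shows "transfer x y (Suc m) v = up x y (transfer x y m v)"
proof
  fix i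
  have *: "transfer_coeff x y (Suc m) i j = x ^ i * transfer_coeff x y m i j + (if i = 0 then 0 else y * transfer_coeff x y m (i - 1) j)"
    if "j \<le> i" "i \<le> m" for j
  proof (cases i)
    case 0
    with that show ?thesis by (simp add: transfer_coeff_def)
  next
    case (Suc l)
    have e1: "Suc m - j = Suc (m - j)" "Suc m - i = Suc (m - i)" "m - l = Suc (m - i)"
      using that Suc by auto
    have e2: "(m - j) - (m - i) = i - j" using that by auto
    have p: "x ^ (j * Suc (m - i)) * x ^ (i - j) = x ^ i * x ^ (j * (m - i))"
      using that by (simp add: add.commute flip: power_add)
    have "transfer_coeff x y (Suc m) i j = y ^ i * x ^ (j * Suc (m - i)) * (x ^ (i - j) * qbin x (m - j) (m - i) + qbin x (m - j) (Suc (m - i)))"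
      unfolding transfer_coeff_def e1(1,2) using qbin_Suc_Suc'[of "m - i" "m - j" x] e2 that by simp
    also have "\<dots> = y ^ i * (x ^ (j * Suc (m - i)) * x ^ (i - j)) * qbin x (m - j) (m - i) + y ^ i * x ^ (j * Suc (m - i)) * qbin x (m - j) (Suc (m - i))"
      by (simp add: algebra_simps)
    also have "\<dots> = x ^ i * transfer_coeff x y m i j + y * transfer_coeff x y m (i - 1) j"
      unfolding p transfer_coeff_def using e1(3) Suc by (simp add: algebra_simps)
    finally show ?thesis using Suc by simp
  qed
  consider "i \<le> m" | "i = Suc m" | "i > Suc m" by linarith
  then show "transfer x y (Suc m) v i = up x y (transfer x y m v) i"
  proof cases
    case 1
    show ?thesis
    proof (cases i)
      case 0
      then show ?thesis by (simp add: transfer_0 up_def)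
    next
      case (Suc l)
      have "transfer x y (Suc m) v i = (\<Sum>j\<le>i. (x ^ i * transfer_coeff x y m i j + y * transfer_coeff x y m l j) * v j)"
        using 1 Suc * by (auto simp: transfer_def intro!: sum.cong)
      also have "\<dots> = x ^ i * (\<Sum>j\<le>i. transfer_coeff x y m i j * v j) + y * (\<Sum>j\<le>i. transfer_coeff x y m l j * v j)"
        by (simp add: algebra_simps sum.distrib sum_distrib_left)
      also have "(\<Sum>j\<le>i. transfer_coeff x y m l j * v j) = transfer x y m v l"
        using Suc 1 by (simp add: transfer_def transfer_coeff_upper)
      finally show ?thesis using Suc 1 by (simp add: up_def transfer_def)
    qed
  next
    case 2
    have "(\<Sum>j\<le>m. v j) = (\<Sum>j\<le>Suc m. v j)" using assms by (simp add: supp_le_def)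
    then show ?thesis using transfer_last[of x y "Suc m" v] transfer_last[of x y m v] 2
      by (simp add: up_def transfer_def[of x y m v "Suc m"])
  next
    case 3
    then show ?thesis by (auto simp: transfer_def up_def)
  qed
qed

text \<open>A difference operator, independent of m like \<open>up\<close>: composed on the right it
  makes the matrix of size m + 1 act like that of size m (\<open>transfer_dn\<close>), and it is
  \<open>up\<close> at inverted arguments conjugated by a diagonal (\<open>up_gsc\<close>).\<close>

definition dn :: "'a::field \<Rightarrow> (nat \<Rightarrow> 'a) \<Rightarrow> nat \<Rightarrow> 'a" where
  "dn x v i = inverse x ^ i * v i - (if i = 0 then 0 else inverse x ^ (i - 1) * v (i - 1))"

lemma supp_le_dn: "supp_le m v \<Longrightarrow> supp_le (Suc m) (dn x v)"
  by (auto simp: supp_le_def dn_def)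

text \<open>The defining Pascal identity, read as a difference of two neighbouring columns.\<close>

lemma transfer_coeff_dn:
  fixes x :: "'a::field"
  assumes "x \<noteq> 0" "j \<le> i" "i \<le> m"
  shows "inverse x ^ j * (transfer_coeff x y (Suc m) i j - transfer_coeff x y (Suc m) i (Suc j)) = transfer_coeff x y m i j"
proof -
  have e: "Suc m - j = Suc (m - j)" "Suc m - i = Suc (m - i)" using assms by auto
  have p: "x ^ (Suc j * Suc (m - i)) = x ^ (j * Suc (m - i)) * x ^ Suc (m - i)"
    by (simp only: mult_Suc power_add mult.commute)
  have "transfer_coeff x y (Suc m) i j - transfer_coeff x y (Suc m) i (Suc j)
      = y ^ i * x ^ (j * Suc (m - i)) * (qbin x (Suc (m - j)) (Suc (m - i)) - x ^ Suc (m - i) * qbin x (m - j) (Suc (m - i)))"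
    unfolding transfer_coeff_def e p by (simp add: algebra_simps)
  also have "\<dots> = x ^ j * transfer_coeff x y m i j"
    by (simp add: transfer_coeff_def power_add)
  finally show ?thesis using assms(1) by (simp add: power_inverse)
qed

lemma transfer_dn:
  fixes x :: "'a::field"
  assumes "x \<noteq> 0" "supp_le m v"
  shows "transfer x y (Suc m) (dn x v) = transfer x y m v"
proof
  fix i
  consider "i \<le> m" | "i = Suc m" | "i > Suc m" by linarith
  then show "transfer x y (Suc m) (dn x v) i = transfer x y m v i"
  proof cases
    case 1
    have "transfer x y (Suc m) (dn x v) i = (\<Sum>j\<le>Suc i. transfer_coeff x y (Suc m) i j * dn x v j)"
      using 1 by (simp add: transfer_def transfer_coeff_upper)
    also have "\<dots> = (\<Sum>j\<le>Suc i. transfer_coeff x y (Suc m) i j * (inverse x ^ j * v j))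
        - (\<Sum>j\<le>Suc i. transfer_coeff x y (Suc m) i j * (if j = 0 then 0 else inverse x ^ (j - 1) * v (j - 1)))"
      by (simp add: dn_def algebra_simps sum_subtractf del: sum.atMost_Suc)
    also have "\<dots> = (\<Sum>j\<le>i. transfer_coeff x y (Suc m) i j * (inverse x ^ j * v j))
        - (\<Sum>j\<le>i. transfer_coeff x y (Suc m) i (Suc j) * (inverse x ^ j * v j))"
    proof -
      have "(\<Sum>j\<le>Suc i. transfer_coeff x y (Suc m) i j * (inverse x ^ j * v j)) = (\<Sum>j\<le>i. transfer_coeff x y (Suc m) i j * (inverse x ^ j * v j))"
        using 1 by (simp add: transfer_coeff_upper)
      then show ?thesis by (simp add: sum.atMost_Suc_shift del: sum.atMost_Suc)
    qed
    also have "\<dots> = (\<Sum>j\<le>i. (inverse x ^ j * (transfer_coeff x y (Suc m) i j - transfer_coeff x y (Suc m) i (Suc j))) * v j)"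
      by (simp add: algebra_simps sum_subtractf)
    also have "\<dots> = transfer x y m v i"
      using 1 transfer_coeff_dn[OF assms(1)] by (auto simp: transfer_def intro!: sum.cong)
    finally show ?thesis .
  next
    case 2
    \<comment> \<open>In the last row all coefficients agree, so only the sum of the coordinates
      counts; it telescopes to a multiple of \<open>v (Suc m)\<close>, which is 0.\<close>
    have tele: "(\<Sum>j\<le>k. dn x v j) = inverse x ^ k * v k" for k
      by (induction k) (auto simp: dn_def)
    have "v (Suc m) = 0" using assms by (simp add: supp_le_def)
    then show ?thesis using transfer_last[of x y "Suc m" "dn x v"] 2 tele[of "Suc m"]
      by (simp add: transfer_def[of x y m])
  next
    case 3
    then show ?thesis by (auto simp: transfer_def)
  qed
qed

section \<open>The inverse of the transfer operator\<close>

lemma power_inverse_cancel: "(x::'a::field) \<noteq> 0 \<Longrightarrow> x ^ k * inverse x ^ k = 1"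
  by (simp flip: power_mult_distrib)

text \<open>The signs and triangular powers of q-binomial inversion. The factor y^(-i) turns the row
  factors of the matrix at (1/x, 1/y) into the column factors of the inverse matrix.\<close>

definition gsc :: "'a::field \<Rightarrow> 'a \<Rightarrow> nat \<Rightarrow> 'a" where
  "gsc x y i = (-1) ^ i * inverse y ^ i * x ^ (i choose 2)"

lemma gsc_nonzero: "x \<noteq> 0 \<Longrightarrow> y \<noteq> 0 \<Longrightarrow> gsc x y i \<noteq> 0"
  by (simp add: gsc_def)

lemma gsc_Suc: "gsc x y (Suc i) = - inverse y * x ^ i * gsc x y i"
  by (simp add: gsc_def numeral_2_eq_2 power_add)

text \<open>Conjugation by \<open>gsc\<close> of the transfer operator at \<open>(1/x, 1/y)\<close> inverts the operator at \<open>(x, y)\<close>.\<close>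

definition ctmat :: "'a::field \<Rightarrow> 'a \<Rightarrow> nat \<Rightarrow> (nat \<Rightarrow> 'a) \<Rightarrow> nat \<Rightarrow> 'a" where
  "ctmat x y m v i = transfer (inverse x) (inverse y) m (\<lambda>j. gsc x y j * v j) i / gsc x y i"

text \<open>Makes the conjugated inverted operator grow with m by \<open>dn\<close>, which is
  exactly what the original operator absorbs; this is why the conjugate is an inverse.\<close>

lemma up_gsc:
  fixes x :: "'a::field"
  assumes "x \<noteq> 0" "y \<noteq> 0"
  shows "up (inverse x) (inverse y) (\<lambda>j. gsc x y j * v j) i = gsc x y i * dn x v i"
proof (cases i)
  case (Suc l)
  have "gsc x y i * (inverse x ^ l * v l) = - (x ^ l * inverse x ^ l) * (inverse y * (gsc x y l * v l))"
    using Suc by (simp add: gsc_Suc mult_ac)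
  then show ?thesis
    using Suc power_inverse_cancel[OF assms(1), of l]
    by (simp add: up_def dn_def right_diff_distrib mult.left_commute)
qed (simp add: up_def dn_def)

lemma ctmat_Suc:
  fixes x :: "'a::field"
  assumes "x \<noteq> 0" "y \<noteq> 0" "supp_le m v"
  shows "ctmat x y (Suc m) v = dn x (ctmat x y m v)"
proof
  fix i
  have s: "supp_le m (\<lambda>j. gsc x y j * v j)" using assms by (simp add: supp_le_def)
  have "transfer (inverse x) (inverse y) m (\<lambda>j. gsc x y j * v j) = (\<lambda>j. gsc x y j * ctmat x y m v j)"
    using gsc_nonzero[OF assms(1,2)] by (simp add: ctmat_def)
  then show "ctmat x y (Suc m) v i = dn x (ctmat x y m v) i"
    using gsc_nonzero[OF assms(1,2)] up_gsc[OF assms(1,2), of "ctmat x y m v"] transfer_Suc[OF s]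
    by (simp add: ctmat_def[of x y "Suc m"])
qed

lemma supp_le_ctmat [simp]: "supp_le m (ctmat x y m v)"
  by (simp add: supp_le_def ctmat_def transfer_def)

lemma transfer_delta: "transfer x y m (\<lambda>j. if j = m then c else 0) = (\<lambda>j. if j = m then y ^ m * c else 0)"
  by (rule ext) (auto simp: transfer_def transfer_coeff_def if_distrib sum.delta cong: if_cong)

text \<open>Induction on m. On vectors supported up to m the conjugate grows by \<open>dn\<close>
  and the operator absorbs it, which leaves the smaller case; the remaining top basis vector is an
  eigenvector of both, with eigenvalues y^(m+1) and its inverse.\<close>

lemma transfer_ctmat:
  fixes x :: "'a::field"
  assumes "x \<noteq> 0" "y \<noteq> 0" "supp_le m v"
  shows "transfer x y m (ctmat x y m v) = v"
  using assms(3)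
proof (induction m arbitrary: v)
  case 0
  then show ?case
    by (auto simp: fun_eq_iff transfer_def transfer_coeff_def ctmat_def gsc_def supp_le_def)
next
  case (Suc m)
  define a where "a = (\<lambda>j. if j = Suc m then 0 else v j)"
  define d where "d = (\<lambda>j. if j = Suc m then v (Suc m) else 0)"
  have v: "v = (\<lambda>j. a j + d j)" by (auto simp: a_def d_def)
  have sa: "supp_le m a" using Suc.prems by (auto simp: a_def supp_le_def)
  have 1: "ctmat x y (Suc m) v = (\<lambda>j. ctmat x y (Suc m) a j + ctmat x y (Suc m) d j)"
    by (rule ext, subst v) (simp only: ctmat_def distrib_left transfer_add add_divide_distrib)
  have 2: "transfer x y (Suc m) (ctmat x y (Suc m) a) = a"
    using ctmat_Suc[OF assms(1,2) sa] transfer_dn[OF assms(1) supp_le_ctmat] Suc.IH[OF sa] by simp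
  have 3: "transfer x y (Suc m) (ctmat x y (Suc m) d) = d"
  proof -
    have g: "(\<lambda>j. gsc x y j * d j) = (\<lambda>j. if j = Suc m then gsc x y (Suc m) * v (Suc m) else 0)"
      by (auto simp: d_def)
    have "ctmat x y (Suc m) d = (\<lambda>j. if j = Suc m then inverse y ^ Suc m * v (Suc m) else 0)"
      unfolding fun_eq_iff ctmat_def g transfer_delta using gsc_nonzero[OF assms(1,2), of "Suc m"] by simp
    then show ?thesis using power_inverse_cancel[OF assms(2), of "Suc m"]
      by (simp only: transfer_delta d_def mult.assoc[symmetric] mult_1)
  qed
  show ?case
    by (rule ext) (simp only: 1 2 3 transfer_add, simp add: a_def d_def)
qed

lemma ctmat_dn_pow:
  fixes x :: "'a::field"
  assumes "x \<noteq> 0" "y \<noteq> 0" "supp_le m v"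
  shows "ctmat x y (m + r) v = (dn x ^^ r) (ctmat x y m v)"
proof (induction r)
  case (Suc r)
  have "supp_le (m + r) v" using assms(3) by (rule supp_le_mono) simp
  then show ?case using Suc ctmat_Suc[OF assms(1,2)] by simp
qed simp

lemma transfer_dn_pow:
  fixes x :: "'a::field"
  assumes "x \<noteq> 0" "supp_le m v"
  shows "transfer x y (m + r) ((dn x ^^ r) v) = transfer x y m v"
proof (induction r)
  case (Suc r)
  have "supp_le (m + r) ((dn x ^^ r) v)"
    using assms(2) by (induction r) (auto simp: supp_le_dn)
  then show ?case using Suc transfer_dn[OF assms(1)] by simp
qed simp

text \<open>The matrix is lower triangular with diagonal entries y^i x^(i (m - i)), so each
  coordinate is determined by the earlier ones, except coordinate 0, whose diagonal entry is 1 and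
  which has to be prescribed.\<close>

lemma transfer_fixed_unique:
  fixes v w :: "nat \<Rightarrow> 'a::field"
  assumes "\<And>i. 0 < i \<Longrightarrow> i \<le> m \<Longrightarrow> y ^ i * x ^ (i * (m - i)) \<noteq> 1"
  assumes "transfer x y m v = v" "transfer x y m w = w" "v 0 = w 0"
  shows "v = w"
proof
  fix i
  show "v i = w i"
  proof (induction i rule: less_induct)
    case (less i)
    consider "i = 0" | "i > m" | "0 < i" "i \<le> m" by linarith
    then show ?case
    proof cases
      case 1
      then show ?thesis using assms by simp
    next
      case 2
      then show ?thesis using fun_cong[OF assms(2), of i] fun_cong[OF assms(3), of i] by (simp add: transfer_def)
    next
      case 3
      have split: "u i = y ^ i * x ^ (i * (m - i)) * u i + (\<Sum>j<i. transfer_coeff x y m i j * u j)"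
        if "transfer x y m u = u" for u
      proof -
        have "u i = (\<Sum>j\<le>i. transfer_coeff x y m i j * u j)" using fun_cong[OF that, of i] 3 by (simp add: transfer_def)
        also have "\<dots> = transfer_coeff x y m i i * u i + (\<Sum>j<i. transfer_coeff x y m i j * u j)"
          by (simp flip: lessThan_Suc_atMost)
        finally show ?thesis by (simp add: transfer_coeff_def)
      qed
      have "(\<Sum>j<i. transfer_coeff x y m i j * v j) = (\<Sum>j<i. transfer_coeff x y m i j * w j)"
        by (intro sum.cong) (auto simp: less)
      moreover have "(1 - y ^ i * x ^ (i * (m - i))) * u i = (\<Sum>j<i. transfer_coeff x y m i j * u j)"
        if "transfer x y m u = u" for u
        unfolding left_diff_distrib diff_eq_eq mult_1_left using split[OF that] by (simp only: add.commute)
      ultimately have "(1 - y ^ i * x ^ (i * (m - i))) * v i = (1 - y ^ i * x ^ (i * (m - i))) * w i"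
        using assms(2,3) by simp
      with assms(1)[OF 3] show ?thesis by simp
    qed
  qed
qed

text \<open>Vectors are compared by showing that both solve the same triangular system;
  \<open>gen\<close> keeps the relevant diagonal entries away from 1.\<close>

lemma functional_equation:
  fixes x y :: "'a::field" and e f n :: nat
  defines "u \<equiv> y ^ (2 * f)"
  assumes n: "n = e * f" and ef: "e \<ge> 1" "f \<ge> 1"
    and x: "x \<noteq> 0" and y: "y \<noteq> 0"
    and gen: "\<And>i k. 0 < i \<Longrightarrow> y ^ i * x ^ k \<noteq> 1"
    and Z: "transfer x y (2 * n) Z = Z" "Z 0 = 1"
    and N: "\<And>i. N i = (\<Sum>b<e. u ^ b * transfer x y (2 * n + b * f) Z i) + u ^ e * transfer x y (3 * n) N i"
    and ZZ: "transfer (inverse x) (inverse y) (2 * n) ZZ = ZZ" "ZZ 0 = 1"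
    and NN: "\<And>i. NN i = (\<Sum>b<e. inverse u ^ b * transfer (inverse x) (inverse y) (2 * n + b * f) ZZ i)
               + inverse u ^ e * transfer (inverse x) (inverse y) (3 * n) NN i"
  shows "(1 - inverse u) * (\<Sum>i\<le>3*n. NN i)
    = (- 1) ^ (3 * n) * x ^ (3 * n choose 2) * y ^ (5 * n + 2 * (e - 1) * f) * ((1 - u) * (\<Sum>i\<le>3*n. N i))"
proof -
  note g0 = gsc_nonzero[OF x y]
  have u0: "u \<noteq> 0" using y by (simp add: u_def)
  define Z' where "Z' = (\<lambda>i. ZZ i / gsc x y i)"
  define N' where "N' = (\<lambda>i. NN i / gsc x y i)"
  have sZ: "supp_le (2 * n) Z" using supp_le_tmat[of "2*n" x y Z] Z by simp
  have bN: "b * f < n" if "b < e" for b using that ef n by simp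
  have ZZ': "ZZ = (\<lambda>i. gsc x y i * Z' i)" and NN': "NN = (\<lambda>i. gsc x y i * N' i)"
    using g0 by (simp_all add: Z'_def N'_def)
  have cZ': "ctmat x y (2 * n) Z' = Z'"
    unfolding fun_eq_iff ctmat_def ZZ'[symmetric] ZZ(1) by (simp add: Z'_def)
  then have sZ': "supp_le (2 * n) Z'" by (metis supp_le_ctmat)
  \<comment> \<open>The rescaled inverted vector is fixed by the inverse of the operator, hence by
    the operator itself, and it agrees with Z at 0.\<close>
  have "transfer x y (2 * n) Z' = Z'" using transfer_ctmat[OF x y sZ'] cZ' by simp
  then have Z'Z: "Z' = Z"
    by (rule transfer_fixed_unique[rotated, OF _ Z(1)]) (auto simp: gen Z'_def ZZ Z gsc_def numeral_2_eq_2)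
  have N'eq: "N' i = (\<Sum>b<e. inverse u ^ b * ctmat x y (2 * n + b * f) Z i)
      + inverse u ^ e * ctmat x y (3 * n) N' i" for i
  proof -
    have c: "ctmat x y m Z i = transfer (inverse x) (inverse y) m ZZ i / gsc x y i"
      "ctmat x y m N' i = transfer (inverse x) (inverse y) m NN i / gsc x y i" for m
      unfolding ctmat_def Z'Z[symmetric] ZZ'[symmetric] NN'[symmetric] by simp_all
    have "N' i = NN i / gsc x y i" by (simp add: N'_def)
    also have "\<dots> = (\<Sum>b<e. inverse u ^ b * ctmat x y (2 * n + b * f) Z i)
      + inverse u ^ e * ctmat x y (3 * n) N' i"
      by (subst NN) (simp only: c add_divide_distrib sum_divide_distrib times_divide_eq_right)
    finally show ?thesis .
  qed
  have sN: "supp_le (3 * n) N"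
    unfolding supp_le_def
  proof (intro allI impI)
    fix i assume i: "i > 3 * n"
    have "transfer x y (2 * n + b * f) v i = 0" if "b < e" for b v
      using bN[OF that] i by (simp add: transfer_def)
    moreover have "transfer x y (3 * n) v i = 0" for v using i by (simp add: transfer_def)
    ultimately show "N i = 0" by (subst N) simp
  qed
  have sN': "supp_le (3 * n) N'"
    unfolding supp_le_def
  proof (intro allI impI)
    fix i assume i: "i > 3 * n"
    have "ctmat x y (2 * n + b * f) v i = 0" if "b < e" for b v
      using bN[OF that] i by (simp add: ctmat_def transfer_def)
    moreover have "ctmat x y (3 * n) v i = 0" for v using i by (simp add: ctmat_def transfer_def)
    ultimately show "N' i = 0" by (subst N'eq) simp
  qed
  \<comment> \<open>As Z is fixed by the conjugate of size 2n, the one of size 2n + bf yields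
    \<open>dn\<close> applied bf times to Z. The operator of size 3n absorbs these and shrinks to
    size 2n + (e - b)f.\<close>
  have key: "transfer x y (3 * n) (ctmat x y (2 * n + b * f) Z) = transfer x y (2 * n + (e - b) * f) Z"
    if "b < e" for b
  proof -
    have *: "ctmat x y (2 * n + b * f) Z = (dn x ^^ (b * f)) Z"
      using ctmat_dn_pow[OF x y sZ, of "b * f"] cZ' Z'Z by simp
    have e: "3 * n = 2 * n + (e - b) * f + b * f"
      using that n by (simp add: algebra_simps flip: distrib_right)
    show ?thesis unfolding * e
      by (rule transfer_dn_pow[OF x]) (rule supp_le_mono[OF sZ], simp)
  qed
  define w where "w = (\<lambda>i. \<Sum>b<e. u ^ b * transfer x y (2 * n + b * f) Z i)"
  define T where "T = transfer x y (3 * n)"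
  have N1: "N i = w i + u ^ e * T N i" for i using N[of i] by (simp add: w_def T_def)
  have "T N' i = (\<Sum>b<e. inverse u ^ b * transfer x y (2 * n + (e - b) * f) Z i) + inverse u ^ e * N' i" for i
  proof -
    have "T N' i = (\<Sum>b<e. inverse u ^ b * T (ctmat x y (2 * n + b * f) Z) i)
        + inverse u ^ e * T (ctmat x y (3 * n) N') i"
      using arg_cong[OF ext[of N', OF N'eq], of "\<lambda>v. T v i"]
      unfolding T_def by (simp only: transfer_add transfer_sum transfer_scale)
    then show ?thesis using key transfer_ctmat[OF x y sN'] by (simp add: T_def)
  qed
  then have e1: "u ^ e * T N' i = (\<Sum>b<e. u ^ e * inverse u ^ b * transfer x y (2 * n + (e - b) * f) Z i) + N' i" for i
    using u0 by (simp add: algebra_simps sum_distrib_left power_inverse)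
  \<comment> \<open>Reversed, the sum runs over 1, ..., e in place of 0, ..., e - 1: the term Z at 0
    is dropped and u^e T Z at e is added.\<close>
  have e2: "(\<Sum>b<e. u ^ e * inverse u ^ b * transfer x y (2 * n + (e - b) * f) Z i) = w i - Z i + u ^ e * T Z i" for i
  proof -
    have "(\<Sum>b<e. u ^ e * inverse u ^ b * transfer x y (2 * n + (e - b) * f) Z i)
        = (\<Sum>b<e. u ^ (e - b) * transfer x y (2 * n + (e - b) * f) Z i)"
      using u0 by (intro sum.cong) (auto simp: power_diff power_inverse divide_inverse)
    also have "\<dots> = (\<Sum>b<e. u ^ Suc b * transfer x y (2 * n + Suc b * f) Z i)"
      by (rule sum.reindex_bij_witness[of _ "\<lambda>b. e - Suc b" "\<lambda>b. e - Suc b"])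
        (auto simp: Suc_diff_Suc simp del: power_Suc mult_Suc)
    also have "\<dots> = (\<Sum>b<Suc e. u ^ b * transfer x y (2 * n + b * f) Z i) - Z i"
      using fun_cong[OF Z(1), of i] by (subst sum.lessThan_Suc_shift) simp
    also have "\<dots> = w i - Z i + u ^ e * T Z i"
      using n by (simp add: w_def T_def)
    finally show ?thesis .
  qed
  have N2: "N' i = u ^ e * T N' i - (w i - Z i + u ^ e * T Z i)" for i
    by (simp only: e1 e2 add_diff_cancel_left')
  \<comment> \<open>The claim is N' = Z - N. The defect solves D = u^e T D, whose diagonal entries
    y^(2n + i) x^(i (3n - i)) differ from 1, so it vanishes.\<close>
  define D where "D = (\<lambda>i. N' i - (Z i - N i))"
  have D: "D i = u ^ e * T D i" for i
  proof -
    have "T D i = T N' i - (T Z i - T N i)" by (simp add: D_def T_def transfer_diff)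
    then have *: "u ^ e * T D i = u ^ e * T N' i - (u ^ e * T Z i - u ^ e * T N i)"
      by (simp only: right_diff_distrib)
    show ?thesis unfolding * by (subst D_def, subst N1, subst N2) simp
  qed
  have ue: "u ^ e = y ^ (2 * n)" by (simp add: u_def n mult_ac flip: power_mult)
  have D0: "D i = 0" for i
  proof (induction i rule: less_induct)
    case (less i)
    show ?case
    proof (cases "i \<le> 3 * n")
      case False
      then show ?thesis by (subst D) (simp add: T_def transfer_def)
    next
      case True
      have "T D i = (\<Sum>j\<le>i. transfer_coeff x y (3*n) i j * D j)" using True by (simp add: T_def transfer_def)
      also have "\<dots> = transfer_coeff x y (3*n) i i * D i" using less
        by (simp flip: lessThan_Suc_atMost)
      finally have "D i = u ^ e * transfer_coeff x y (3*n) i i * D i" using D[of i] by (simp only: mult.assoc)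
      moreover have "u ^ e * transfer_coeff x y (3*n) i i = y ^ (2 * n + i) * x ^ (i * (3 * n - i))"
        by (simp add: ue transfer_coeff_def power_add)
      moreover have "2 * n + i > 0" using ef n by simp
      ultimately show ?thesis using gen[of "2 * n + i" "i * (3 * n - i)"] by simp
    qed
  qed
  \<comment> \<open>Coordinate 3n lies beyond the support of Z, and there the operator sums all
    coordinates, which is how the total sums enter.\<close>
  have NNlast: "NN (3 * n) = - gsc x y (3 * n) * N (3 * n)"
  proof -
    have "Z (3 * n) = 0" using sZ ef n by (simp add: supp_le_def)
    then have "N' (3 * n) = - N (3 * n)"
      using D0[of "3 * n"] unfolding D_def by (simp add: eq_neg_iff_add_eq_0)
    then show ?thesis unfolding NN' by simp
  qed
  have z: "transfer x' y' (2 * n + b * f) v (3 * n) = 0" if "b < e" for b v and x' y' :: 'a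
    using bN[OF that] by (simp add: transfer_def)
  have "N (3 * n) = u ^ e * (y ^ (3 * n) * (\<Sum>i\<le>3*n. N i))"
    by (subst N) (simp add: z transfer_last)
  moreover have "NN (3 * n) = inverse u ^ e * (inverse y ^ (3 * n) * (\<Sum>i\<le>3*n. NN i))"
    by (subst NN) (simp add: z transfer_last)
  ultimately have "inverse u ^ e * (inverse y ^ (3 * n) * (\<Sum>i\<le>3*n. NN i))
      = - gsc x y (3 * n) * (u ^ e * (y ^ (3 * n) * (\<Sum>i\<le>3*n. N i)))" (is "?L = ?R")
    using NNlast by simp
  then have "u ^ e * y ^ (3 * n) * ?L = u ^ e * y ^ (3 * n) * ?R" by simp
  moreover have "u ^ e * y ^ (3 * n) * ?L
      = (u ^ e * inverse u ^ e) * (y ^ (3 * n) * inverse y ^ (3 * n)) * (\<Sum>i\<le>3*n. NN i)"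
    by (simp only: mult_ac)
  moreover have "\<dots> = (\<Sum>i\<le>3*n. NN i)"
    by (simp only: power_inverse_cancel[OF u0] power_inverse_cancel[OF y] mult_1_left)
  moreover have "u ^ e * y ^ (3 * n) * ?R
      = - (gsc x y (3 * n) * y ^ (3 * n)) * (u ^ (2 * e) * y ^ (3 * n)) * (\<Sum>i\<le>3*n. N i)"
    unfolding mult_2 power_add
    by (simp only: mult_ac minus_mult_left[symmetric] minus_mult_right[symmetric])
  ultimately have sums: "(\<Sum>i\<le>3*n. NN i)
      = - (gsc x y (3 * n) * y ^ (3 * n)) * (u ^ (2 * e) * y ^ (3 * n)) * (\<Sum>i\<le>3*n. N i)"
    by simp
  have gy: "gsc x y (3 * n) * y ^ (3 * n) = (-1) ^ (3 * n) * x ^ (3 * n choose 2)"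
  proof -
    have "gsc x y (3 * n) * y ^ (3 * n)
        = (y ^ (3 * n) * inverse y ^ (3 * n)) * ((-1) ^ (3 * n) * x ^ (3 * n choose 2))"
      unfolding gsc_def by (simp only: mult_ac)
    then show ?thesis by (simp only: power_inverse_cancel[OF y] mult_1_left)
  qed
  \<comment> \<open>The two factors u^e make u^(2e); one u is set aside to be consumed by 1 - 1/u =
    -(1 - u)/u.\<close>
  have "2 * f * (2 * e) + 3 * n = 2 * f + (5 * n + 2 * (e - 1) * f)"
    using ef n by (cases e) (simp_all add: algebra_simps)
  then have uy: "u ^ (2 * e) * y ^ (3 * n) = u * y ^ (5 * n + 2 * (e - 1) * f)"
    unfolding u_def by (simp only: power_mult[symmetric] power_add[symmetric])
  have *: "(1 - inverse u) * u = - (1 - u)" using u0 by (simp add: algebra_simps)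
  have "(1 - inverse u) * (- P * (u * Q) * S) = P * Q * ((1 - u) * S)" for P Q S
  proof -
    have "(1 - inverse u) * (- P * (u * Q) * S) = - ((1 - inverse u) * u * (P * Q * S))"
      by (simp only: mult_ac minus_mult_left[symmetric] minus_mult_right[symmetric])
    also have "\<dots> = P * Q * ((1 - u) * S)"
      unfolding * by (simp only: mult_ac minus_mult_left[symmetric] minus_mult_right[symmetric] minus_minus)
    finally show ?thesis .
  qed
  then show ?thesis unfolding sums gy uy .
qed

section \<open>Additive subgroups and their indices\<close>

definition subgrp :: "'a::ab_group_add set \<Rightarrow> bool" where
  "subgrp N \<longleftrightarrow> 0 \<in> N \<and> (\<forall>x\<in>N. \<forall>y\<in>N. x - y \<in> N)"

text \<open>\<open>card\<close> makes an infinite index 0, so an equation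
  \<open>idx M N = p ^ m\<close> with p > 0 includes finiteness, and the laws for towers and
  transfers hold for infinite indices too.\<close>

definition idx :: "'a::ab_group_add set \<Rightarrow> 'a set \<Rightarrow> nat" where
  "idx M N = card ((\<lambda>x. (+) x ` N) ` M)"

definition ssum :: "'a::ab_group_add set \<Rightarrow> 'a set \<Rightarrow> 'a set" where
  "ssum A B = {a + b | a b. a \<in> A \<and> b \<in> B}"

lemma subgrp_0: "subgrp N \<Longrightarrow> 0 \<in> N"
  and subgrp_diff: "subgrp N \<Longrightarrow> x \<in> N \<Longrightarrow> y \<in> N \<Longrightarrow> x - y \<in> N"
  by (auto simp: subgrp_def)

lemma subgrp_minus: "subgrp N \<Longrightarrow> x \<in> N \<Longrightarrow> - x \<in> N"
  using subgrp_diff[of N 0 x] subgrp_0[of N] by simp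

lemma subgrp_add: "subgrp N \<Longrightarrow> x \<in> N \<Longrightarrow> y \<in> N \<Longrightarrow> x + y \<in> N"
  using subgrp_diff[of N x "- y"] subgrp_minus[of N y] by simp

lemma subgrp_minus_iff: "subgrp N \<Longrightarrow> - x \<in> N \<longleftrightarrow> x \<in> N"
  using subgrp_minus[of N x] subgrp_minus[of N "- x"] by auto

lemma subgrp_diff_commute: "subgrp N \<Longrightarrow> x - y \<in> N \<longleftrightarrow> y - x \<in> N"
  using subgrp_minus_iff[of N "x - y"] by simp

lemma subgrp_Int: "subgrp A \<Longrightarrow> subgrp B \<Longrightarrow> subgrp (A \<inter> B)"
  by (auto simp: subgrp_def)

lemma subgrp_UNIV [simp]: "subgrp UNIV"
  by (simp add: subgrp_def)

lemma ssumI: "a \<in> A \<Longrightarrow> b \<in> B \<Longrightarrow> x = a + b \<Longrightarrow> x \<in> ssum A B"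
  by (auto simp: ssum_def)

lemma subgrp_ssum:
  assumes "subgrp A" "subgrp B"
  shows "subgrp (ssum A B)"
  unfolding subgrp_def
proof (intro conjI ballI)
  show "0 \<in> ssum A B" using subgrp_0[OF assms(1)] subgrp_0[OF assms(2)]
    by (auto simp: ssum_def intro!: exI[of _ 0])
  fix x y assume "x \<in> ssum A B" "y \<in> ssum A B"
  then obtain a b a' b' where *: "x = a + b" "y = a' + b'" "a \<in> A" "b \<in> B" "a' \<in> A" "b' \<in> B"
    by (auto simp: ssum_def)
  then have "x - y = (a - a') + (b - b')" by simp
  then show "x - y \<in> ssum A B"
    using * subgrp_diff[OF assms(1), of a a'] subgrp_diff[OF assms(2), of b b'] by (intro ssumI[of "a - a'" A "b - b'" B]) auto
qed

lemma ssum_left: "subgrp B \<Longrightarrow> A \<subseteq> ssum A B"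
  using subgrp_0 by (force simp: ssum_def)

lemma ssum_right: "subgrp A \<Longrightarrow> B \<subseteq> ssum A B"
  using subgrp_0 by (force simp: ssum_def)

lemma ssum_commute: "ssum A B = ssum B A"
  by (auto simp: ssum_def) (metis add.commute)+

lemma ssum_least: "subgrp C \<Longrightarrow> A \<subseteq> C \<Longrightarrow> B \<subseteq> C \<Longrightarrow> ssum A B \<subseteq> C"
  by (auto simp: ssum_def intro!: subgrp_add)

lemma subgrp_of_nat: "subgrp N \<Longrightarrow> x \<in> N \<Longrightarrow> of_nat k * x \<in> (N :: 'a::comm_ring_1 set)"
  by (induction k) (auto simp: subgrp_0 subgrp_add algebra_simps)

lemma subgrp_of_int: "subgrp N \<Longrightarrow> x \<in> N \<Longrightarrow> of_int k * x \<in> (N :: 'a::comm_ring_1 set)"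
  by (cases k) (auto simp: subgrp_of_nat subgrp_minus_iff simp del: of_nat_Suc)

lemma coset_eq_iff:
  assumes "subgrp N"
  shows "(+) x ` N = (+) y ` N \<longleftrightarrow> x - y \<in> N"
proof
  assume *: "(+) x ` N = (+) y ` N"
  have "x \<in> (+) x ` N" using subgrp_0[OF assms] by force
  then have "x \<in> (+) y ` N" using * by simp
  then show "x - y \<in> N" by auto
next
  assume xy: "x - y \<in> N"
  have "(+) a ` N \<subseteq> (+) b ` N" if "a - b \<in> N" for a b
  proof
    fix z assume "z \<in> (+) a ` N"
    then obtain n where "n \<in> N" "z = a + n" by auto
    then have "z = b + ((a - b) + n)" "(a - b) + n \<in> N" using that assms subgrp_add by auto
    then show "z \<in> (+) b ` N" by blast
  qed
  then show "(+) x ` N = (+) y ` N" using xy subgrp_diff_commute[OF assms] by blast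
qed

lemma card_image_eq:
  assumes "\<And>x y. x \<in> A \<Longrightarrow> y \<in> A \<Longrightarrow> f x = f y \<longleftrightarrow> g x = g y"
  shows "card (f ` A) = card (g ` A)"
proof (rule bij_betw_same_card)
  have *: "g (inv_into A f (f x)) = g x" if "x \<in> A" for x
    using assms[of "inv_into A f (f x)" x] that by (simp add: inv_into_into f_inv_into_f)
  show "bij_betw (\<lambda>u. g (inv_into A f u)) (f ` A) (g ` A)"
    unfolding bij_betw_def
  proof
    show "inj_on (\<lambda>u. g (inv_into A f u)) (f ` A)"
      using * assms by (auto simp: inj_on_def)
    show "(\<lambda>u. g (inv_into A f u)) ` f ` A = g ` A"
      unfolding image_image using * by (intro image_cong) auto
  qed
qed

text \<open>An isomorphism of the quotients M/N and M'/N' given on representatives: h has to respect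
  differences modulo the subgroups and to be onto modulo N'.\<close>

lemma idx_transfer:
  assumes "subgrp N" "subgrp N'"
    and into: "\<And>x. x \<in> M \<Longrightarrow> h x \<in> M'"
    and rel: "\<And>x y. x \<in> M \<Longrightarrow> y \<in> M \<Longrightarrow> h x - h y \<in> N' \<longleftrightarrow> x - y \<in> N"
    and onto: "\<And>z. z \<in> M' \<Longrightarrow> \<exists>x\<in>M. h x - z \<in> N'"
  shows "idx M N = idx M' N'"
proof -
  have "(\<lambda>x. (+) (h x) ` N') ` M = (\<lambda>z. (+) z ` N') ` M'"
  proof
    show "(\<lambda>z. (+) z ` N') ` M' \<subseteq> (\<lambda>x. (+) (h x) ` N') ` M"
      using onto coset_eq_iff[OF assms(2)] by (smt (verit) image_iff subsetI)
  qed (use into in blast)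
  moreover have "card ((\<lambda>x. (+) x ` N) ` M) = card ((\<lambda>x. (+) (h x) ` N') ` M)"
    by (rule card_image_eq) (simp add: coset_eq_iff assms(1,2) rel)
  ultimately show ?thesis by (simp add: idx_def)
qed

lemma idx_tower:
  assumes "subgrp N" "subgrp K" "subgrp M" "N \<subseteq> K" "K \<subseteq> M"
  shows "idx M N = idx M K * idx K N"
proof -
  define r where "r x = (SOME y. y \<in> (+) x ` K)" for x
  have r: "r x \<in> (+) x ` K" for x
    unfolding r_def by (rule someI[of _ "x + 0"]) (rule imageI, rule subgrp_0[OF assms(2)])
  have r1: "x - r x \<in> K" for x
    using r[of x] subgrp_minus[OF assms(2)] by auto
  have r2: "r x = r y" if "x - y \<in> K" for x y
  proof -
    have "(+) x ` K = (+) y ` K" using that coset_eq_iff[OF assms(2)] by blast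
    then show ?thesis by (simp only: r_def)
  qed
  define g where "g x = ((+) x ` K, (+) (x - r x) ` N)" for x
  have "card ((\<lambda>x. (+) x ` N) ` M) = card (g ` M)"
  proof (rule card_image_eq)
    fix x y
    show "(+) x ` N = (+) y ` N \<longleftrightarrow> g x = g y"
    proof (cases "x - y \<in> K")
      case True
      then have "x - r x - (y - r y) = x - y" using r2 by simp
      then show ?thesis using True unfolding g_def prod.inject coset_eq_iff[OF assms(1)] coset_eq_iff[OF assms(2)]
        by simp
    next
      case False
      then show ?thesis using assms(4) unfolding g_def prod.inject coset_eq_iff[OF assms(1)] coset_eq_iff[OF assms(2)]
        by blast
    qed
  qed
  also have "g ` M = (\<lambda>x. (+) x ` K) ` M \<times> (\<lambda>x. (+) x ` N) ` K"
  proof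
    show "g ` M \<subseteq> (\<lambda>x. (+) x ` K) ` M \<times> (\<lambda>x. (+) x ` N) ` K"
      using r1 by (auto simp: g_def)
    show "(\<lambda>x. (+) x ` K) ` M \<times> (\<lambda>x. (+) x ` N) ` K \<subseteq> g ` M"
    proof clarify
      fix x k assume xk: "x \<in> M" "k \<in> K"
      define z where "z = r x + k"
      have zx: "z - x \<in> K" unfolding z_def using r[of x] xk subgrp_add[OF assms(2)] by (auto simp: algebra_simps)
      then have "z \<in> M" using xk(1) subgrp_add[OF assms(3), of "z - x" x] assms(5) by auto
      moreover have "(+) z ` K = (+) x ` K" using coset_eq_iff[OF assms(2)] zx by blast
      moreover have "z - r z = k" using r2[OF zx] by (simp add: z_def)
      ultimately have "g z = ((+) x ` K, (+) k ` N)" "z \<in> M" by (simp_all add: g_def)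
      then show "((+) x ` K, (+) k ` N) \<in> g ` M" by (metis image_eqI)
    qed
  qed
  finally show ?thesis by (simp add: idx_def card_cartesian_product)
qed

lemma idx_self [simp]: "subgrp N \<Longrightarrow> idx N N = 1"
proof -
  assume N: "subgrp N"
  have "(\<lambda>x. (+) x ` N) ` N = {(+) 0 ` N}"
    using coset_eq_iff[OF N, of _ 0] subgrp_0[OF N] by auto
  then show ?thesis by (simp add: idx_def)
qed

lemma idx_eq_1D:
  assumes "idx M N = 1" "subgrp N" "subgrp M" "N \<subseteq> M"
  shows "N = M"
proof -
  obtain C where C: "(\<lambda>x. (+) x ` N) ` M = {C}" using assms(1) unfolding idx_def by (rule card_1_singletonE)
  have "x \<in> N" if "x \<in> M" for x
  proof -
    have "(+) y ` N = C" if "y \<in> M" for y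
      using imageI[OF that, of "\<lambda>x. (+) x ` N"] unfolding C by (rule singletonD)
    then have "(+) x ` N = (+) 0 ` N" using that subgrp_0[OF assms(3)] by (simp only:)
    then show ?thesis using coset_eq_iff[OF assms(2), of x 0] by simp
  qed
  with assms(4) show ?thesis by blast
qed

lemma idx_ssum:
  assumes A: "subgrp A" and B: "subgrp B"
  shows "idx (ssum A B) B = idx A (A \<inter> B)"
proof (rule idx_transfer[symmetric, where h = "\<lambda>x. x"])
  show "\<And>x. x \<in> A \<Longrightarrow> x \<in> ssum A B" using ssum_left[OF B] by blast
  fix x y assume "x \<in> A" "y \<in> A"
  then have "x - y \<in> A" by (rule subgrp_diff[OF A])
  then show "x - y \<in> B \<longleftrightarrow> x - y \<in> A \<inter> B" by blast
next
  fix z assume "z \<in> ssum A B"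
  then obtain a b where ab: "a \<in> A" "b \<in> B" "z = a + b" by (auto simp: ssum_def)
  then have "a - z \<in> B" using subgrp_minus[OF B] by simp
  with ab(1) show "\<exists>x\<in>A. x - z \<in> B" by blast
qed (rule subgrp_Int[OF A B], rule B)

text \<open>Such a subgroup is the union of the B-cosets it contains, and M has only finitely many
  of them.\<close>

lemma finite_subgroups_between:
  assumes "idx M B \<noteq> 0" "subgrp B"
  shows "finite {N. subgrp N \<and> B \<subseteq> N \<and> N \<subseteq> M}"
proof (rule finite_imageD)
  let ?c = "\<lambda>N. (\<lambda>x. (+) x ` B) ` N"
  have fin: "finite (?c M)" using assms(1) by (auto simp: idx_def intro: card_ge_0_finite)
  have "?c ` {N. subgrp N \<and> B \<subseteq> N \<and> N \<subseteq> M} \<subseteq> Pow (?c M)" by blast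
  then show "finite (?c ` {N. subgrp N \<and> B \<subseteq> N \<and> N \<subseteq> M})"
    by (rule finite_subset) (simp add: fin)
  have "\<Union> (?c N) = N" if "subgrp N" "B \<subseteq> N" for N
  proof
    show "\<Union> (?c N) \<subseteq> N" using that subgrp_add[OF that(1)] by auto
    show "N \<subseteq> \<Union> (?c N)" using subgrp_0[OF assms(2)] by force
  qed
  then show "inj_on ?c {N. subgrp N \<and> B \<subseteq> N \<and> N \<subseteq> M}"
    by (intro inj_on_inverseI[where g = Union]) auto
qed

section \<open>Extension by one element and subspaces over the prime field\<close>

definition adj :: "'a::comm_ring_1 set \<Rightarrow> 'a \<Rightarrow> 'a set" where
  "adj H v = {h + of_int k * v | h k. h \<in> H}"

lemma adjI: "h \<in> H \<Longrightarrow> x = h + of_int k * v \<Longrightarrow> x \<in> adj H v"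
  by (auto simp: adj_def)

lemma subgrp_adj:
  assumes "subgrp H" shows "subgrp (adj H v)"
  unfolding subgrp_def
proof (intro conjI ballI)
  show "0 \<in> adj H v" using subgrp_0[OF assms] by (force simp: adj_def intro: exI[of _ 0])
  fix x y assume "x \<in> adj H v" "y \<in> adj H v"
  then obtain a k b l where *: "x = a + of_int k * v" "y = b + of_int l * v" "a \<in> H" "b \<in> H"
    by (auto simp: adj_def)
  then have "x - y = (a - b) + of_int (k - l) * v" by (simp add: algebra_simps)
  then show "x - y \<in> adj H v" using * subgrp_diff[OF assms, of a b] by (intro adjI)
qed

lemma adj_base: "H \<subseteq> adj H v"
  by (force simp: adj_def intro: exI[of _ 0])

lemma adj_mem: "subgrp H \<Longrightarrow> v \<in> adj H v"
  using subgrp_0 by (force simp: adj_def intro: exI[of _ 1])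

lemma adj_least: "subgrp N \<Longrightarrow> H \<subseteq> N \<Longrightarrow> v \<in> N \<Longrightarrow> adj H v \<subseteq> N"
  by (auto simp: adj_def intro!: subgrp_add subgrp_of_int)

lemma of_int_mult_mem_iff:
  fixes H :: "'a::comm_ring_1 set"
  assumes "Factorial_Ring.prime p" "subgrp H" "v \<notin> H" "of_nat p * v \<in> H"
  shows "of_int k * v \<in> H \<longleftrightarrow> int p dvd k"
proof
  assume k: "of_int k * v \<in> H"
  show "int p dvd k"
  proof (rule ccontr)
    assume "\<not> int p dvd k"
    then have "coprime (int p) k" using assms(1) by (simp add: prime_imp_coprime)
    then obtain a b where ab: "a * int p + b * k = 1"
      using bezout_int[of "int p" k] by (auto simp: coprime_iff_gcd_eq_1)
    have "v = of_int (a * int p + b * k) * v" by (simp add: ab)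
    also have "\<dots> = of_int a * (of_nat p * v) + of_int b * (of_int k * v)" by (simp add: algebra_simps)
    also have "\<dots> \<in> H" using subgrp_add[OF assms(2) subgrp_of_int[OF assms(2,4)] subgrp_of_int[OF assms(2) k]] .
    finally show False using assms by simp
  qed
next
  assume "int p dvd k"
  then obtain l where "k = int p * l" by auto
  then have "of_int k * v = of_int l * (of_nat p * v)" by simp
  then show "of_int k * v \<in> H" using subgrp_of_int[OF assms(2,4)] by simp
qed

lemma idx_adj:
  fixes H :: "'a::comm_ring_1 set"
  assumes "Factorial_Ring.prime p" "subgrp H" "v \<notin> H" "of_nat p * v \<in> H"
  shows "idx (adj H v) H = p"
proof -
  let ?c = "\<lambda>x. (+) x ` H"
  let ?g = "\<lambda>k. ?c (of_int k * v)"
  have p: "p > 0" using assms(1) prime_gt_0_nat by blast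
  have dist: "?g k = ?g l \<longleftrightarrow> int p dvd k - l" for k l
    using coset_eq_iff[OF assms(2), of "of_int k * v" "of_int l * v"]
      of_int_mult_mem_iff[OF assms, of "k - l"] by (simp add: left_diff_distrib)
  have "?c ` adj H v = ?g ` {0..<int p}"
  proof
    show "?c ` adj H v \<subseteq> ?g ` {0..<int p}"
    proof
      fix C assume "C \<in> ?c ` adj H v"
      then obtain h k where hk: "h \<in> H" "C = ?c (h + of_int k * v)" by (auto simp: adj_def)
      then have "C = ?g k" using coset_eq_iff[OF assms(2), of "h + of_int k * v" "of_int k * v"] by simp
      also have "\<dots> = ?g (k mod int p)" using dist[of k "k mod int p"] by (simp add: minus_mod_eq_mult_div)
      finally show "C \<in> ?g ` {0..<int p}" using p by auto
    qed
    show "?g ` {0..<int p} \<subseteq> ?c ` adj H v"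
      using subgrp_0[OF assms(2)] by (force simp: adj_def)
  qed
  moreover have "inj_on ?g {0..<int p}"
  proof (rule inj_onI)
    fix k l assume "k \<in> {0..<int p}" "l \<in> {0..<int p}" "?g k = ?g l"
    then show "k = l" using dist[of k l] zdvd_not_zless[of "k - l" "int p"] zdvd_not_zless[of "l - k" "int p"]
      by (auto simp: dvd_diff_commute) (metis dvd_diff_commute linorder_neqE_linordered_idom diff_gt_0_iff_gt)
  qed
  ultimately show ?thesis by (simp add: idx_def card_image)
qed

text \<open>Among the proper subgroups of M over U take one of least index: adjoining an outside
  element divides the index by p, so minimality forces the result to be all of M.\<close>

lemma hyperplane_exists:
  fixes M U :: "'a::comm_ring_1 set"
  assumes "Factorial_Ring.prime p" "subgrp M" "subgrp U" "U \<subseteq> M" "U \<noteq> M" "idx M U \<noteq> 0"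
    and pM: "\<And>x. x \<in> M \<Longrightarrow> of_nat p * x \<in> U"
  shows "\<exists>H. subgrp H \<and> U \<subseteq> H \<and> H \<subseteq> M \<and> idx M H = p"
proof -
  let ?S = "\<lambda>H. subgrp H \<and> U \<subseteq> H \<and> H \<subset> M"
  have "?S U" using assms by blast
  then obtain H where H: "?S H" and min: "\<And>H'. ?S H' \<Longrightarrow> idx M H \<le> idx M H'"
    using ex_has_least_nat[of ?S U "idx M"] by auto
  obtain v where v: "v \<in> M" "v \<notin> H" using H by blast
  have pv: "of_nat p * v \<in> H" using pM[OF v(1)] H by blast
  have H1: "subgrp (adj H v)" "H \<subseteq> adj H v" "adj H v \<subseteq> M"
    using H subgrp_adj adj_base adj_least[of M H v] assms(2) v by blast+
  have i: "idx (adj H v) H = p" using idx_adj[OF assms(1) _ v(2) pv] H by blast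
  have t: "idx M H = idx M (adj H v) * p"
    using idx_tower[of H "adj H v" M] H H1 assms(2) i by auto
  have "idx M U = idx M H * idx H U" using idx_tower[of U H M] H assms by auto
  then have nz: "idx M H \<noteq> 0" using assms(6) by auto
  have "adj H v = M"
  proof (rule ccontr)
    assume "adj H v \<noteq> M"
    then have "idx M H \<le> idx M (adj H v)" using min[of "adj H v"] H H1 by blast
    moreover have "p \<ge> 2" using assms(1) by (rule prime_ge_2_nat)
    then have "idx M (adj H v) * 2 \<le> idx M (adj H v) * p" by simp
    ultimately show False using t nz by simp
  qed
  then show ?thesis using H i by blast
qed

lemma power_eq_cancel: "(p::nat) > 0 \<Longrightarrow> p ^ (a + b) = p ^ a * x \<Longrightarrow> x = p ^ b"
  by (simp add: power_add)

text \<open>Induction along hyperplanes containing \<open>U\<close>: a subspace not inside the hyperplane \<open>H\<close> is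
  spanned by its trace on \<open>H\<close> and a vector of a fixed translate of \<open>H\<close>.\<close>

lemma card_subspaces:
  fixes B U M :: "'a::comm_ring_1 set"
  assumes "Factorial_Ring.prime p" "subgrp B" "subgrp U" "B \<subseteq> U" "idx U B = p ^ r"
    and "subgrp M" "U \<subseteq> M" "\<And>x. x \<in> M \<Longrightarrow> of_nat p * x \<in> B" "idx M B = p ^ m"
  shows "int (card {N. subgrp N \<and> B \<subseteq> N \<and> N \<subseteq> M \<and> N \<inter> U = B \<and> idx N B = p ^ c})
    = int p ^ (r * c) * qbin (int p) (m - r) c"
  using assms(6-9)
proof (induction "m - r" arbitrary: M m c)
  case 0
  have p1: "p > 1" using assms(1) prime_gt_1_nat by blast
  have "p ^ m = idx M U * p ^ r" using idx_tower[of B U M] assms 0 by simp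
  moreover have "idx M U \<noteq> 0" using calculation p1 by (metis mult_is_0 power_not_zero not_one_less_zero)
  ultimately have "p ^ r \<le> p ^ m" by simp
  then have "m = r" using p1 0 by simp
  with \<open>p ^ m = _\<close> p1 have "idx M U = 1" by simp
  then have "U = M" using idx_eq_1D assms 0 by blast
  then have "{N. subgrp N \<and> B \<subseteq> N \<and> N \<subseteq> M \<and> N \<inter> U = B \<and> idx N B = p ^ c} = (if c = 0 then {B} else {})"
  proof -
    have "c = 0" if "1 = p ^ c" using that p1 by (metis nat_power_eq_Suc_0_iff One_nat_def less_irrefl)
    then show ?thesis using \<open>U = M\<close> assms(2) assms(4) 0(2) by (auto simp: Int_absorb2)
  qed
  then have "card {N. subgrp N \<and> B \<subseteq> N \<and> N \<subseteq> M \<and> N \<inter> U = B \<and> idx N B = p ^ c} = (if c = 0 then 1 else 0)"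
    by simp
  then show ?case using \<open>m = r\<close> by (cases c) simp_all
next
  case (Suc d)
  note M = \<open>subgrp M\<close> \<open>U \<subseteq> M\<close> and pM = Suc.prems(3) and iM = \<open>idx M B = p ^ m\<close>
  have p1: "p > 1" and p0: "p > 0" using prime_gt_1_nat[OF assms(1)] by simp_all
  have m: "m = Suc (r + d)" using Suc(2) by simp
  have "U \<noteq> M"
  proof
    assume "U = M"
    then have "p ^ m = p ^ r" using iM assms(5) by simp
    then have "m = r" using p1 power_inject_exp by blast
    then show False using m by simp
  qed
  have "idx M B = idx M U * idx U B" using idx_tower[of B U M] assms M by simp
  then have "idx M U \<noteq> 0" using iM p1 by (metis mult_is_0 power_not_zero not_one_less_zero)
  \<comment> \<open>Since U lies in H, the condition \<open>N \<inter> U = B\<close> only concerns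
    the trace of N on H, so it passes to the induction hypothesis.\<close>
  then obtain H where H: "subgrp H" "U \<subseteq> H" "H \<subseteq> M" "idx M H = p"
    using hyperplane_exists[OF assms(1) M(1) assms(3) M(2) \<open>U \<noteq> M\<close>] pM assms(4) by blast
  have BH: "B \<subseteq> H" using assms(4) H(2) by blast
  have "idx M B = p * idx H B" using idx_tower[of B H M] H assms M BH by simp
  then have iH: "idx H B = p ^ (r + d)" using iM m p0 by simp
  obtain v where v: "v \<in> M" "v \<notin> H"
    using H p1 idx_self[OF H(1)] by (metis less_irrefl subset_antisym subsetI)
  have pB: "of_nat p * x \<in> B" if "x \<in> M" for x using pM that by blast
  have vh: "v + h \<in> M" "v + h \<notin> H" if "h \<in> H" for h
  proof -
    show "v + h \<in> M" using subgrp_add[OF M(1) v(1)] that H(3) by blast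
    show "v + h \<notin> H"
    proof
      assume "v + h \<in> H"
      from subgrp_diff[OF H(1) this that] v(2) show False by simp
    qed
  qed
  have adjM: "adj H v = M"
  proof -
    have "subgrp (adj H v)" "adj H v \<subseteq> M" using subgrp_adj[OF H(1)] adj_least[OF M(1) H(3) v(1)] by auto
    moreover have "idx (adj H v) H = p"
      using idx_adj[OF assms(1) H(1) v(2)] pB[OF v(1)] BH by blast
    then have "idx M (adj H v) = 1"
      using idx_tower[of H "adj H v" M] H M calculation adj_base[of H v] p0 by simp
    ultimately show ?thesis using idx_eq_1D M(1) by blast
  qed
  have kv: "of_int k * w \<in> H \<longleftrightarrow> int p dvd k" if "w \<in> M" "w \<notin> H" for k w
    using of_int_mult_mem_iff[OF assms(1) H(1) that(2)] pB[OF that(1)] BH by blast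
  have pdv: "of_int k * w \<in> B" if "w \<in> M" "int p dvd k" for k w
  proof -
    obtain l where "k = int p * l" using \<open>int p dvd k\<close> by auto
    then have "of_int k * w = of_int l * (of_nat p * w)" by simp
    then show ?thesis using subgrp_of_int[OF assms(2) pB[OF that(1)]] by simp
  qed
  let ?S = "\<lambda>M c. {N. subgrp N \<and> B \<subseteq> N \<and> N \<subseteq> M \<and> N \<inter> U = B \<and> idx N B = p ^ c}"
  have IH: "int (card (?S H c)) = int p ^ (r * c) * qbin (int p) d c" for c
    using Suc(1)[of "r + d" H c] H pB iH by auto
  have fin: "finite (?S M c)" for c
    by (rule finite_subset[OF _ finite_subgroups_between[of M B]]) (use iM assms p0 in auto)
  define S2 where "S2 = {N \<in> ?S M c. \<not> N \<subseteq> H}"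
  have S2D: "subgrp N" "B \<subseteq> N" "N \<subseteq> M" "\<not> N \<subseteq> H" "N \<inter> U = B" "idx N B = p ^ c" if "N \<in> S2" for N
    using that by (simp_all add: S2_def)
  have Un: "?S M c = ?S H c \<union> S2" and disj: "?S H c \<inter> S2 = {}"
    using H(3) by (auto simp: S2_def)
  have finS2: "finite S2" by (rule finite_subset[OF _ fin[of c]]) (auto simp: S2_def)
  have "finite (?S H c)" by (rule finite_subset[OF _ fin[of c]]) (use H(3) in auto)
  then have split: "card (?S M c) = card (?S H c) + card S2"
    unfolding Un using finS2 disj by (rule card_Un_disjoint)
  \<comment> \<open>An element of N outside H is h + k v with k prime to p; a Bezout multiple of it
    lies in v + H, and N is spanned by that multiple and its trace on H.\<close>
  have S2N: "\<exists>w. w \<in> N \<and> w \<in> M \<and> w \<notin> H \<and> w - v \<in> H \<and> N = adj (N \<inter> H) w" if "N \<in> S2" for N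
  proof -
    note N = S2D(1-3)[OF that]
    obtain x where x: "x \<in> N" "x \<notin> H" using S2D(4)[OF \<open>N \<in> S2\<close>] by blast
    then have "x \<in> adj H v" using N adjM by blast
    then obtain h k where hk: "h \<in> H" "x = h + of_int k * v" by (auto simp: adj_def)
    have "\<not> int p dvd k" using kv[OF v] hk x subgrp_add[OF H(1)] by blast
    then have "coprime (int p) k" using assms(1) by (simp add: prime_imp_coprime)
    then obtain a b where ab: "a * int p + b * k = 1"
      using bezout_int[of "int p" k] by (auto simp: coprime_iff_gcd_eq_1)
    define w where "w = of_int b * x"
    have wN: "w \<in> N" unfolding w_def using N x by (intro subgrp_of_int)
    have "b * k - 1 = int p * (- a)" using ab by (simp add: algebra_simps)
    then have "int p dvd b * k - 1" by simp
    then have "of_int (b * k - 1) * v \<in> H" using kv[OF v] by blast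
    moreover have "w - v = of_int b * h + of_int (b * k - 1) * v"
      unfolding w_def hk(2) by (simp add: algebra_simps)
    ultimately have wv: "w - v \<in> H" using subgrp_add[OF H(1)] subgrp_of_int[OF H(1) hk(1)] by simp
    have wH: "w \<notin> H" using wv v(2) subgrp_diff[OF H(1), of w "w - v"] by auto
    have "N = adj (N \<inter> H) w"
    proof
      show "adj (N \<inter> H) w \<subseteq> N" using adj_least[OF N(1) _ wN] by blast
      show "N \<subseteq> adj (N \<inter> H) w"
      proof
        fix y assume y: "y \<in> N"
        then have "y \<in> adj H v" using N adjM by blast
        then obtain h k where hk: "h \<in> H" "y = h + of_int k * v" by (auto simp: adj_def)
        have "y - of_int k * w = h - of_int k * (w - v)" unfolding hk(2) by (simp add: algebra_simps)
        then have "y - of_int k * w \<in> H" using hk(1) wv subgrp_diff[OF H(1)] subgrp_of_int[OF H(1)] by simp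
        moreover have "y - of_int k * w \<in> N" using y wN subgrp_diff[OF N(1)] subgrp_of_int[OF N(1)] by simp
        ultimately have "y - of_int k * w \<in> N \<inter> H" "y = (y - of_int k * w) + of_int k * w" by auto
        then show "y \<in> adj (N \<inter> H) w" unfolding adj_def by blast
      qed
    qed
    then show ?thesis using wN wv wH N by blast
  qed
  have S2N': "idx N B = p * idx (N \<inter> H) B" if "N \<in> S2" for N
  proof -
    obtain w where w: "w \<in> M" "w \<notin> H" "N = adj (N \<inter> H) w" using S2N[OF \<open>N \<in> S2\<close>] by blast
    note N = S2D(1,2)[OF that]
    have NH: "subgrp (N \<inter> H)" using N H subgrp_Int by blast
    have "idx (adj (N \<inter> H) w) (N \<inter> H) = p"
      by (rule idx_adj[OF assms(1) NH]) (use w pB[OF w(1)] N BH in auto)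
    then show ?thesis using idx_tower[of B "N \<inter> H" N] N NH assms(2) BH w(3) by auto
  qed
  have main: "int (card S2) = int p ^ (r * c) * (qbin (int p) (Suc d) c - qbin (int p) d c)"
  proof (cases c)
    case 0
    have "S2 = {}"
    proof (rule ccontr)
      assume "S2 \<noteq> {}"
      then obtain N where N: "N \<in> S2" by blast
      note S2D[OF N]
      moreover from this have "idx N B = 1" using 0 by simp
      ultimately show False using idx_eq_1D[of N B] assms(2) BH by blast
    qed
    then show ?thesis using 0 by simp
  next
    case (Suc c')
    let ?T = "?S H c'"
    have finT: "finite ?T"
      by (rule finite_subset[OF _ finite_subgroups_between[of H B]]) (use iH assms p0 in auto)
    have inT: "N \<inter> H \<in> ?T" if "N \<in> S2" for N
    proof -
      have "idx (N \<inter> H) B = p ^ c'" using S2N'[OF that] S2D(6)[OF that] Suc p0 by simp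
      then show ?thesis using S2D(1,2,5)[OF that] H BH subgrp_Int by auto
    qed
    \<comment> \<open>The subspaces over K are K + Z (v + h) with h in H, and h matters only modulo
      K; so there are as many as the index of K in H.\<close>
    have fib: "card {N \<in> S2. N \<inter> H = K} = p ^ (r + d - c') \<and> c' \<le> r + d" if K: "K \<in> ?T" for K
    proof -
      have K': "subgrp K" "B \<subseteq> K" "K \<subseteq> H" "K \<inter> U = B" "idx K B = p ^ c'" using K by auto
      have "{N \<in> S2. N \<inter> H = K} = (\<lambda>h. adj K (v + h)) ` H"
      proof
        show "{N \<in> S2. N \<inter> H = K} \<subseteq> (\<lambda>h. adj K (v + h)) ` H"
        proof
          fix N assume N: "N \<in> {N \<in> S2. N \<inter> H = K}"
          then obtain w where w: "w - v \<in> H" "N = adj (N \<inter> H) w" using S2N by blast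
          then have "N = adj K (v + (w - v))" using N by simp
          then show "N \<in> (\<lambda>h. adj K (v + h)) ` H" using w(1) by blast
        qed
        show "(\<lambda>h. adj K (v + h)) ` H \<subseteq> {N \<in> S2. N \<inter> H = K}"
        proof
          fix N assume "N \<in> (\<lambda>h. adj K (v + h)) ` H"
          then obtain h where h: "h \<in> H" "N = adj K (v + h)" by blast
          note w = vh[OF h(1)]
          have N: "subgrp N" "K \<subseteq> N" "v + h \<in> N"
            unfolding h(2) by (rule subgrp_adj[OF K'(1)], rule adj_base, rule adj_mem[OF K'(1)])
          have NM: "N \<subseteq> M" unfolding h(2) by (rule adj_least[OF M(1) _ w(1)]) (use K'(3) H(3) in blast)
          have NH: "N \<inter> H = K"
          proof
            show "K \<subseteq> N \<inter> H" using N K' by blast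
            show "N \<inter> H \<subseteq> K"
            proof
              fix x assume x: "x \<in> N \<inter> H"
              then obtain a k where ak: "a \<in> K" "x = a + of_int k * (v + h)" using h(2) by (auto simp: adj_def)
              then have "of_int k * (v + h) \<in> H" using x K'(3) subgrp_diff[OF H(1), of x a] by auto
              then have "of_int k * (v + h) \<in> B" using kv[OF w] pdv[OF w(1)] by blast
              then show "x \<in> K" unfolding ak(2) using subgrp_add[OF K'(1) ak(1)] K'(2) by blast
            qed
          qed
          have "idx N K = p" unfolding h(2)
            by (rule idx_adj[OF assms(1) K'(1)]) (use w K' pB[OF w(1)] in auto)
          then have "idx N B = p ^ c" using idx_tower[of B K N] K' N assms(2) Suc by simp
          moreover have "N \<inter> U = B" using NH K'(4) H(2) by blast
          moreover have "B \<subseteq> N" "\<not> N \<subseteq> H" using N K'(2) w(2) by blast+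
          ultimately have "N \<in> S2" using N NM unfolding S2_def by blast
          then show "N \<in> {N \<in> S2. N \<inter> H = K}" using NH by blast
        qed
      qed
      then have "card {N \<in> S2. N \<inter> H = K} = card ((\<lambda>h. adj K (v + h)) ` H)" by simp
      also have "\<dots> = card ((\<lambda>h. (+) h ` K) ` H)"
      proof (rule card_image_eq)
        fix h h' assume h: "h \<in> H" "h' \<in> H"
        note w = vh[OF h(2)]
        have "adj K (v + h) = adj K (v + h') \<longleftrightarrow> h - h' \<in> K"
        proof
          assume "adj K (v + h) = adj K (v + h')"
          then have "v + h \<in> adj K (v + h')" using adj_mem[OF K'(1), of "v + h"] by simp
          then obtain a k where ak: "a \<in> K" "v + h = a + of_int k * (v + h')" by (auto simp: adj_def)
          have "of_int (k - 1) * (v + h') = h - h' - a" using ak(2) by (simp add: algebra_simps)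
          moreover have "h - h' - a \<in> H"
            using subgrp_diff[OF H(1) subgrp_diff[OF H(1) h]] ak(1) K'(3) by blast
          ultimately have "of_int (k - 1) * (v + h') \<in> B" using kv[OF w] pdv[OF w(1)] by metis
          then have "a + of_int (k - 1) * (v + h') \<in> K" using subgrp_add[OF K'(1) ak(1)] K'(2) by blast
          moreover have "a + of_int (k - 1) * (v + h') = h - h'" using ak(2) by (simp add: algebra_simps)
          ultimately show "h - h' \<in> K" by simp
        next
          assume hh: "h - h' \<in> K"
          have sub: "adj K (v + x) \<subseteq> adj K (v + y)" if "x - y \<in> K" for x y
          proof (rule adj_least[OF subgrp_adj[OF K'(1)] adj_base])
            have "v + x = (x - y) + of_int 1 * (v + y)" by simp
            then show "v + x \<in> adj K (v + y)" unfolding adj_def using that by blast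
          qed
          show "adj K (v + h) = adj K (v + h')"
            using sub[OF hh] sub[of h' h] hh subgrp_diff_commute[OF K'(1), of h h'] by blast
        qed
        then show "adj K (v + h) = adj K (v + h') \<longleftrightarrow> (+) h ` K = (+) h' ` K"
          using coset_eq_iff[OF K'(1)] by simp
      qed
      also have "\<dots> = idx H K" by (simp add: idx_def)
      finally have "card {N \<in> S2. N \<inter> H = K} = idx H K" .
      moreover have t: "p ^ (r + d) = idx H K * p ^ c'" using idx_tower[of B K H] K' H assms(2) iH by simp
      then have "idx H K \<noteq> 0" using p0 by (metis mult_is_0 power_not_zero less_numeral_extra(3))
      then have "p ^ c' \<le> p ^ (r + d)" using t by simp
      then have le: "c' \<le> r + d" using p1 by simp
      moreover have "idx H K = p ^ (r + d - c')"
        using power_eq_cancel[of p c' "r + d - c'" "idx H K"] le t p0 by (simp add: mult.commute)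
      ultimately show ?thesis by simp
    qed
    have "card S2 = (\<Sum>K\<in>?T. card {N \<in> S2. N \<inter> H = K})"
    proof -
      have "S2 = (\<Union>K\<in>?T. {N \<in> S2. N \<inter> H = K})" using inT by blast
      then have "card S2 = card (\<Union>K\<in>?T. {N \<in> S2. N \<inter> H = K})" by simp
      also have "\<dots> = (\<Sum>K\<in>?T. card {N \<in> S2. N \<inter> H = K})"
        by (rule card_UN_disjoint) (use finT finS2 in auto)
      finally show ?thesis .
    qed
    also have "\<dots> = card ?T * p ^ (r + d - c')" using fib by simp
    finally have "int (card S2) = int (card ?T) * int p ^ (r + d - c')" by simp
    then have eq: "int (card S2) = int p ^ (r * c') * qbin (int p) d c' * int p ^ (r + d - c')" using IH by simp
    show ?thesis
    proof (cases "c' \<le> d")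
      case True
      \<comment> \<open>With c = c' + 1, this brings the count p^(r c') p^(r + d - c') to the shape
        of the second Pascal identity.\<close>
      have "r * c' + (r + d - c') = r * c + (d - c')" using True Suc by simp
      then have "int p ^ (r * c') * int p ^ (r + d - c') = int p ^ (r * c) * int p ^ (d - c')"
        by (simp only: power_add[symmetric])
      then show ?thesis unfolding eq Suc using qbin_Suc_Suc'[OF True, of "int p"] Suc
        by (simp add: algebra_simps del: qbin.simps)
    next
      case False
      then show ?thesis unfolding eq Suc by (simp add: qbin_eq_0)
    qed
  qed
  have "m - r = Suc d" using m by simp
  then show ?case using split IH[of c] main by (simp add: right_diff_distrib)
qed

section \<open>Primes congruent to \<open>1\<close> modulo \<open>f\<close>\<close>

lemma rat_poly_clear_denominators:
  fixes p :: "rat poly"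
  shows "\<exists>c (q::int poly). c > 0 \<and> Polynomial.smult (of_int c) p = map_poly of_int q"
proof (induction p)
  case 0
  show ?case by (intro exI[of _ 1] exI[of _ 0]) auto
next
  case (pCons a p)
  then obtain c q where c: "c > 0" "Polynomial.smult (of_int c) p = map_poly of_int q" by blast
  obtain n d where nd: "quotient_of a = (n, d)" by fastforce
  have d: "d > 0" "a = of_int n / of_int d"
    using quotient_of_denom_pos[OF nd] quotient_of_div[OF nd] by auto
  have "Polynomial.smult (of_int (c * d)) (pCons a p) = pCons (of_int (c * n)) (Polynomial.smult (of_int d) (Polynomial.smult (of_int c) p))"
    using d by (simp add: mult.commute)
  also have "\<dots> = map_poly of_int (pCons (c * n) (Polynomial.smult d q))"
    unfolding c(2) using d by (simp add: map_poly_pCons) (metis map_poly_smult of_int_0 of_int_mult)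
  finally show ?case using c d by (intro exI[of _ "c * d"] exI) auto
qed

lemma poly_of_int_of_int: "poly (map_poly of_int q) (of_int b) = (of_int (poly q b) :: 'a::comm_ring_1)"
  by (induction q) (simp_all add: map_poly_pCons)

text \<open>The factor \<open>h\<close> of \<open>x ^ f - 1\<close> obtained by removing the common factors with all
  \<open>x ^ d - 1\<close>, \<open>d < f\<close>, replaces the cyclotomic polynomial: a prime dividing a
  suitable value \<open>h b\<close> divides none of the \<open>b ^ d - 1\<close>, so \<open>b\<close> has order \<open>f\<close> modulo it.\<close>

lemma ex_prime_cong_1:
  assumes f: "f \<ge> 1"
  shows "\<exists>p. Factorial_Ring.prime p \<and> p > N \<and> f dvd (p - 1 :: nat)"
proof -
  define F where "F = (\<lambda>d. Polynomial.monom 1 d - 1 :: rat poly)"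
  define w where "w = (\<Prod>d\<in>{1..<f}. F d)"
  define g where "g = gcd (F f) w"
  obtain h where h: "F f = g * h" unfolding g_def by (meson dvdE gcd_dvd1)
  have pF: "poly (F d) x = x ^ d - 1" for d x by (simp add: F_def poly_monom)
  have dF: "pderiv (F f) = Polynomial.monom (of_nat f) (f - 1)"
    by (simp add: F_def pderiv_diff pderiv_monom)
  have F0: "F f \<noteq> 0"
  proof
    assume "F f = 0"
    then have "poly (F f) 2 = 0" by simp
    then have "(2::rat) ^ f = 1" unfolding pF by simp
    then show False using f one_less_power[of "2::rat" f] by simp
  qed
  \<comment> \<open>The derivative f X^(f-1) has only X as a prime factor, and X does not divide X^f
    - 1.\<close>
  have sqf: "\<not> q * q dvd F f" if "Factorial_Ring.prime q" for q
  proof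
    assume "q * q dvd F f"
    then obtain r where r: "F f = q * q * r" by auto
    then have "q dvd pderiv (F f)" by (simp add: pderiv_mult dvd_add algebra_simps)
    then have "q dvd Polynomial.monom (of_nat f) (f - 1)" using dF by simp
    then have "q dvd Polynomial.smult (of_nat f) ([:0, 1:] ^ (f - 1))"
      by (simp add: monom_altdef)
    then have "q dvd [:0, 1:] ^ (f - 1)" using f by (simp add: dvd_smult_cancel)
    then have "q dvd [:0, 1:]" using that prime_dvd_power by blast
    then have "q dvd [:0, 1:] ^ f" using f by (metis dvd_power dvd_trans One_nat_def Suc_le_eq)
    then have "q dvd Polynomial.monom 1 f" by (simp add: monom_altdef)
    moreover have "q dvd F f" using r by simp
    ultimately have "q dvd Polynomial.monom 1 f - F f" by (rule dvd_diff)
    then have "q dvd 1" by (simp add: F_def)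
    with that show False by (meson not_prime_unit)
  qed
  \<comment> \<open>A common prime of h and w would divide g as well, and then its square would
    divide X^f - 1.\<close>
  have cop: "coprime h w"
  proof (rule ccontr)
    assume "\<not> coprime h w"
    moreover have "h \<noteq> 0" using F0 h by auto
    ultimately have "gcd h w \<noteq> 0" "\<not> is_unit (gcd h w)"
      by (simp_all add: coprime_iff_gcd_eq_1)
    then obtain q where q: "Factorial_Ring.prime q" "q dvd gcd h w"
      using prime_divisor_exists by blast
    then have q: "Factorial_Ring.prime q" "q dvd h" "q dvd w" by simp_all
    then have "q dvd F f" using h by simp
    then have "q dvd g" unfolding g_def using q by simp
    then have "q * q dvd F f" unfolding h using q by (intro mult_dvd_mono)
    with sqf[OF q(1)] show False by blast
  qed
  have cis: "cis (2 * pi * real d / real f) \<noteq> 1" if "0 < d" "d < f" for d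
  proof
    assume "cis (2 * pi * real d / real f) = 1"
    then have "cos (2 * pi * real d / real f) = 1" by (simp add: complex_eq_iff)
    then obtain k :: int where "2 * pi * real d / real f = of_int k * 2 * pi"
      using cos_one_2pi_int by auto
    then have "2 * pi * (real d / real f) = 2 * pi * of_int k" by (simp add: mult_ac)
    then have "real d / real f = of_int k" by (simp only: mult_cancel_left) simp
    moreover have "0 < real d / real f" "real d / real f < 1" using that by simp_all
    ultimately show False by simp
  qed
  \<comment> \<open>exp(2 pi i / f) is a root of X^f - 1 but of no X^d - 1 with 0 < d < f.
    Consequently h is not constant.\<close>
  have ndvd: "\<not> F f dvd w"
  proof
    assume "F f dvd w"
    then obtain r where r: "w = F f * r" by auto
    define z where "z = cis (2 * pi / real f)"
    have hom: "poly (map_poly of_rat (p * q)) z = poly (map_poly of_rat p) z * poly (map_poly of_rat q) z"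
      for p q :: "rat poly"
      by (subst map_poly_hom_mult) (simp_all add: of_rat_add of_rat_mult)
    have "map_poly of_rat (F d) = (Polynomial.monom 1 d - 1 :: complex poly)" for d
      by (rule poly_eqI) (auto simp: F_def coeff_map_poly coeff_monom)
    then have Fz: "poly (map_poly of_rat (F d)) z = z ^ d - 1" for d
      by (simp add: poly_monom)
    have zd: "z ^ d = cis (2 * pi * real d / real f)" for d
      by (simp add: z_def Complex.DeMoivre mult_ac)
    have "z ^ f = 1" using f by (simp add: zd cis_2pi)
    then have "poly (map_poly of_rat w) z = 0" unfolding r hom Fz by simp
    moreover have "poly (map_poly of_rat (\<Prod>d\<in>A. F d)) z = (\<Prod>d\<in>A. z ^ d - 1)" if "finite A" for A
      using that by induction (simp_all add: hom Fz)
    then have "poly (map_poly of_rat w) z = (\<Prod>d\<in>{1..<f}. z ^ d - 1)" unfolding w_def by simp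
    moreover have "(\<Prod>d\<in>{1..<f}. z ^ d - 1) \<noteq> 0" using cis by (auto simp: zd)
    ultimately show False by simp
  qed
  have dh: "degree h > 0"
  proof (rule ccontr)
    assume "\<not> degree h > 0"
    then have "is_unit h" using F0 h by (metis is_unit_iff_degree mult_zero_right not_gr_zero)
    then have "F f dvd g" using h by (metis dvd_refl mult_unit_dvd_iff)
    moreover have "g dvd w" unfolding g_def by simp
    ultimately show False using ndvd by (meson dvd_trans)
  qed
  obtain U V where UV: "U * h + V * w = 1"
    using bezout_coefficients_fst_snd[of h w] coprime_imp_gcd_eq_1[OF cop] by metis
  obtain cU U' where U': "cU > 0" "Polynomial.smult (of_int cU) U = map_poly of_int U'"
    using rat_poly_clear_denominators by blast
  obtain cV V' where V': "cV > 0" "Polynomial.smult (of_int cV) V = map_poly of_int V'"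
    using rat_poly_clear_denominators by blast
  obtain cg g' where g': "cg > 0" "Polynomial.smult (of_int cg) g = map_poly of_int g'"
    using rat_poly_clear_denominators by blast
  obtain ch h' where h': "ch > 0" "Polynomial.smult (of_int ch) h = map_poly of_int h'"
    using rat_poly_clear_denominators by blast
  have ev: "of_int c * poly q (of_int b) = (of_int (poly q' b) :: rat)" if "Polynomial.smult (of_int c) q = map_poly of_int q'"
    for c q q' b
    using arg_cong[OF that, of "\<lambda>r. poly r (of_int b)"] by (simp add: poly_of_int_of_int)
  define c where "c = cU * cV * ch * cg"
  have c: "c > 0" using U' V' g' h' by (simp add: c_def)
  have dh': "degree h' > 0"
  proof -
    have "degree (map_poly (of_int :: int \<Rightarrow> rat) h') = degree h'" by (rule degree_map_poly) simp
    then show ?thesis using dh h' by (metis degree_smult_eq of_int_eq_0_iff less_irrefl)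
  qed
  have v1: "of_int (ch * cg) * (of_int b ^ f - 1) = (of_int (poly g' b * poly h' b) :: rat)" for b
  proof -
    have "of_int (ch * cg) * (of_int b ^ f - 1) = (of_int cg * poly g (of_int b)) * (of_int ch * poly h (of_int b))"
      unfolding pF[symmetric] h by (simp add: mult_ac)
    then show ?thesis unfolding ev[OF g'(2)] ev[OF h'(2)] by simp
  qed
  then have v1: "ch * cg * (b ^ f - 1) = poly g' b * poly h' b" for b :: int
  proof -
    have "(of_int (ch * cg * (b ^ f - 1)) :: rat) = of_int (poly g' b * poly h' b)"
      using v1[of b] by simp
    then show ?thesis by (simp only: of_int_eq_iff)
  qed
  have wev: "poly w (of_int b) = (of_int (\<Prod>d\<in>{1..<f}. b ^ d - 1) :: rat)" for b
    by (simp add: w_def poly_prod pF)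
  \<comment> \<open>The Bezout identity for h and w with denominators cleared: a prime that divides
    the value of h' at b but not c cannot divide any b^d - 1 with 0 < d < f.\<close>
  have v2: "cU * cV * ch = cV * poly U' b * poly h' b + cU * ch * poly V' b * (\<Prod>d\<in>{1..<f}. b ^ d - 1)" for b
  proof -
    have "(of_int (cU * cV * ch) :: rat) = of_int (cU * cV * ch) * poly (U * h + V * w) (of_int b)"
      using UV by simp
    also have "\<dots> = of_int cV * (of_int cU * poly U (of_int b)) * (of_int ch * poly h (of_int b))
        + of_int (cU * ch) * (of_int cV * poly V (of_int b)) * poly w (of_int b)"
      by (simp add: algebra_simps)
    also have "\<dots> = of_int (cV * poly U' b * poly h' b + cU * ch * poly V' b * (\<Prod>d\<in>{1..<f}. b ^ d - 1))"
      unfolding ev[OF U'(2)] ev[OF h'(2)] ev[OF V'(2)] wev by simp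
    finally show ?thesis using of_int_eq_iff by blast
  qed
  have h0: "poly h' 0 \<noteq> 0"
  proof
    assume "poly h' 0 = 0"
    then have "ch * cg * (0 ^ f - 1) = 0" using v1[of 0] by simp
    then show False using f h' g' by (simp add: power_0_left)
  qed
  define a where "a = poly h' 0"
  \<comment> \<open>The factor N! excludes the primes up to N, and c excludes those that divide the
    cleared denominators.\<close>
  define m where "m = a * c * int (fact N)"
  have m0: "m \<noteq> 0" using h0 c by (simp add: m_def a_def)
  text \<open>The values at multiples of \<open>a * m\<close> are \<open>a\<close> times a number congruent to 1 modulo \<open>m\<close>.\<close>
  have cong: "\<exists>t. poly h' (m * a * k) = a * (1 + m * t)" for k
  proof -
    obtain h2 where h2: "h' = pCons a h2" by (cases h') (simp add: a_def)
    have "poly h' (m * a * k) = a * (1 + m * (k * poly h2 (m * a * k)))"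
      by (simp add: h2 algebra_simps)
    then show ?thesis by blast
  qed
  \<comment> \<open>Avoiding the values a, -a and 0 makes 1 + m t neither a unit nor 0, so that it
    has a prime divisor.\<close>
  obtain k where k: "poly h' (m * a * k) \<notin> {a, -a, 0}"
  proof -
    let ?R = "\<lambda>q. {x. poly q x = 0}"
    have "h' - [:a:] \<noteq> 0" "h' + [:a:] \<noteq> 0" "h' \<noteq> 0"
      using dh' by (auto simp: eq_neg_iff_add_eq_0[symmetric])
    then have "finite (?R (h' - [:a:]) \<union> ?R (h' + [:a:]) \<union> ?R h')" using poly_roots_finite by blast
    moreover have "infinite (range (\<lambda>k. m * a * k))"
    proof
      assume "finite (range (\<lambda>k. m * a * k))"
      then have "finite (UNIV :: int set)"
        by (rule finite_imageD) (use m0 h0 in \<open>auto simp: inj_on_def a_def\<close>)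
      then show False by simp
    qed
    ultimately obtain x where "x \<in> range (\<lambda>k. m * a * k)" "x \<notin> ?R (h' - [:a:]) \<union> ?R (h' + [:a:]) \<union> ?R h'"
      by (meson finite_subset subsetI)
    then show ?thesis using that by (auto simp: eq_neg_iff_add_eq_0)
  qed
  define b where "b = m * a * k"
  obtain t where t: "poly h' b = a * (1 + m * t)" using cong b_def by blast
  have m1: "\<bar>1 + m * t\<bar> \<noteq> 1" "1 + m * t \<noteq> 0"
  proof -
    have "a * (1 + m * t) \<notin> {a, -a, 0}" using k t unfolding b_def by simp
    moreover have "a * (1 + m * t) \<in> {a, -a, 0}" if "1 + m * t \<in> {1, -1, 0}"
      using that by (elim insertE emptyE) (simp_all only: mult_1_right mult_minus_right mult_zero_right insert_iff simp_thms)
    ultimately have "1 + m * t \<notin> {1, -1, 0}" by blast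
    then show "\<bar>1 + m * t\<bar> \<noteq> 1" "1 + m * t \<noteq> 0" by (auto simp: abs_if split: if_splits)
  qed
  then obtain p' where p': "Factorial_Ring.prime p'" "p' dvd 1 + m * t"
    using prime_divisor_exists[of "1 + m * t"] m1 by auto
  have ndm: "\<not> p' dvd m"
  proof
    assume "p' dvd m"
    then have "p' dvd 1 + m * t - m * t" using p'(2) by (intro dvd_diff) simp_all
    then have "p' dvd 1" by simp
    then show False using p'(1) by (meson not_prime_unit)
  qed
  have ph: "p' dvd poly h' b" using p'(2) t by simp
  have pc: "\<not> p' dvd c" using ndm by (auto simp: m_def)
  have "p' dvd ch * cg * (b ^ f - 1)" using ph v1[of b] by simp
  moreover have "\<not> p' dvd ch * cg"
  proof
    assume "p' dvd ch * cg"
    then have "p' dvd cU * cV * (ch * cg)" by simp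
    then show False using pc by (simp add: c_def mult_ac)
  qed
  ultimately have bf: "p' dvd b ^ f - 1" using p'(1) prime_dvd_multD by blast
  have nd: "\<not> p' dvd b ^ d - 1" if "d \<in> {1..<f}" for d
  proof
    assume "p' dvd b ^ d - 1"
    moreover have "b ^ d - 1 dvd (\<Prod>d\<in>{1..<f}. b ^ d - 1)" using that by (intro dvd_prodI) auto
    ultimately have "p' dvd (\<Prod>d\<in>{1..<f}. b ^ d - 1)" by (rule dvd_trans)
    then have "p' dvd cU * cV * ch" unfolding v2[of b] using ph by (intro dvd_add) simp_all
    then show False using pc by (simp add: c_def)
  qed
  define p where "p = nat p'"
  have p0: "p' > 0" using p'(1) prime_gt_0_int by blast
  have pp: "Factorial_Ring.prime p" "int p = p'" using p'(1) p0 by (auto simp: p_def)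
  have "p > N"
  proof (rule ccontr)
    assume "\<not> p > N"
    then have "p dvd fact N" using prime_dvd_fact_iff[OF pp(1)] by simp
    then have "p' dvd int (fact N)" unfolding pp(2)[symmetric] by (rule of_nat_dvd_iff[THEN iffD2])
    then show False using ndm by (simp add: m_def)
  qed
  moreover have "f dvd p - 1"
  proof -
    define B where "B = nat (b mod p')"
    have B: "int B = b mod p'" using p0 by (simp add: B_def)
    have iff: "p' dvd b ^ d - 1 \<longleftrightarrow> [B ^ d = 1] (mod p)" for d
    proof -
      have "p' dvd b ^ d - 1 \<longleftrightarrow> [b ^ d = 1] (mod p')" by (simp add: cong_iff_dvd_diff)
      also have "\<dots> \<longleftrightarrow> [int B ^ d = 1] (mod p')" by (simp add: cong_def B power_mod)
      also have "\<dots> \<longleftrightarrow> [B ^ d = 1] (mod p)" unfolding pp(2)[symmetric]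
        using cong_int_iff[of "B ^ d" 1 p] by simp
      finally show ?thesis .
    qed
    have cp: "coprime p B"
    proof -
      have "coprime (B ^ f) p" using bf iff by (metis cong_imp_coprime cong_sym coprime_1_left)
      then show ?thesis using f by (simp add: coprime_commute)
    qed
    have "ord p B = f"
    proof (rule antisym)
      show "ord p B \<le> f"
      proof (rule ccontr)
        assume "\<not> ord p B \<le> f"
        then show False using ord_minimal[of f p B] bf iff f by auto
      qed
      show "f \<le> ord p B"
      proof (rule ccontr)
        assume "\<not> f \<le> ord p B"
        moreover have "[B ^ ord p B = 1] (mod p)" by (rule ord_works[THEN conjunct1])
        moreover have "ord p B > 0" using cp by simp
        ultimately have "ord p B \<in> {1..<f}" "p' dvd b ^ ord p B - 1"
          using iff[of "ord p B"] by (simp_all only: atLeastLessThan_iff not_le One_nat_def Suc_le_eq)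
        then show False using nd by blast
      qed
    qed
    then have "f dvd totient p" using order_divides_totient[OF cp] by simp
    then show ?thesis using totient_prime[OF pp(1)] by simp
  qed
  ultimately show ?thesis using pp(1) by blast
qed

section \<open>Lattices and multiplication by \<open>p\<close>\<close>

text \<open>The subgroup pN + J: with subgroups of the quotient by J represented by their preimages,
  this is multiplication by p.\<close>

definition pmul :: "nat \<Rightarrow> 'v::comm_ring_1 set \<Rightarrow> 'v set \<Rightarrow> 'v set" where
  "pmul p J N = {y. \<exists>x\<in>N. y - of_nat p * x \<in> J}"

definition pdiv :: "nat \<Rightarrow> 'v::comm_ring_1 set \<Rightarrow> 'v set" where
  "pdiv p N = {x. of_nat p * x \<in> N}"

text \<open>Absorbing a power of p stands for openness; in the setting of \<open>plattice\<close>,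
  with J contained in P, it forces the index to be a power of p. P is a prescribed part, later the
  part that normality demands.\<close>

definition lattices :: "nat \<Rightarrow> 'v::comm_ring_1 set \<Rightarrow> 'v set set" where
  "lattices p P = {N. subgrp N \<and> P \<subseteq> N \<and> (\<exists>i. \<forall>x. of_nat p ^ i * x \<in> N)}"

lemma subgrp_pmul:
  assumes "subgrp J" "subgrp N"
  shows "subgrp (pmul p J N)"
  unfolding subgrp_def
proof (intro conjI ballI)
  have "0 - of_nat p * 0 \<in> J" using subgrp_0[OF assms(1)] by simp
  then show "0 \<in> pmul p J N" using subgrp_0[OF assms(2)] unfolding pmul_def by blast
  fix y y' assume "y \<in> pmul p J N" "y' \<in> pmul p J N"
  then obtain x x' where x: "x \<in> N" "x' \<in> N" "y - of_nat p * x \<in> J" "y' - of_nat p * x' \<in> J"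
    by (auto simp: pmul_def)
  have "(y - y') - of_nat p * (x - x') = (y - of_nat p * x) - (y' - of_nat p * x')"
    by (simp add: algebra_simps)
  then have "(y - y') - of_nat p * (x - x') \<in> J" using subgrp_diff[OF assms(1) x(3,4)] by (simp only:)
  then show "y - y' \<in> pmul p J N" using subgrp_diff[OF assms(2) x(1,2)] unfolding pmul_def by blast
qed

lemma subgrp_pdiv:
  assumes "subgrp N" shows "subgrp (pdiv p N)"
  unfolding subgrp_def pdiv_def
  using subgrp_0[OF assms] subgrp_diff[OF assms] by (simp add: right_diff_distrib)

lemma pmul_memI: "subgrp J \<Longrightarrow> x \<in> N \<Longrightarrow> of_nat p * x \<in> pmul p J N"
  unfolding pmul_def using subgrp_0 by force

lemma pmul_superset: "subgrp N \<Longrightarrow> J \<subseteq> pmul p J N"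
  unfolding pmul_def using subgrp_0[of N] by force

lemma pmul_mono: "N \<subseteq> N' \<Longrightarrow> pmul p J N \<subseteq> pmul p J N'"
  unfolding pmul_def by blast

lemma pmul_subset: "subgrp N \<Longrightarrow> J \<subseteq> N \<Longrightarrow> N' \<subseteq> pdiv p N \<Longrightarrow> pmul p J N' \<subseteq> N"
proof
  fix y assume N: "subgrp N" "J \<subseteq> N" "N' \<subseteq> pdiv p N" and "y \<in> pmul p J N'"
  then obtain x where x: "x \<in> N'" "y - of_nat p * x \<in> J" by (auto simp: pmul_def)
  have "of_nat p * x \<in> N" using x N by (auto simp: pdiv_def)
  with subgrp_add[OF N(1), of "y - of_nat p * x" "of_nat p * x"] x(2) N(2) show "y \<in> N" by auto
qed

lemma latticesD:
  assumes "N \<in> lattices p P"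
  shows "subgrp N" "P \<subseteq> N" "\<exists>i. \<forall>x. of_nat p ^ i * x \<in> N"
  using assms by (auto simp: lattices_def)

lemma pdiv_superset: "subgrp N \<Longrightarrow> N \<subseteq> pdiv p N"
  unfolding pdiv_def using subgrp_of_nat by blast

lemma lattices_pdiv:
  assumes "N \<in> lattices p P"
  shows "pdiv p N \<in> lattices p (pdiv p P)"
proof -
  note N = latticesD[OF assms]
  obtain i where "\<forall>x. of_nat p ^ i * x \<in> N" using N(3) by blast
  then have "\<forall>x. of_nat p ^ i * x \<in> pdiv p N" using pdiv_superset[OF N(1)] by blast
  moreover have "pdiv p P \<subseteq> pdiv p N" using N(2) by (auto simp: pdiv_def)
  ultimately show ?thesis using subgrp_pdiv[OF N(1)] unfolding lattices_def by blast
qed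

lemma nat_mult_eq_power: "(p::nat) > 0 \<Longrightarrow> p ^ m = p ^ a * x \<Longrightarrow> a \<le> m \<Longrightarrow> x = p ^ (m - a)"
  by (metis le_add_diff_inverse power_eq_cancel)

text \<open>The quotient of 'v by J plays the role of the lattice Z_p^m; what is recorded of it is
  the absence of p-torsion and the index p^m of its p-fold multiples.\<close>

locale plattice =
  fixes p m :: nat and J :: "'v::comm_ring_1 set"
  assumes prime_p: "Factorial_Ring.prime p"
    and subgrp_J: "subgrp J"
    and torsion_free: "of_nat p * x \<in> J \<Longrightarrow> x \<in> J"
    and idx_pmul_UNIV: "idx UNIV (pmul p J UNIV) = p ^ m"
begin

abbreviation "E \<equiv> pmul p J UNIV"

lemma p_gt_1: "p > 1"
  using prime_gt_1_nat[OF prime_p] .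

lemma subgrp_E: "subgrp E"
  by (rule subgrp_pmul[OF subgrp_J subgrp_UNIV])

lemma J_sub_E: "J \<subseteq> E"
  by (rule pmul_superset) simp

lemma p_mem_E: "of_nat p * x \<in> E"
  by (rule pmul_memI[OF subgrp_J]) simp

lemma idx_pmul:
  assumes "subgrp N" "J \<subseteq> N"
  shows "idx E (pmul p J N) = idx UNIV N"
proof (rule idx_transfer[symmetric, where h = "\<lambda>x. of_nat p * x"])
  show "\<And>x. x \<in> UNIV \<Longrightarrow> of_nat p * x \<in> E" by (rule p_mem_E)
  fix x y :: 'v
  show "of_nat p * x - of_nat p * y \<in> pmul p J N \<longleftrightarrow> x - y \<in> N"
  proof
    assume "of_nat p * x - of_nat p * y \<in> pmul p J N"
    then obtain n where n: "n \<in> N" "of_nat p * x - of_nat p * y - of_nat p * n \<in> J" by (auto simp: pmul_def)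
    then have "of_nat p * (x - y - n) \<in> J" by (simp add: algebra_simps)
    then have "x - y - n \<in> N" using torsion_free assms(2) by blast
    from subgrp_add[OF assms(1) this n(1)] show "x - y \<in> N" by simp
  next
    assume "x - y \<in> N"
    from pmul_memI[OF subgrp_J this, of p] show "of_nat p * x - of_nat p * y \<in> pmul p J N"
      by (simp add: right_diff_distrib)
  qed
next
  fix z assume "z \<in> E"
  then obtain x where "z - of_nat p * x \<in> J" by (auto simp: pmul_def)
  then have "of_nat p * x - z \<in> J" using subgrp_diff_commute[OF subgrp_J] by blast
  then show "\<exists>x\<in>UNIV. of_nat p * x - z \<in> pmul p J N" using pmul_superset[OF assms(1), of J p] by blast
qed (rule assms(1), rule subgrp_pmul[OF subgrp_J assms(1)])

lemma idx_UNIV_pmul: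
  assumes "subgrp N" "J \<subseteq> N"
  shows "idx UNIV (pmul p J N) = p ^ m * idx UNIV N"
  using idx_tower[OF subgrp_pmul[OF subgrp_J assms(1)] subgrp_E subgrp_UNIV pmul_mono] idx_pmul[OF assms] idx_pmul_UNIV
  by simp

definition Epow :: "nat \<Rightarrow> 'v set" where
  "Epow i = (pmul p J ^^ i) UNIV"

lemma Epow: "subgrp (Epow i)" "J \<subseteq> Epow i" "idx UNIV (Epow i) = p ^ (m * i)"
proof -
  have "subgrp (Epow i) \<and> J \<subseteq> Epow i \<and> idx UNIV (Epow i) = p ^ (m * i)"
  proof (induction i)
    case 0
    then show ?case by (simp add: Epow_def idx_self[OF subgrp_UNIV])
  next
    case (Suc i)
    have "Epow (Suc i) = pmul p J (Epow i)" by (simp add: Epow_def)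
    then show ?case using Suc subgrp_pmul[OF subgrp_J, of "Epow i"] pmul_superset[of "Epow i" J p] idx_UNIV_pmul[of "Epow i"]
      by (simp add: power_add mult.commute)
  qed
  then show "subgrp (Epow i)" "J \<subseteq> Epow i" "idx UNIV (Epow i) = p ^ (m * i)" by auto
qed

lemma Epow_sub:
  assumes "subgrp N" "J \<subseteq> N" "\<And>x. of_nat p ^ i * x \<in> N"
  shows "Epow i \<subseteq> N"
  using assms
proof (induction i arbitrary: N)
  case 0
  then show ?case using "0.prems"(3)[of "_"] by auto
next
  case (Suc i)
  have "of_nat p ^ i * x \<in> pdiv p N" for x using Suc.prems(3)[of x] by (simp add: pdiv_def mult.assoc)
  moreover have "J \<subseteq> pdiv p N" using Suc.prems(2) pdiv_superset[OF Suc.prems(1)] by blast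
  ultimately have "Epow i \<subseteq> pdiv p N" using Suc.IH[OF subgrp_pdiv[OF Suc.prems(1)]] by blast
  from pmul_subset[OF Suc.prems(1,2) this] show ?case by (simp add: Epow_def)
qed

lemma idx_lat:
  assumes "N \<in> lattices p P" "J \<subseteq> P"
  obtains j where "idx UNIV N = p ^ j"
proof -
  note N = latticesD[OF assms(1)]
  obtain i where "\<forall>x. of_nat p ^ i * x \<in> N" using N(3) by blast
  then have "Epow i \<subseteq> N" using Epow_sub[of N i] N assms(2) by blast
  then have "p ^ (m * i) = idx UNIV N * idx N (Epow i)"
    using idx_tower[OF Epow(1) N(1) subgrp_UNIV] Epow(3)[of i] by simp
  then have "idx UNIV N dvd p ^ (m * i)" by simp
  then show thesis using divides_primepow_nat[OF prime_p] that by blast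
qed

text \<open>Multiplication by p identifies the quotient by \<open>pdiv p N\<close> with E / (E
  \<inter> N), that is with (N + E) / N. So passing to \<open>pdiv p N\<close> divides the index by
  that of N + E, which produces the factor y^i in row i of the transfer matrix.\<close>

lemma idx_lat_pdiv:
  assumes "subgrp N" "J \<subseteq> N"
  shows "idx UNIV N = idx UNIV (ssum N E) * idx UNIV (pdiv p N)"
proof -
  have "idx UNIV N = idx UNIV (ssum N E) * idx (ssum N E) N"
    by (rule idx_tower[OF assms(1) subgrp_ssum[OF assms(1) subgrp_E] subgrp_UNIV ssum_left[OF subgrp_E]]) simp
  also have "idx (ssum N E) N = idx E (E \<inter> N)"
    unfolding ssum_commute[of N E] by (rule idx_ssum[OF subgrp_E assms(1)])
  also have "\<dots> = idx UNIV (pdiv p N)"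
  proof (rule idx_transfer[symmetric, where h = "\<lambda>x. of_nat p * x"])
    show "\<And>x. x \<in> UNIV \<Longrightarrow> of_nat p * x \<in> E" by (rule p_mem_E)
    fix x y :: 'v
    show "of_nat p * x - of_nat p * y \<in> E \<inter> N \<longleftrightarrow> x - y \<in> pdiv p N"
      using p_mem_E[of "x - y"] by (simp add: pdiv_def right_diff_distrib)
  next
    fix z assume z: "z \<in> E"
    then obtain x where "z - of_nat p * x \<in> J" by (auto simp: pmul_def)
    then have "of_nat p * x - z \<in> J" using subgrp_diff_commute[OF subgrp_J] by blast
    then show "\<exists>x\<in>UNIV. of_nat p * x - z \<in> E \<inter> N" using J_sub_E assms(2) by blast
  qed (rule subgrp_pdiv[OF assms(1)], rule subgrp_Int[OF subgrp_E assms(1)])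
  finally show ?thesis .
qed

text \<open>\<open>pdiv p N\<close> has smaller index unless it equals N, and equality means that N
  is everything because some power of p maps into N. Each step costs one factor p, so p^j suffices;
  this bounds all lattices of a given index from below.\<close>

lemma lattices_annihilated:
  assumes "N \<in> lattices p P" "J \<subseteq> P" "idx UNIV N = p ^ j"
  shows "of_nat p ^ j * x \<in> N"
  using assms
proof (induction j arbitrary: N P x rule: less_induct)
  case (less j)
  note N = latticesD[OF less.prems(1)]
  show ?case
  proof (cases "pdiv p N = N")
    case True
    have "of_nat p ^ i * y \<in> N \<Longrightarrow> y \<in> N" for i y
    proof (induction i)
      case (Suc i)
      then have "of_nat p ^ i * y \<in> pdiv p N" by (simp add: pdiv_def mult.assoc)
      then show ?case using Suc.IH True by simp
    qed simp
    then show ?thesis using N(3) by blast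
  next
    case False
    have J: "J \<subseteq> pdiv p P" using less.prems(2) unfolding pdiv_def
      using subgrp_of_nat[OF subgrp_J] by blast
    obtain k where k: "idx UNIV (pdiv p N) = p ^ k" using idx_lat[OF lattices_pdiv[OF less.prems(1)] J] .
    have t: "p ^ j = p ^ k * idx (pdiv p N) N"
      using idx_tower[OF N(1) subgrp_pdiv[OF N(1)] subgrp_UNIV pdiv_superset[OF N(1)], of p] k less.prems(3) by simp
    then have "p ^ k dvd p ^ j" by simp
    then have "k \<le> j" using p_gt_1 by (metis power_dvd_imp_le)
    moreover have "k \<noteq> j"
    proof
      assume "k = j"
      then have "idx (pdiv p N) N = 1" using t p_gt_1 by simp
      with idx_eq_1D[OF _ N(1) subgrp_pdiv[OF N(1)] pdiv_superset[OF N(1)]] False show False by blast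
    qed
    ultimately have kj: "k < j" by simp
    from less.IH[OF kj lattices_pdiv[OF less.prems(1)] J k, of "of_nat p ^ (j - Suc k) * x"]
    have "of_nat p * (of_nat p ^ k * (of_nat p ^ (j - Suc k) * x)) \<in> N" by (simp add: pdiv_def)
    moreover have "of_nat p ^ j = (of_nat p * (of_nat p ^ k * of_nat p ^ (j - Suc k)) :: 'v)"
      using kj by (simp flip: power_add power_Suc)
    ultimately show ?thesis by (simp add: mult.assoc)
  qed
qed

lemma finite_lat:
  assumes "J \<subseteq> P"
  shows "finite {N \<in> lattices p P. idx UNIV N = p ^ j}"
proof (rule finite_subset)
  have "idx UNIV (Epow j) \<noteq> 0" using Epow(3) p_gt_1 by simp
  then show "finite {N. subgrp N \<and> Epow j \<subseteq> N \<and> N \<subseteq> UNIV}" by (rule finite_subgroups_between[OF _ Epow(1)])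
  show "{N \<in> lattices p P. idx UNIV N = p ^ j} \<subseteq> {N. subgrp N \<and> Epow j \<subseteq> N \<and> N \<subseteq> UNIV}"
  proof clarify
    fix N assume N: "N \<in> lattices p P" "idx UNIV N = p ^ j"
    then have "Epow j \<subseteq> N" using lattices_annihilated[OF N(1) assms N(2)] latticesD[OF N(1)] assms
      by (intro Epow_sub) auto
    then show "subgrp N \<and> Epow j \<subseteq> N \<and> N \<subseteq> UNIV" using latticesD[OF N(1)] by simp
  qed
qed

definition num_lattices :: "'v set \<Rightarrow> nat \<Rightarrow> nat \<Rightarrow> nat" where
  "num_lattices P d j = card {N \<in> lattices p P. idx UNIV N = p ^ j \<and> idx UNIV (ssum N E) = p ^ d}"

text \<open>The lattices \<open>N \<supseteq> P\<close> with a prescribed \<open>pdiv p N = N'\<close> are the subspaces of \<open>N'/pN'\<close> that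
  contain the image of \<open>P\<close> and meet the image of \<open>N' \<inter> E\<close> as little as possible.\<close>

lemma fibre:
  assumes P: "subgrp P" "J \<subseteq> P" "idx (ssum P E) E = p ^ s"
    and N': "N' \<in> lattices p (pdiv p P)" "idx UNIV (ssum N' E) = p ^ d'"
  shows "s \<le> m" "d' \<le> m - s"
    and "N \<in> lattices p P \<Longrightarrow> pdiv p N = N' \<Longrightarrow> idx UNIV (ssum N E) = p ^ d \<Longrightarrow> d \<le> m - s"
    and "d \<le> m - s \<Longrightarrow>
      int (card {N \<in> lattices p P. pdiv p N = N' \<and> idx UNIV (ssum N E) = p ^ d}) = transfer_coeff (int p) 1 (m - s) d d'"
proof -
  have p0: "p > 0" using p_gt_1 by simp
  note n = latticesD[OF N'(1)]
  have JP': "J \<subseteq> pdiv p P" using P(2) subgrp_of_nat[OF subgrp_J] unfolding pdiv_def by blast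
  have JN: "J \<subseteq> N'" using n(2) JP' by blast
  obtain j' where j': "idx UNIV N' = p ^ j'" using idx_lat[OF N'(1) JP'] .
  \<comment> \<open>In N'/B, an F_p-space of dimension m, Q is the image of P, of dimension s, and
    U/Q is what N' \<inter> E adds to it, of dimension d'.\<close>
  define B where "B = pmul p J N'"
  define Q where "Q = ssum P B"
  define U where "U = ssum (N' \<inter> E) Q"
  have B: "subgrp B" "J \<subseteq> B" "B \<subseteq> E" "B \<subseteq> N'"
    unfolding B_def using subgrp_pmul[OF subgrp_J n(1)] pmul_superset[OF n(1)] pmul_mono[of N' UNIV]
      pmul_subset[OF n(1) JN pdiv_superset[OF n(1)]] by auto
  \<comment> \<open>An element of E is p z modulo J, and p z in N means that z lies in
    \<open>pdiv p N\<close>; so the elements of N in E already lie in B.\<close>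
  have BI: "x \<in> B" if "x \<in> E" "x \<in> N" "pdiv p N \<subseteq> N'" "subgrp N" "J \<subseteq> N" for x N
  proof -
    obtain z where z: "x - of_nat p * z \<in> J" using \<open>x \<in> E\<close> by (auto simp: pmul_def)
    have "of_nat p * z \<in> N" using subgrp_diff[OF that(4) that(2), of "x - of_nat p * z"] z that(5) by auto
    then have "z \<in> N'" using that(3) by (auto simp: pdiv_def)
    then show "x \<in> B" using z unfolding B_def pmul_def by blast
  qed
  have PP: "P \<subseteq> N'" using n(2) pdiv_superset[OF P(1), of p] by blast
  have Q: "subgrp Q" "P \<subseteq> Q" "B \<subseteq> Q" "Q \<subseteq> N'"
    unfolding Q_def using subgrp_ssum[OF P(1) B(1)] ssum_left[OF B(1)] ssum_right[OF P(1)] ssum_least[OF n(1) PP B(4)]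
    by auto
  have NE: "subgrp (N' \<inter> E)" by (rule subgrp_Int[OF n(1) subgrp_E])
  have U: "subgrp U" "N' \<inter> E \<subseteq> U" "Q \<subseteq> U" "U \<subseteq> N'"
    unfolding U_def using subgrp_ssum[OF NE Q(1)] ssum_left[OF Q(1)] ssum_right[OF NE] ssum_least[OF n(1) _ Q(4), of "N' \<inter> E"]
    by auto
  have iB: "idx N' B = p ^ m"
  proof -
    have "idx UNIV B = p ^ m * p ^ j'" unfolding B_def using idx_UNIV_pmul[OF n(1) JN] j' by simp
    moreover have "idx UNIV B = p ^ j' * idx N' B" using idx_tower[OF B(1) n(1) subgrp_UNIV B(4)] j' by simp
    ultimately show ?thesis using p0 by (simp add: mult.commute)
  qed
  have PB: "P \<inter> B = P \<inter> E"
    using B(3) BI[OF _ _ n(2) P(1,2)] by blast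
  have iQB: "idx Q B = p ^ s"
    unfolding Q_def idx_ssum[OF P(1) B(1)] PB using idx_ssum[OF P(1) subgrp_E] P(3) by simp
  have t1: "p ^ m = idx N' Q * p ^ s" using idx_tower[OF B(1) Q(1) n(1) Q(3,4)] iB iQB by simp
  then have "p ^ s dvd p ^ m" by simp
  then show s: "s \<le> m" using p_gt_1 by (metis power_dvd_imp_le)
  have iQ: "idx N' Q = p ^ (m - s)"
    using nat_mult_eq_power[OF p0 _ s, of "idx N' Q"] t1 by (simp add: mult.commute)
  have QE: "Q \<inter> E = B"
  proof
    show "B \<subseteq> Q \<inter> E" using Q(3) B(3) by blast
    show "Q \<inter> E \<subseteq> B"
    proof
      fix x assume x: "x \<in> Q \<inter> E"
      then obtain a b where ab: "a \<in> P" "b \<in> B" "x = a + b" unfolding Q_def ssum_def by blast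
      have "a \<in> E" using subgrp_diff[OF subgrp_E, of x b] x ab B(3) by auto
      then have "a \<in> B" using PB ab(1) by blast
      then show "x \<in> B" using ab subgrp_add[OF B(1)] by blast
    qed
  qed
  have dm: "d' \<le> m \<and> idx (N' \<inter> E) B = p ^ d'"
  proof -
    have t: "p ^ m = p ^ d' * idx (ssum N' E) E"
      using idx_tower[OF subgrp_E subgrp_ssum[OF n(1) subgrp_E] subgrp_UNIV ssum_right[OF n(1)]] idx_pmul_UNIV N'(2) by simp
    then have "p ^ d' dvd p ^ m" by simp
    then have d: "d' \<le> m" using p_gt_1 by (metis power_dvd_imp_le)
    have "idx N' (N' \<inter> E) = p ^ (m - d')"
      using nat_mult_eq_power[OF p0 t d] idx_ssum[OF n(1) subgrp_E] by simp
    moreover have "idx N' B = idx N' (N' \<inter> E) * idx (N' \<inter> E) B"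
      by (rule idx_tower[OF B(1) NE n(1)]) (use B in auto)
    ultimately have "p ^ m = p ^ (m - d') * idx (N' \<inter> E) B" using iB by simp
    from nat_mult_eq_power[OF p0 this] d show ?thesis by simp
  qed
  have iU: "idx U Q = p ^ d'"
  proof -
    have "(N' \<inter> E) \<inter> Q = B" using QE Q(4) by blast
    then show ?thesis unfolding U_def idx_ssum[OF NE Q(1)] using dm by simp
  qed
  have "p ^ (m - s) = idx N' U * p ^ d'" using idx_tower[OF Q(1) U(1) n(1) U(3,4)] iQ iU by simp
  then have "p ^ d' dvd p ^ (m - s)" by simp
  then show "d' \<le> m - s" using p_gt_1 by (metis power_dvd_imp_le)
  \<comment> \<open>The prescribed value of \<open>pdiv\<close> becomes a linear condition:
    containing B gives N' \<subseteq> \<open>pdiv p N\<close>, and meeting U only in Q gives the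
    converse inclusion.\<close>
  have F1: "{N \<in> lattices p P. pdiv p N = N'} = {N. subgrp N \<and> Q \<subseteq> N \<and> N \<subseteq> N' \<and> N \<inter> U = Q}"
  proof (intro equalityI subsetI)
    fix N assume "N \<in> {N \<in> lattices p P. pdiv p N = N'}"
    then have N: "N \<in> lattices p P" "pdiv p N = N'" by auto
    note l = latticesD[OF N(1)]
    have JN': "J \<subseteq> N" using P(2) l(2) by blast
    have "B \<subseteq> N" unfolding B_def using pmul_subset[OF l(1) JN', of N' p] N(2) by blast
    then have QN: "Q \<subseteq> N" unfolding Q_def using ssum_least[OF l(1,2)] by blast
    have NN: "N \<subseteq> N'" using pdiv_superset[OF l(1), of p] N(2) by simp
    have "N \<inter> U \<subseteq> Q"
    proof
      fix x assume x: "x \<in> N \<inter> U"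
      then obtain a q where aq: "a \<in> E" "q \<in> Q" "x = a + q" unfolding U_def ssum_def by blast
      have "a \<in> N" using subgrp_diff[OF l(1), of x q] x aq QN by auto
      then have "a \<in> B" using BI[OF aq(1) _ _ l(1) JN'] N(2) by blast
      then show "x \<in> Q" using aq Q(3) subgrp_add[OF Q(1)] by blast
    qed
    then show "N \<in> {N. subgrp N \<and> Q \<subseteq> N \<and> N \<subseteq> N' \<and> N \<inter> U = Q}" using l(1) QN NN U(3) by blast
  next
    fix N assume "N \<in> {N. subgrp N \<and> Q \<subseteq> N \<and> N \<subseteq> N' \<and> N \<inter> U = Q}"
    then have N: "subgrp N" "Q \<subseteq> N" "N \<subseteq> N'" "N \<inter> U = Q" by auto
    obtain i where i: "\<forall>x. of_nat p ^ i * x \<in> N'" using n(3) by blast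
    have pB: "of_nat p * y \<in> B" if "y \<in> N'" for y unfolding B_def by (rule pmul_memI[OF subgrp_J that])
    have "of_nat p ^ Suc i * x \<in> N" for x
      using pB[of "of_nat p ^ i * x"] i Q(3) N(2) by (auto simp: mult.assoc)
    then have lattices: "N \<in> lattices p P" using N Q(2) unfolding lattices_def by blast
    have "pdiv p N = N'"
    proof
      show "N' \<subseteq> pdiv p N" using pB Q(3) N(2) by (auto simp: pdiv_def)
      show "pdiv p N \<subseteq> N'"
      proof
        fix x assume "x \<in> pdiv p N"
        then have px: "of_nat p * x \<in> N" by (simp add: pdiv_def)
        then have "of_nat p * x \<in> U" using U(2) N(3) p_mem_E[of x] by blast
        then have "of_nat p * x \<in> Q" using px N(4) by blast
        then obtain a b where ab: "a \<in> P" "b \<in> B" "of_nat p * x = a + b" unfolding Q_def ssum_def by blast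
        then obtain y where y: "y \<in> N'" "b - of_nat p * y \<in> J" unfolding B_def pmul_def by blast
        have "of_nat p * (x - y) = a + (b - of_nat p * y)" using ab(3) by (simp add: algebra_simps)
        then have "of_nat p * (x - y) \<in> P" using subgrp_add[OF P(1) ab(1)] y(2) P(2) by auto
        then have "x - y \<in> N'" using n(2) by (auto simp: pdiv_def)
        from subgrp_add[OF n(1) this y(1)] show "x \<in> N'" by simp
      qed
    qed
    then show "N \<in> {N \<in> lattices p P. pdiv p N = N'}" using lattices by blast
  qed
  \<comment> \<open>The codimension d of N + E and the dimension of N/Q add up to m - s, so
    prescribing d fixes the dimension of the subspace N/Q.\<close>
  have F3: "p ^ (m - s) = idx UNIV (ssum N E) * idx N Q" if "N \<in> lattices p P" "pdiv p N = N'" for N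
  proof -
    note l = latticesD[OF that(1)]
    have N: "Q \<subseteq> N" "N \<subseteq> N'" using F1 that by blast+
    have "N \<inter> E = B"
      using BI[OF _ _ _ l(1)] that(2) P(2) l(2) N(1) Q(3) B(3) by blast
    then have "idx (ssum N E) E = idx N B" using idx_ssum[OF l(1) subgrp_E] by simp
    also have "\<dots> = idx N Q * p ^ s" using idx_tower[OF B(1) Q(1) l(1) Q(3) N(1)] iQB by simp
    finally have "p ^ m = idx UNIV (ssum N E) * (idx N Q * p ^ s)"
      using idx_tower[OF subgrp_E subgrp_ssum[OF l(1) subgrp_E] subgrp_UNIV ssum_right[OF l(1)]] idx_pmul_UNIV by simp
    then have "p ^ m = p ^ s * (idx UNIV (ssum N E) * idx N Q)" by (simp add: mult_ac)
    from nat_mult_eq_power[OF p0 this s] show ?thesis by simp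
  qed
  show "d \<le> m - s" if "N \<in> lattices p P" "pdiv p N = N'" "idx UNIV (ssum N E) = p ^ d" for N d
  proof -
    have "p ^ d dvd p ^ (m - s)" using F3[OF that(1,2)] that(3) by simp
    then show ?thesis using p_gt_1 by (metis power_dvd_imp_le)
  qed
  show "int (card {N \<in> lattices p P. pdiv p N = N' \<and> idx UNIV (ssum N E) = p ^ d}) = transfer_coeff (int p) 1 (m - s) d d'"
    if d: "d \<le> m - s" for d
  proof -
    have "{N \<in> lattices p P. pdiv p N = N' \<and> idx UNIV (ssum N E) = p ^ d}
        = {N. subgrp N \<and> Q \<subseteq> N \<and> N \<subseteq> N' \<and> N \<inter> U = Q \<and> idx N Q = p ^ (m - s - d)}"
    proof -
      have "idx UNIV (ssum N E) = p ^ d \<longleftrightarrow> idx N Q = p ^ (m - s - d)"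
        if N: "N \<in> lattices p P" "pdiv p N = N'" for N
      proof
        assume "idx UNIV (ssum N E) = p ^ d"
        with nat_mult_eq_power[OF p0 _ d, of "idx N Q"] F3[OF N] show "idx N Q = p ^ (m - s - d)" by simp
      next
        assume "idx N Q = p ^ (m - s - d)"
        then have "p ^ (m - s) = p ^ (m - s - d) * idx UNIV (ssum N E)" using F3[OF N] by (simp add: mult.commute)
        from nat_mult_eq_power[OF p0 this] have "idx UNIV (ssum N E) = p ^ (m - s - (m - s - d))" by simp
        moreover have "m - s - (m - s - d) = d" using d by simp
        ultimately show "idx UNIV (ssum N E) = p ^ d" by (simp only:)
      qed
      then have "{N \<in> lattices p P. pdiv p N = N' \<and> idx UNIV (ssum N E) = p ^ d}
          = {N \<in> {N \<in> lattices p P. pdiv p N = N'}. idx N Q = p ^ (m - s - d)}" by auto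
      also have "\<dots> = {N. subgrp N \<and> Q \<subseteq> N \<and> N \<subseteq> N' \<and> N \<inter> U = Q \<and> idx N Q = p ^ (m - s - d)}"
        unfolding F1 by auto
      finally show ?thesis .
    qed
    moreover have "of_nat p * x \<in> Q" if "x \<in> N'" for x
      using pmul_memI[OF subgrp_J that, of p] Q(3) unfolding B_def by blast
    ultimately show ?thesis
      using card_subspaces[OF prime_p Q(1) U(1,3) iU n(1) U(4) _ iQ, of "m - s - d"]
      by (simp add: transfer_coeff_def)
  qed
qed

text \<open>The lattices are sorted by \<open>pdiv p N\<close>, which has index p^(j - d) and runs
  over lattices above \<open>pdiv p P\<close>; by \<open>fibre\<close> the number of N over it
  depends only on d and d'.\<close>

lemma num_lattices_rec:
  assumes P: "subgrp P" "J \<subseteq> P" "idx (ssum P E) E = p ^ s"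
  shows "int (num_lattices P d j) = (if d \<le> j \<and> d \<le> m - s
    then \<Sum>d'\<le>d. transfer_coeff (int p) 1 (m - s) d d' * int (num_lattices (pdiv p P) d' (j - d)) else 0)"
proof -
  define A where "A = {N \<in> lattices p P. idx UNIV N = p ^ j \<and> idx UNIV (ssum N E) = p ^ d}"
  define T where "T d' = {N \<in> lattices p (pdiv p P). idx UNIV N = p ^ (j - d) \<and> idx UNIV (ssum N E) = p ^ d'}" for d'
  have p0: "p > 0" using p_gt_1 by simp
  have JP': "J \<subseteq> pdiv p P" using P(2) subgrp_of_nat[OF subgrp_J] unfolding pdiv_def by blast
  have AT: "d \<le> j \<and> d \<le> m - s \<and> (\<exists>d'\<le>m. pdiv p N \<in> T d')" if "N \<in> A" for N
  proof -
    have N: "N \<in> lattices p P" "idx UNIV N = p ^ j" "idx UNIV (ssum N E) = p ^ d" using that by (auto simp: A_def)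
    note l = latticesD[OF N(1)] and l' = latticesD[OF lattices_pdiv[OF N(1)]]
    have "p ^ j = p ^ d * idx UNIV (pdiv p N)" using idx_lat_pdiv[OF l(1)] l(2) P(2) N by auto
    moreover from this have "p ^ d dvd p ^ j" by simp
    then have dj: "d \<le> j" using p_gt_1 by (metis power_dvd_imp_le)
    ultimately have ij: "idx UNIV (pdiv p N) = p ^ (j - d)" using nat_mult_eq_power[OF p0] by blast
    have "p ^ m = idx UNIV (ssum (pdiv p N) E) * idx (ssum (pdiv p N) E) E"
      using idx_tower[OF subgrp_E subgrp_ssum[OF l'(1) subgrp_E] subgrp_UNIV ssum_right[OF l'(1)]] idx_pmul_UNIV by simp
    then have "idx UNIV (ssum (pdiv p N) E) dvd p ^ m" by simp
    then obtain d' where d': "d' \<le> m" "idx UNIV (ssum (pdiv p N) E) = p ^ d'"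
      using divides_primepow_nat[OF prime_p] by blast
    have "pdiv p N \<in> T d'" using lattices_pdiv[OF N(1)] ij d'(2) by (simp add: T_def)
    then show ?thesis using dj fibre(3)[OF P lattices_pdiv[OF N(1)] d'(2) N(1) refl N(3)] d'(1) by blast
  qed
  show ?thesis
  proof (cases "d \<le> j \<and> d \<le> m - s")
    case False
    then have "A = {}" using AT by blast
    then show ?thesis using False by (auto simp: num_lattices_def A_def[symmetric])
  next
    case True
    have finT: "finite (T d')" for d'
      by (rule finite_subset[OF _ finite_lat[OF JP', of "j - d"]]) (auto simp: T_def)
    have finA: "finite A"
      by (rule finite_subset[OF _ finite_lat[OF P(2), of j]]) (auto simp: A_def)
    have cardT: "card (T d') = num_lattices (pdiv p P) d' (j - d)" for d' by (simp add: T_def num_lattices_def)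
    have fib: "int (card {N \<in> A. pdiv p N = N'}) = transfer_coeff (int p) 1 (m - s) d d'" if "N' \<in> T d'" for N' d'
    proof -
      have N': "N' \<in> lattices p (pdiv p P)" "idx UNIV N' = p ^ (j - d)" "idx UNIV (ssum N' E) = p ^ d'"
        using that by (auto simp: T_def)
      have "idx UNIV N = p ^ j" if "N \<in> lattices p P" "pdiv p N = N'" "idx UNIV (ssum N E) = p ^ d" for N
      proof -
        have "J \<subseteq> N" using latticesD(2)[OF that(1)] P(2) by blast
        then have "idx UNIV N = p ^ d * p ^ (j - d)" using idx_lat_pdiv[OF latticesD(1)[OF that(1)]] that N'(2) by simp
        then show ?thesis using True by (simp flip: power_add)
      qed
      then have "{N \<in> A. pdiv p N = N'} = {N \<in> lattices p P. pdiv p N = N' \<and> idx UNIV (ssum N E) = p ^ d}"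
        by (auto simp: A_def)
      then show ?thesis using fibre(4)[OF P N'(1,3)] True by simp
    qed
    have inj: "d1 = d2" if "N \<in> T d1" "N \<in> T d2" for N d1 d2
    proof -
      have "p ^ d1 = p ^ d2" using that by (simp add: T_def)
      then show ?thesis using p_gt_1 power_inject_exp by blast
    qed
    have "A = (\<Union>d'\<le>m. \<Union>N'\<in>T d'. {N \<in> A. pdiv p N = N'})" using AT by blast
    then have "card A = card (\<Union>d'\<le>m. \<Union>N'\<in>T d'. {N \<in> A. pdiv p N = N'})" by simp
    also have "\<dots> = (\<Sum>d'\<le>m. card (\<Union>N'\<in>T d'. {N \<in> A. pdiv p N = N'}))"
    proof (rule card_UN_disjoint)
      show "\<forall>i\<in>{..m}. finite (\<Union>N'\<in>T i. {N \<in> A. pdiv p N = N'})" using finT finA by auto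
      show "\<forall>i\<in>{..m}. \<forall>j\<in>{..m}. i \<noteq> j \<longrightarrow>
          (\<Union>N'\<in>T i. {N \<in> A. pdiv p N = N'}) \<inter> (\<Union>N'\<in>T j. {N \<in> A. pdiv p N = N'}) = {}"
        using inj by blast
    qed simp
    also have "\<dots> = (\<Sum>d'\<le>m. \<Sum>N'\<in>T d'. card {N \<in> A. pdiv p N = N'})"
    proof (rule sum.cong[OF refl], rule card_UN_disjoint)
      show "finite (T d')" for d' by (rule finT)
    qed (use finA in auto)
    finally have "int (card A) = (\<Sum>d'\<le>m. \<Sum>N'\<in>T d'. int (card {N \<in> A. pdiv p N = N'}))" by simp
    also have "\<dots> = (\<Sum>d'\<le>m. \<Sum>N'\<in>T d'. transfer_coeff (int p) 1 (m - s) d d')"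
      using fib by (intro sum.cong refl) auto
    also have "\<dots> = (\<Sum>d'\<le>m. transfer_coeff (int p) 1 (m - s) d d' * int (num_lattices (pdiv p P) d' (j - d)))"
      by (simp add: cardT mult.commute)
    \<comment> \<open>For d < d' <= m - s the coefficient is 0; for larger d' there is no lattice to
      count.\<close>
    also have "\<dots> = (\<Sum>d'\<le>d. transfer_coeff (int p) 1 (m - s) d d' * int (num_lattices (pdiv p P) d' (j - d)))"
    proof (rule sum.mono_neutral_right)
      show "\<forall>d'\<in>{..m} - {..d}. transfer_coeff (int p) 1 (m - s) d d' * int (num_lattices (pdiv p P) d' (j - d)) = 0"
      proof
        fix d' assume d': "d' \<in> {..m} - {..d}"
        show "transfer_coeff (int p) 1 (m - s) d d' * int (num_lattices (pdiv p P) d' (j - d)) = 0"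
        proof (cases "d' \<le> m - s")
          case True
          then show ?thesis using d' by (simp add: transfer_coeff_upper)
        next
          case False
          then have "T d' = {}" using fibre(2)[OF P] by (auto simp: T_def)
          then show ?thesis using cardT[of d'] by simp
        qed
      qed
      show "{..d} \<subseteq> {..m}" using True by auto
    qed simp
    finally show ?thesis using True by (simp add: num_lattices_def A_def)
  qed
qed

lemma lattices_pdiv_eq_UNIV:
  assumes "N \<in> lattices p P" "pdiv p N = N"
  shows "N = UNIV"
proof -
  have "of_nat p ^ i * y \<in> N \<Longrightarrow> y \<in> N" for i y
  proof (induction i)
    case (Suc i)
    then have "of_nat p ^ i * y \<in> pdiv p N" by (simp add: pdiv_def mult.assoc)
    then show ?case using Suc.IH assms(2) by simp
  qed simp
  then show ?thesis using latticesD(3)[OF assms(1)] by blast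
qed

lemma UNIV_lat: "UNIV \<in> lattices p P"
  by (auto simp: lattices_def)

text \<open>Nakayama: if N + E is everything, then N and \<open>pdiv p N\<close> have the same
  index, so they agree and N is everything. This normalizes the vectors at coordinate 0.\<close>

lemma num_lattices_0:
  assumes "J \<subseteq> P"
  shows "num_lattices P 0 j = (if j = 0 then 1 else 0)"
proof -
  have "N = UNIV" if N: "N \<in> lattices p P" "idx UNIV N = p ^ j" "idx UNIV (ssum N E) = 1" for N
  proof -
    note l = latticesD[OF N(1)]
    have "J \<subseteq> N" using assms l(2) by blast
    then have "idx UNIV N = idx UNIV (pdiv p N)" using idx_lat_pdiv[OF l(1)] N(3) by simp
    moreover have "idx UNIV N = idx UNIV (pdiv p N) * idx (pdiv p N) N"
      using idx_tower[OF l(1) subgrp_pdiv[OF l(1)] subgrp_UNIV pdiv_superset[OF l(1)], of p] by simp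
    moreover have "idx UNIV N \<noteq> 0" using N(2) p_gt_1 by simp
    ultimately have "idx (pdiv p N) N = 1" by simp
    then have "pdiv p N = N" using idx_eq_1D[OF _ l(1) subgrp_pdiv[OF l(1)] pdiv_superset[OF l(1)]] by blast
    then show ?thesis by (rule lattices_pdiv_eq_UNIV[OF N(1)])
  qed
  then have *: "{N \<in> lattices p P. idx UNIV N = p ^ j \<and> idx UNIV (ssum N E) = p ^ 0}
      \<subseteq> {UNIV}" by auto
  have "ssum UNIV E = UNIV" using ssum_left[OF subgrp_E, of UNIV] by blast
  moreover have "1 = p ^ j \<longleftrightarrow> j = 0" using power_inject_exp[OF p_gt_1, of 0 j] by auto
  ultimately have U: "UNIV \<in> {N \<in> lattices p P. idx UNIV N = p ^ j \<and> idx UNIV (ssum N E) = p ^ 0} \<longleftrightarrow> j = 0"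
    using UNIV_lat[of P] by (simp add: idx_self[OF subgrp_UNIV])
  show ?thesis
  proof (cases "j = 0")
    case True
    then have "{N \<in> lattices p P. idx UNIV N = p ^ j \<and> idx UNIV (ssum N E) = p ^ 0} = {UNIV}"
      using * U by blast
    then show ?thesis using True unfolding num_lattices_def by simp
  next
    case False
    then have "{N \<in> lattices p P. idx UNIV N = p ^ j \<and> idx UNIV (ssum N E) = p ^ 0} = {}"
      using * U by blast
    then show ?thesis using False unfolding num_lattices_def by (simp only: card.empty if_False)
  qed
qed

lemma codim_le:
  assumes "N \<in> lattices p P"
  obtains d where "d \<le> m" "idx UNIV (ssum N E) = p ^ d"
proof -
  note l = latticesD[OF assms]
  have "p ^ m = idx UNIV (ssum N E) * idx (ssum N E) E"
    using idx_tower[OF subgrp_E subgrp_ssum[OF l(1) subgrp_E] subgrp_UNIV ssum_right[OF l(1)]] idx_pmul_UNIV by simp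
  then have "idx UNIV (ssum N E) dvd p ^ m" by simp
  then show thesis using divides_primepow_nat[OF prime_p] that by blast
qed

lemma card_lat_conv_cnt:
  assumes "J \<subseteq> P"
  shows "card {N \<in> lattices p P. idx UNIV N = p ^ j} = (\<Sum>d\<le>m. num_lattices P d j)"
proof -
  let ?A = "\<lambda>d. {N \<in> lattices p P. idx UNIV N = p ^ j \<and> idx UNIV (ssum N E) = p ^ d}"
  have "{N \<in> lattices p P. idx UNIV N = p ^ j} = (\<Union>d\<le>m. ?A d)"
  proof (intro equalityI subsetI)
    fix N assume N: "N \<in> {N \<in> lattices p P. idx UNIV N = p ^ j}"
    then obtain d where "d \<le> m" "idx UNIV (ssum N E) = p ^ d" using codim_le[of N P] by blast
    then show "N \<in> (\<Union>d\<le>m. ?A d)" using N by auto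
  qed auto
  then have "card {N \<in> lattices p P. idx UNIV N = p ^ j} = card (\<Union>d\<le>m. ?A d)" by simp
  also have "\<dots> = (\<Sum>d\<le>m. card (?A d))"
  proof (rule card_UN_disjoint)
    have "finite (?A i)" for i by (rule finite_subset[OF _ finite_lat[OF assms, of j]]) auto
    then show "\<forall>i\<in>{..m}. finite (?A i)" by blast
    show "\<forall>i\<in>{..m}. \<forall>j\<in>{..m}. i \<noteq> j \<longrightarrow> ?A i \<inter> ?A j = {}"
      using p_gt_1 power_inject_exp by auto
  qed simp
  finally show ?thesis by (simp add: num_lattices_def)
qed

end

section \<open>Lattices in \<open>R\<^sup>3\<close>\<close>

definition vbox :: "'b set \<Rightarrow> 'b set \<Rightarrow> 'b set \<Rightarrow> ('b ^ 3) set" where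
  "vbox A B C = {v. v $ 1 \<in> A \<and> v $ 2 \<in> B \<and> v $ 3 \<in> C}"

lemma vec3_eqI: "(v :: 'b ^ 3) $ 1 = w $ 1 \<Longrightarrow> v $ 2 = w $ 2 \<Longrightarrow> v $ 3 = w $ 3 \<Longrightarrow> v = w"
  by (simp add: vec_eq_iff forall_3)

lemma subgrp_vbox: "subgrp A \<Longrightarrow> subgrp B \<Longrightarrow> subgrp C \<Longrightarrow> subgrp (vbox A B C :: ('b::comm_ring_1 ^ 3) set)"
  by (simp add: subgrp_def vbox_def)

lemma vbox_mono: "A \<subseteq> A' \<Longrightarrow> B \<subseteq> B' \<Longrightarrow> C \<subseteq> C' \<Longrightarrow> vbox A B C \<subseteq> vbox A' B' C'"
  by (auto simp: vbox_def)

lemma idx_vbox: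
  fixes A B C A' B' C' :: "'b::comm_ring_1 set"
  assumes s: "subgrp A" "subgrp B" "subgrp C" "subgrp A'" "subgrp B'" "subgrp C'" and sub: "A' \<subseteq> A" "B' \<subseteq> B" "C' \<subseteq> C"
  shows "idx (vbox A B C) (vbox A' B' C') = idx A A' * idx B B' * idx C C'"
proof -
  note z = s[THEN subgrp_0]
  have i1: "idx (vbox A B C) (vbox A' B C) = idx A A'"
  proof (rule idx_transfer[where h = "\<lambda>v. v $ 1"])
    fix x y assume "x \<in> vbox A B C" "y \<in> vbox A B C"
    then show "x $ 1 - y $ 1 \<in> A' \<longleftrightarrow> x - y \<in> vbox A' B C"
      using subgrp_diff[OF s(2)] subgrp_diff[OF s(3)] by (simp add: vbox_def)
  next
    fix a assume "a \<in> A"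
    then show "\<exists>x\<in>vbox A B C. x $ 1 - a \<in> A'" using z by (intro bexI[of _ "vector [a, 0, 0]"]) (auto simp: vbox_def)
  qed (use s subgrp_vbox in \<open>auto simp: vbox_def\<close>)
  have i2: "idx (vbox A' B C) (vbox A' B' C) = idx B B'"
  proof (rule idx_transfer[where h = "\<lambda>v. v $ 2"])
    fix x y assume "x \<in> vbox A' B C" "y \<in> vbox A' B C"
    then show "x $ 2 - y $ 2 \<in> B' \<longleftrightarrow> x - y \<in> vbox A' B' C"
      using subgrp_diff[OF s(4)] subgrp_diff[OF s(3)] by (simp add: vbox_def)
  next
    fix a assume "a \<in> B"
    then show "\<exists>x\<in>vbox A' B C. x $ 2 - a \<in> B'" using z by (intro bexI[of _ "vector [0, a, 0]"]) (auto simp: vbox_def)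
  qed (use s subgrp_vbox in \<open>auto simp: vbox_def\<close>)
  have i3: "idx (vbox A' B' C) (vbox A' B' C') = idx C C'"
  proof (rule idx_transfer[where h = "\<lambda>v. v $ 3"])
    fix x y assume "x \<in> vbox A' B' C" "y \<in> vbox A' B' C"
    then show "x $ 3 - y $ 3 \<in> C' \<longleftrightarrow> x - y \<in> vbox A' B' C'"
      using subgrp_diff[OF s(4)] subgrp_diff[OF s(5)] by (simp add: vbox_def)
  next
    fix a assume "a \<in> C"
    then show "\<exists>x\<in>vbox A' B' C. x $ 3 - a \<in> C'" using z by (intro bexI[of _ "vector [0, 0, a]"]) (auto simp: vbox_def)
  qed (use s subgrp_vbox in \<open>auto simp: vbox_def\<close>)
  have "idx (vbox A B C) (vbox A' B' C') = idx (vbox A B C) (vbox A' B C) * idx (vbox A' B C) (vbox A' B' C')"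
    by (rule idx_tower[OF subgrp_vbox[OF s(4-6)] subgrp_vbox[OF s(4) s(2,3)] subgrp_vbox[OF s(1-3)]
        vbox_mono[OF subset_refl sub(2,3)] vbox_mono[OF sub(1) subset_refl subset_refl]])
  also have "idx (vbox A' B C) (vbox A' B' C') = idx (vbox A' B C) (vbox A' B' C) * idx (vbox A' B' C) (vbox A' B' C')"
    by (rule idx_tower[OF subgrp_vbox[OF s(4-6)] subgrp_vbox[OF s(4,5) s(3)] subgrp_vbox[OF s(4) s(2,3)]
        vbox_mono[OF subset_refl subset_refl sub(3)] vbox_mono[OF subset_refl sub(2) subset_refl]])
  finally show ?thesis using i1 i2 i3 by simp
qed

lemma of_nat_vec_nth: "(of_nat k :: 'b::comm_ring_1 ^ 'n) $ i = of_nat k"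
  by (induction k) simp_all

lemma vbox_UNIV: "vbox UNIV UNIV UNIV = UNIV"
  by (simp add: vbox_def)

lemma qbin_of_int: "qbin (of_int q) n k = of_int (qbin q n k)"
  by (induction q n k rule: qbin.induct) simp_all

text \<open>Iteration makes D s divisible by every power of X. This serves to identify infinite sums
  by their recursion.\<close>

lemma fps_shift_unique:
  fixes D :: "nat \<Rightarrow> 'a::comm_ring_1 fps"
  assumes "\<And>s. D s = fps_X ^ r * D (Suc s)" "r \<ge> 1"
  shows "D s = 0"
proof (rule fps_ext)
  fix j
  have "D s = fps_X ^ (r * k) * D (s + k)" for k
  proof (induction k)
    case (Suc k)
    have "D (s + k) = fps_X ^ r * D (s + Suc k)" using assms(1)[of "s + k"] by simp
    with Suc show ?case by (simp add: power_add mult_ac)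
  qed simp
  from this[of "Suc j"] have "D s = fps_X ^ (r * Suc j) * D (s + Suc j)" .
  moreover have "j < r * Suc j"
  proof -
    have "1 * Suc j \<le> r * Suc j" using assms(2) by (rule mult_le_mono1)
    then show ?thesis by simp
  qed
  ultimately show "fps_nth (D s) j = fps_nth 0 j" by (simp only: fps_X_power_mult_nth if_True fps_zero_nth)
qed

text \<open>The X-adically convergent sum of X^(r k) A (s + k) over all k; for r > 0 only k <= j / r
  reaches coefficient j. The start s is variable so that the sum satisfies a recursion.\<close>

definition shift_sum :: "nat \<Rightarrow> (nat \<Rightarrow> 'a::comm_ring_1 fps) \<Rightarrow> nat \<Rightarrow> 'a fps" where
  "shift_sum r A s = Abs_fps (\<lambda>j. \<Sum>k\<le>j div r. fps_nth (A (s + k)) (j - r * k))"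

lemma shift_sum_rec:
  assumes "r \<ge> 1"
  shows "shift_sum r A s = A s + fps_X ^ r * shift_sum r A (Suc s)"
proof (rule fps_ext)
  fix j
  show "fps_nth (shift_sum r A s) j = fps_nth (A s + fps_X ^ r * shift_sum r A (Suc s)) j"
  proof (cases "j < r")
    case True
    then show ?thesis by (simp add: shift_sum_def fps_X_power_mult_nth)
  next
    case False
    then have "j div r = Suc ((j - r) div r)" using assms by (simp add: le_div_geq)
    moreover have "j - r * Suc k = j - r - r * k" for k by simp
    ultimately show ?thesis using False
      by (simp add: shift_sum_def fps_X_power_mult_nth sum.atMost_Suc_shift del: sum.atMost_Suc mult_Suc_right)
  qed
qed

text \<open>The ring \<open>R\<close> is \<open>'b\<close> modulo the ideal \<open>J\<close>, with uniformizer \<open>w\<close>. Subgroups of \<open>R\<close> are represented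
  by subgroups of \<open>'b\<close> containing \<open>J\<close>, which avoids forming the quotient.\<close>

locale ring_model =
  fixes p e f :: nat and J :: "'b::comm_ring_1 set" and w :: 'b
  assumes prime_p: "Factorial_Ring.prime p" and e1: "e \<ge> 1" and f1: "f \<ge> 1"
    and subgrp_J: "subgrp J" and J_mult: "x \<in> J \<Longrightarrow> r * x \<in> J"
    and w_cancel: "w * x \<in> J \<Longrightarrow> x \<in> J"
    and p_w: "of_nat p - w ^ e \<in> J"
    and card_residue: "idx UNIV {x. \<exists>y. x - w * y \<in> J} = p ^ f"
    and unit_mod: "(\<nexists>y. x - w * y \<in> J) \<Longrightarrow> \<exists>y. x * y - 1 \<in> J"
    and separated: "(\<And>k. \<exists>y. x - w ^ k * y \<in> J) \<Longrightarrow> x \<in> J"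
    and complete: "\<exists>x. \<forall>k. \<exists>y. x - (\<Sum>i<k. w ^ i * c i) - w ^ k * y \<in> J"
begin

definition I :: "nat \<Rightarrow> 'b set" where
  "I k = {x. \<exists>y. x - w ^ k * y \<in> J}"

lemma J_mult': "x \<in> J \<Longrightarrow> x * r \<in> J"
  by (subst mult.commute) (rule J_mult)

lemma J_add: "x \<in> J \<Longrightarrow> y \<in> J \<Longrightarrow> x + y \<in> J" and J_diff: "x \<in> J \<Longrightarrow> y \<in> J \<Longrightarrow> x - y \<in> J"
  and J_0: "0 \<in> J"
  using subgrp_add[OF subgrp_J] subgrp_diff[OF subgrp_J] subgrp_0[OF subgrp_J] by auto

lemma wpow_cancel: "w ^ k * x \<in> J \<Longrightarrow> x \<in> J"
  by (induction k) (auto simp: mult.assoc dest: w_cancel)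

lemma I_I: "x - w ^ k * y \<in> J \<Longrightarrow> x \<in> I k"
  by (auto simp: I_def)

lemma subgrp_I: "subgrp (I k)"
  unfolding subgrp_def
proof (intro conjI ballI)
  show "0 \<in> I k" using J_0 by (intro I_I[of _ _ 0]) simp
  fix x y assume "x \<in> I k" "y \<in> I k"
  then obtain a b where ab: "x - w ^ k * a \<in> J" "y - w ^ k * b \<in> J" by (auto simp: I_def)
  have "(x - y) - w ^ k * (a - b) = (x - w ^ k * a) - (y - w ^ k * b)" by (simp add: algebra_simps)
  also have "\<dots> \<in> J" by (rule J_diff[OF ab])
  finally show "x - y \<in> I k" by (rule I_I)
qed

lemma I_mult: "x \<in> I k \<Longrightarrow> r * x \<in> I k"
proof -
  assume "x \<in> I k"
  then obtain a where a: "x - w ^ k * a \<in> J" by (auto simp: I_def)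
  have "r * x - w ^ k * (r * a) = r * (x - w ^ k * a)" by (simp add: algebra_simps)
  also have "\<dots> \<in> J" by (rule J_mult[OF a])
  finally show "r * x \<in> I k" by (rule I_I)
qed

lemma J_sub_I: "J \<subseteq> I k"
  by (auto intro!: I_I[of _ _ 0])

lemma wpow_I: "w ^ k * x \<in> I k"
  using J_0 by (intro I_I[of _ _ x]) simp

lemma I_0: "I 0 = UNIV"
  using wpow_I[of 0] by auto

lemma wpow_I_iff: "w ^ k * x \<in> I (k + l) \<longleftrightarrow> x \<in> I l"
proof
  assume "w ^ k * x \<in> I (k + l)"
  then obtain a where "w ^ k * x - w ^ (k + l) * a \<in> J" by (auto simp: I_def)
  moreover have "w ^ k * x - w ^ (k + l) * a = w ^ k * (x - w ^ l * a)" by (simp add: algebra_simps power_add)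
  ultimately have "x - w ^ l * a \<in> J" using wpow_cancel by simp
  then show "x \<in> I l" by (rule I_I)
next
  assume "x \<in> I l"
  then obtain a where "x - w ^ l * a \<in> J" by (auto simp: I_def)
  then have "w ^ k * (x - w ^ l * a) \<in> J" by (rule J_mult)
  moreover have "w ^ k * x - w ^ (k + l) * a = w ^ k * (x - w ^ l * a)" by (simp add: algebra_simps power_add)
  ultimately show "w ^ k * x \<in> I (k + l)" by (metis I_I)
qed

lemma I_antimono: "k \<le> l \<Longrightarrow> I l \<subseteq> I k"
proof
  fix x assume "k \<le> l" "x \<in> I l"
  then obtain a where "x - w ^ l * a \<in> J" by (auto simp: I_def)
  moreover have "w ^ l * a = w ^ k * (w ^ (l - k) * a)" using \<open>k \<le> l\<close> by (simp flip: power_add mult.assoc)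
  ultimately show "x \<in> I k" by (intro I_I[of _ _ "w ^ (l - k) * a"]) simp
qed

lemma I_cong: "x - y \<in> I k \<Longrightarrow> x \<in> I k \<longleftrightarrow> y \<in> I k"
  using subgrp_add[OF subgrp_I, of "x - y" k y] subgrp_diff[OF subgrp_I, of x k "x - y"] by auto

text \<open>Multiplication by w^l identifies the residue field with I l / I (l + 1).\<close>

lemma idx_I:
  assumes "k \<le> l"
  shows "idx (I k) (I l) = p ^ (f * (l - k))"
  using assms
proof (induction l rule: dec_induct)
  case base
  then show ?case by (simp add: idx_self[OF subgrp_I])
next
  case (step l)
  have "idx UNIV (I 1) = idx (I l) (I (Suc l))"
  proof (rule idx_transfer[where h = "\<lambda>x. w ^ l * x"])
    show "\<And>x. x \<in> UNIV \<Longrightarrow> w ^ l * x \<in> I l" by (rule wpow_I)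
    show "w ^ l * x - w ^ l * y \<in> I (Suc l) \<longleftrightarrow> x - y \<in> I 1" for x y
      using wpow_I_iff[of l "x - y" 1] by (simp add: right_diff_distrib)
    fix z assume "z \<in> I l"
    then obtain a where "z - w ^ l * a \<in> J" by (auto simp: I_def)
    then show "\<exists>x\<in>UNIV. w ^ l * x - z \<in> I (Suc l)"
      using subgrp_diff_commute[OF subgrp_J] J_sub_I by blast
  qed (rule subgrp_I)+
  moreover have "idx UNIV (I 1) = p ^ f" using card_residue by (simp add: I_def)
  moreover have "idx (I k) (I (Suc l)) = idx (I k) (I l) * idx (I l) (I (Suc l))"
    by (rule idx_tower[OF subgrp_I subgrp_I subgrp_I]) (use step I_antimono in auto)
  ultimately show ?case using step by (simp add: Suc_diff_le power_add)
qed

lemma idx_UNIV_I: "idx UNIV (I k) = p ^ (f * k)"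
  using idx_I[of 0 k] by (simp add: I_0)

lemma p0: "p > 0" and p1: "p > 1"
  using prime_gt_1_nat[OF prime_p] by auto

lemma one_notin_I: "k \<ge> 1 \<Longrightarrow> 1 \<notin> I k"
proof
  assume k: "k \<ge> 1" "1 \<in> I k"
  then have "x \<in> I k" for x using I_mult[of 1 k x] by simp
  then have "I k = UNIV" by blast
  then have "p ^ (f * k) = 1" using idx_UNIV_I[of k] idx_self[OF subgrp_UNIV] by simp
  then show False using p1 f1 k by simp
qed

lemma p_mult: "of_nat p * x - w ^ e * x \<in> J"
  using J_mult'[OF p_w, of x] by (simp add: left_diff_distrib)

lemma ppow_mult: "of_nat p ^ i * x - w ^ (e * i) * x \<in> J"
proof (induction i)
  case (Suc i)
  have "of_nat p ^ Suc i * x - w ^ (e * Suc i) * x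
      = of_nat p * (of_nat p ^ i * x - w ^ (e * i) * x) + (of_nat p * (w ^ (e * i) * x) - w ^ e * (w ^ (e * i) * x))"
    by (simp add: algebra_simps power_add)
  also have "\<dots> \<in> J" by (rule J_add[OF J_mult[OF Suc] p_mult])
  finally show ?case .
qed (simp add: J_0)

text \<open>p and w^e agree modulo J. Truncated subtraction is right because I 0 is everything; it
  is the origin of the index max(k - e, 0).\<close>

lemma p_mult_I_iff: "of_nat p * x \<in> I k \<longleftrightarrow> x \<in> I (k - e)"
proof -
  have "of_nat p * x \<in> I k \<longleftrightarrow> w ^ e * x \<in> I k"
    by (rule I_cong) (use p_mult J_sub_I in blast)
  also have "\<dots> \<longleftrightarrow> x \<in> I (k - e)"
  proof (cases "e \<le> k")
    case True
    then show ?thesis using wpow_I_iff[of e x "k - e"] by simp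
  next
    case False
    then show ?thesis using wpow_I[of e x] I_antimono[of k e] I_0 by auto
  qed
  finally show ?thesis .
qed

lemma p_cancel: "of_nat p * x \<in> J \<Longrightarrow> x \<in> J"
proof -
  assume "of_nat p * x \<in> J"
  have "w ^ e * x = of_nat p * x - (of_nat p * x - w ^ e * x)" by simp
  also have "\<dots> \<in> J" by (rule J_diff[OF \<open>of_nat p * x \<in> J\<close> p_mult])
  finally show "x \<in> J" by (rule wpow_cancel)
qed

section \<open>The lattice R^3 and its subgroups prescribed by powers of w\<close>

abbreviation "VJ \<equiv> vbox J J J"

definition P :: "nat \<Rightarrow> ('b ^ 3) set" where
  "P k = vbox J J (I k)"

definition Dk :: "nat \<Rightarrow> ('b ^ 3) set" where
  "Dk k = vbox (I k) (I k) UNIV"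

abbreviation "n \<equiv> e * f"

lemma pmul_vbox: "pmul p VJ UNIV = vbox (I e) (I e) (I e)"
proof -
  have *: "(\<exists>a. x - of_nat p * a \<in> J) \<longleftrightarrow> x \<in> I e" for x
  proof -
    have "x - of_nat p * a \<in> J \<longleftrightarrow> x - w ^ e * a \<in> J" for a
    proof -
      have "x - of_nat p * a = (x - w ^ e * a) - (of_nat p * a - w ^ e * a)"
        "x - w ^ e * a = (x - of_nat p * a) + (of_nat p * a - w ^ e * a)" by simp_all
      then show ?thesis using J_diff[OF _ p_mult[of a]] J_add[OF _ p_mult[of a]] by metis
    qed
    then show ?thesis by (simp add: I_def)
  qed
  show ?thesis
  proof (intro equalityI subsetI)
    fix v assume "v \<in> pmul p VJ UNIV"
    then show "v \<in> vbox (I e) (I e) (I e)" by (auto simp: pmul_def vbox_def of_nat_vec_nth *[symmetric])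
  next
    fix v assume "v \<in> vbox (I e) (I e) (I e)"
    then obtain a b c where "v $ 1 - of_nat p * a \<in> J" "v $ 2 - of_nat p * b \<in> J" "v $ 3 - of_nat p * c \<in> J"
      by (auto simp: vbox_def *[symmetric])
    then have "v - of_nat p * vector [a, b, c] \<in> VJ" by (simp add: vbox_def of_nat_vec_nth)
    then show "v \<in> pmul p VJ UNIV" by (auto simp: pmul_def)
  qed
qed

sublocale L: plattice p "3 * n" VJ
proof
  show "Factorial_Ring.prime p" by (rule prime_p)
  show "subgrp VJ" by (intro subgrp_vbox subgrp_J)
  show "x \<in> VJ" if "of_nat p * x \<in> VJ" for x using that p_cancel by (simp add: vbox_def of_nat_vec_nth)
  have "idx (vbox UNIV UNIV UNIV) (vbox (I e) (I e) (I e)) = p ^ (f * e) * p ^ (f * e) * p ^ (f * e)"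
    by (subst idx_vbox) (simp_all add: subgrp_I idx_UNIV_I)
  also have "\<dots> = p ^ (f * e + f * e + f * e)" by (simp only: power_add)
  also have "f * e + f * e + f * e = 3 * n" by simp
  finally show "idx UNIV (pmul p VJ UNIV) = p ^ (3 * n)" unfolding pmul_vbox vbox_UNIV .
qed

lemma subgrp_P: "subgrp (P k)" and VJ_P: "VJ \<subseteq> P k"
  unfolding P_def using subgrp_vbox[OF subgrp_J subgrp_J subgrp_I] vbox_mono[OF subset_refl subset_refl J_sub_I] by auto

lemma subgrp_Dk: "subgrp (Dk k)"
  unfolding Dk_def by (intro subgrp_vbox subgrp_I subgrp_UNIV)

lemma pdiv_P: "pdiv p (P k) = P (k - e)"
proof -
  have "of_nat p * x \<in> J \<longleftrightarrow> x \<in> J" for x using p_cancel J_mult by blast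
  then show ?thesis by (auto simp: pdiv_def P_def vbox_def p_mult_I_iff of_nat_vec_nth)
qed

lemma ssum_P: "ssum (P k) L.E = vbox (I e) (I e) (I (min k e))"
  unfolding pmul_vbox P_def
proof (intro equalityI subsetI)
  fix v assume "v \<in> ssum (vbox J J (I k)) (vbox (I e) (I e) (I e))"
  then obtain a b where ab: "v = a + b" "a \<in> vbox J J (I k)" "b \<in> vbox (I e) (I e) (I e)"
    unfolding ssum_def by blast
  have 1: "a $ 1 \<in> I e" "a $ 2 \<in> I e" "a $ 3 \<in> I (min k e)" "b $ 3 \<in> I (min k e)"
    using ab J_sub_I I_antimono[of "min k e" k] I_antimono[of "min k e" e] by (auto simp: vbox_def)
  then show "v \<in> vbox (I e) (I e) (I (min k e))"
    using ab subgrp_add[OF subgrp_I 1(1)] subgrp_add[OF subgrp_I 1(2)] subgrp_add[OF subgrp_I 1(3,4)] by (simp add: vbox_def)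
next
  fix v assume v: "v \<in> vbox (I e) (I e) (I (min k e))"
  show "v \<in> ssum (vbox J J (I k)) (vbox (I e) (I e) (I e))"
  proof (cases "k \<le> e")
    case True
    show ?thesis
    proof (rule ssumI)
      show "vector [0, 0, v $ 3] \<in> vbox J J (I k)" using v True J_0 by (simp add: vbox_def)
      show "vector [v $ 1, v $ 2, 0] \<in> vbox (I e) (I e) (I e)" using v subgrp_0[OF subgrp_I] by (simp add: vbox_def)
    qed (auto intro!: vec3_eqI)
  next
    case False
    have "min k e = e" using False by simp
    then have "v \<in> vbox (I e) (I e) (I e)" using v by simp
    then show ?thesis using ssum_right[OF subgrp_vbox[OF subgrp_J subgrp_J subgrp_I[of k]]] by blast
  qed
qed

text \<open>Modulo p, the image of P k has dimension f (e - min k e), which lowers the size of the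
  transfer matrix from 3n to 2n + min k e * f.\<close>

lemma num_lattices_P:
  "int (L.num_lattices (P k) d j) = (if d \<le> j \<and> d \<le> 2 * n + min k e * f
    then \<Sum>d'\<le>d. transfer_coeff (int p) 1 (2 * n + min k e * f) d d' * int (L.num_lattices (P (k - e)) d' (j - d)) else 0)"
proof -
  have "idx (ssum (P k) L.E) L.E = idx (I e) (I e) * idx (I e) (I e) * idx (I (min k e)) (I e)"
    unfolding ssum_P unfolding pmul_vbox by (subst idx_vbox) (simp_all add: subgrp_I I_antimono)
  then have i: "idx (ssum (P k) L.E) L.E = p ^ (f * (e - min k e))"
    using idx_I[of "min k e" e] idx_self[OF subgrp_I] by simp
  have m: "3 * n - f * (e - min k e) = 2 * n + min k e * f"
    by (cases "k \<le> e") (simp_all add: algebra_simps diff_mult_distrib2)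
  show ?thesis using L.num_lattices_rec[OF subgrp_P VJ_P i, of d j] unfolding m pdiv_P .
qed

definition V :: "nat \<Rightarrow> nat \<Rightarrow> 'c::comm_ring_1 fps" where
  "V k d = Abs_fps (\<lambda>j. of_nat (L.num_lattices (P k) d j))"

lemma V_rec: "V k d = (transfer (of_nat p) fps_X (2 * n + min k e * f) (V (k - e)) d :: 'c::comm_ring_1 fps)"
proof (rule fps_ext)
  fix j
  let ?m = "2 * n + min k e * f"
  have transfer_coeff: "fps_nth (transfer_coeff (of_nat p) fps_X ?m d d' * F) j =
      (if d \<le> j then of_int (transfer_coeff (int p) 1 ?m d d') * fps_nth F (j - d) else 0)" for d' and F :: "'c fps"
  proof -
    have q: "qbin (of_nat p :: 'c fps) a b = of_int (qbin (int p) a b)" for a b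
      using qbin_of_int[of "int p" a b] by simp
    have "transfer_coeff (of_nat p) fps_X ?m d d' = fps_X ^ d * (of_int (transfer_coeff (int p) 1 ?m d d') :: 'c fps)"
      unfolding transfer_coeff_def q by simp
    then have "transfer_coeff (of_nat p) fps_X ?m d d' = fps_X ^ d * fps_const (of_int (transfer_coeff (int p) 1 ?m d d') :: 'c)"
      by (simp only: fps_of_int)
    then show ?thesis by (simp add: mult.assoc fps_X_power_mult_nth)
  qed
  have "fps_nth (V k d) j = (of_int (int (L.num_lattices (P k) d j)) :: 'c)" by (simp add: V_def)
  also have "\<dots> = fps_nth (transfer (of_nat p) fps_X ?m (V (k - e)) d) j"
    by (subst num_lattices_P) (simp add: transfer_def fps_sum_nth transfer_coeff V_def)
  finally show "fps_nth (V k d) j = fps_nth (transfer (of_nat p) fps_X ?m (V (k - e)) d :: 'c fps) j" .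
qed

lemma V_0_0: "V k 0 = 1"
  by (rule fps_ext) (simp add: V_def L.num_lattices_0[OF VJ_P])

section \<open>Normal lattices, sorted by the divisibility of their first two coordinates\<close>

definition ncond :: "('b ^ 3) set \<Rightarrow> bool" where
  "ncond N \<longleftrightarrow> (\<forall>v\<in>N. \<forall>r. vector [0, 0, r * v $ 1] \<in> N \<and> vector [0, 0, r * v $ 2] \<in> N)"

text \<open>Preimages under this map divide the first two coordinates by w^k; the third is left
  alone, so that a lattice above P l stays above P l.\<close>

definition hk :: "nat \<Rightarrow> 'b ^ 3 \<Rightarrow> 'b ^ 3" where
  "hk k v = vector [w ^ k * v $ 1, w ^ k * v $ 2, v $ 3]"

lemma hk_diff: "hk k (x - y) = hk k x - hk k y"
  by (rule vec3_eqI) (simp_all add: hk_def algebra_simps)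

lemma hk_0: "hk k 0 = 0"
  by (rule vec3_eqI) (simp_all add: hk_def)

lemma hk_ppow: "hk k (of_nat p ^ i * x) = of_nat p ^ i * hk k x"
proof -
  have "(of_nat p ^ i :: 'b ^ 3) $ l = of_nat p ^ i" for l
    by (induction i) (simp_all add: of_nat_vec_nth)
  then show ?thesis by (intro vec3_eqI) (simp_all add: hk_def mult_ac)
qed

lemma ppow_nth: "(of_nat p ^ i * x :: 'b ^ 3) $ l = of_nat p ^ i * x $ l"
proof -
  have "(of_nat p ^ i :: 'b ^ 3) $ l = of_nat p ^ i" by (induction i) (simp_all add: of_nat_vec_nth)
  then show ?thesis by simp
qed

lemma hk_VJ_iff: "hk k v \<in> VJ \<longleftrightarrow> v \<in> VJ"
proof -
  have "w ^ k * x \<in> J \<longleftrightarrow> x \<in> J" for x using wpow_cancel J_mult by blast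
  then show ?thesis by (simp add: vbox_def hk_def)
qed

lemma Dk_hk:
  assumes "z \<in> Dk k"
  obtains x where "z - hk k x \<in> VJ"
proof -
  obtain a b where "z $ 1 - w ^ k * a \<in> J" "z $ 2 - w ^ k * b \<in> J"
    using assms by (auto simp: Dk_def vbox_def I_def)
  then have "z - hk k (vector [a, b, z $ 3]) \<in> VJ" by (simp add: vbox_def hk_def J_0)
  then show thesis by (rule that)
qed

lemma hk_Dk: "hk k v \<in> Dk k"
  using wpow_I by (simp add: Dk_def vbox_def hk_def)

lemma idx_Dk: "idx UNIV (Dk k) = p ^ (2 * f * k)"
proof -
  have "idx (vbox UNIV UNIV UNIV) (Dk k) = p ^ (f * k) * p ^ (f * k) * 1"
    unfolding Dk_def by (subst idx_vbox) (simp_all add: subgrp_I idx_UNIV_I idx_self[OF subgrp_UNIV])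
  also have "\<dots> = p ^ (f * k + f * k)" by (simp add: power_add)
  also have "f * k + f * k = 2 * f * k" by simp
  finally show ?thesis unfolding vbox_UNIV .
qed

lemma card_lat_Dk:
  "card {N \<in> lattices p (P l). N \<subseteq> Dk k \<and> idx UNIV N = p ^ j}
    = (if 2 * f * k \<le> j then card {N \<in> lattices p (P l). idx UNIV N = p ^ (j - 2 * f * k)} else 0)"
proof -
  let ?S = "{N \<in> lattices p (P l). N \<subseteq> Dk k \<and> idx UNIV N = p ^ j}"
  define \<phi> where "\<phi> N = {v. hk k v \<in> N}" for N
  \<comment> \<open>The image under \<open>hk k\<close>, enlarged by \<open>VJ\<close> because
    subgroups of the quotient are represented by their preimages.\<close>
  define \<psi> where "\<psi> M = {v. \<exists>u\<in>M. v - hk k u \<in> VJ}" for M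
  have VJl: "VJ \<subseteq> N" if "N \<in> lattices p (P l)" for N using latticesD(2)[OF that] VJ_P by blast
  have subgrp\<phi>: "subgrp (\<phi> N)" if "subgrp N" for N
    unfolding subgrp_def \<phi>_def mem_Collect_eq hk_0 hk_diff
    by (intro conjI ballI subgrp_0[OF that], unfold mem_Collect_eq, rule subgrp_diff[OF that])
  have idx\<phi>: "idx UNIV N = p ^ (2 * f * k) * idx UNIV (\<phi> N)" if N: "N \<in> lattices p (P l)" "N \<subseteq> Dk k" for N
  proof -
    note l = latticesD[OF N(1)]
    note s = subgrp\<phi>[OF l(1)]
    have "idx UNIV (\<phi> N) = idx (Dk k) N"
    proof (rule idx_transfer[where h = "hk k"])
      show "hk k x - hk k y \<in> N \<longleftrightarrow> x - y \<in> \<phi> N" for x y by (simp add: \<phi>_def hk_diff)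
      fix z assume "z \<in> Dk k"
      then obtain x where "z - hk k x \<in> VJ" by (rule Dk_hk)
      then have "hk k x - z \<in> N" using VJl[OF N(1)] subgrp_diff_commute[OF l(1)] by blast
      then show "\<exists>x\<in>UNIV. hk k x - z \<in> N" by blast
    qed (use s l hk_Dk in auto)
    then show ?thesis using idx_tower[OF l(1) subgrp_Dk subgrp_UNIV N(2)] idx_Dk by simp
  qed
  have \<phi>_lat: "\<phi> N \<in> lattices p (P l)" if N: "N \<in> lattices p (P l)" for N
  proof -
    note l = latticesD[OF N]
    have "subgrp (\<phi> N)" by (rule subgrp\<phi>[OF l(1)])
    moreover have "P l \<subseteq> \<phi> N" using l(2) J_mult by (auto simp: \<phi>_def P_def vbox_def hk_def)
    moreover have "\<exists>i. \<forall>x. of_nat p ^ i * x \<in> \<phi> N" using l(3) by (auto simp: \<phi>_def hk_ppow)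
    ultimately show ?thesis by (simp add: lattices_def)
  qed
  have \<psi>_lat: "\<psi> M \<in> lattices p (P l) \<and> \<psi> M \<subseteq> Dk k \<and> \<phi> (\<psi> M) = M" if M: "M \<in> lattices p (P l)" for M
  proof (intro conjI)
    note l = latticesD[OF M]
    show D: "\<psi> M \<subseteq> Dk k"
    proof
      fix v assume "v \<in> \<psi> M"
      then obtain u where "v - hk k u \<in> VJ" by (auto simp: \<psi>_def)
      then have "v - hk k u \<in> Dk k" using J_sub_I by (auto simp: Dk_def vbox_def)
      from subgrp_add[OF subgrp_Dk this hk_Dk[of k u]] show "v \<in> Dk k" by simp
    qed
    show "\<phi> (\<psi> M) = M"
    proof (intro equalityI subsetI)
      fix v assume "v \<in> \<phi> (\<psi> M)"
      then obtain u where u: "u \<in> M" "hk k v - hk k u \<in> VJ" by (auto simp: \<phi>_def \<psi>_def)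
      then have "v - u \<in> VJ" using hk_VJ_iff[of k "v - u"] by (simp add: hk_diff)
      then have "v - u \<in> M" using VJl[OF M] by blast
      from subgrp_add[OF l(1) this u(1)] show "v \<in> M" by simp
    next
      fix v assume "v \<in> M"
      moreover have "hk k v - hk k v \<in> VJ" using subgrp_0[OF L.subgrp_J] by simp
      ultimately show "v \<in> \<phi> (\<psi> M)" unfolding \<phi>_def \<psi>_def by blast
    qed
    have s: "subgrp (\<psi> M)"
      unfolding subgrp_def
    proof (intro conjI ballI)
      have "0 - hk k 0 \<in> VJ" using J_0 by (simp add: vbox_def hk_def)
      then show "0 \<in> \<psi> M" using subgrp_0[OF l(1)] unfolding \<psi>_def by blast
      fix x y assume "x \<in> \<psi> M" "y \<in> \<psi> M"
      then obtain u v where uv: "u \<in> M" "v \<in> M" "x - hk k u \<in> VJ" "y - hk k v \<in> VJ" by (auto simp: \<psi>_def)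
      have "(x - y) - hk k (u - v) = (x - hk k u) - (y - hk k v)" by (simp add: hk_diff)
      also have "\<dots> \<in> VJ" by (rule subgrp_diff[OF L.subgrp_J uv(3,4)])
      finally show "x - y \<in> \<psi> M" using subgrp_diff[OF l(1) uv(1,2)] unfolding \<psi>_def by blast
    qed
    have "P l \<subseteq> \<psi> M"
    proof
      fix v assume v: "v \<in> P l"
      have "vector [0, 0, v $ 3] \<in> M" using v l(2) J_0 by (auto simp: P_def vbox_def)
      moreover have "v - hk k (vector [0, 0, v $ 3]) \<in> VJ" using v J_0 by (simp add: P_def vbox_def hk_def)
      ultimately show "v \<in> \<psi> M" unfolding \<psi>_def by blast
    qed
    moreover have "\<exists>i. \<forall>x. of_nat p ^ i * x \<in> \<psi> M"
    proof -
      obtain i where i: "\<forall>x. of_nat p ^ i * x \<in> M" using l(3) by blast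
      have "of_nat p ^ (i + k) * x \<in> \<psi> M" for x
      proof -
        \<comment> \<open>p^k is w^(e k) modulo J and e k >= k, so w^k can be split off in the first
          two coordinates, leaving w^(e k - k); the third keeps p^k.\<close>
        let ?u = "of_nat p ^ i * vector [w ^ (e * k - k) * x $ 1, w ^ (e * k - k) * x $ 2, of_nat p ^ k * x $ 3]"
        have ek: "e * k = k + (e * k - k)" using e1 by simp
        have *: "of_nat p ^ (i + k) * y - w ^ k * (of_nat p ^ i * (w ^ (e * k - k) * y)) \<in> J" for y
        proof -
          have "of_nat p ^ (i + k) * y - w ^ k * (of_nat p ^ i * (w ^ (e * k - k) * y))
              = of_nat p ^ i * (of_nat p ^ k * y - w ^ (k + (e * k - k)) * y)"
            by (simp add: algebra_simps power_add)
          also have "\<dots> \<in> J" using J_mult[OF ppow_mult[of k y]] ek by simp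
          finally show ?thesis .
        qed
        have "of_nat p ^ (i + k) * x - hk k ?u \<in> VJ"
          using *[of "x $ 1"] *[of "x $ 2"] J_0
          by (simp add: vbox_def hk_def ppow_nth power_add mult.assoc del: vector_mult_component)
        then show ?thesis using i unfolding \<psi>_def by blast
      qed
      then show ?thesis by blast
    qed
    ultimately show "\<psi> M \<in> lattices p (P l)" using s by (simp add: lattices_def)
  qed
  have \<psi>\<phi>: "\<psi> (\<phi> N) = N" if N: "N \<in> lattices p (P l)" "N \<subseteq> Dk k" for N
  proof (intro equalityI subsetI)
    note l = latticesD[OF N(1)]
    fix v assume "v \<in> \<psi> (\<phi> N)"
    then obtain u where u: "hk k u \<in> N" "v - hk k u \<in> VJ" by (auto simp: \<phi>_def \<psi>_def)
    then have "v - hk k u \<in> N" using VJl[OF N(1)] by blast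
    from subgrp_add[OF l(1) this u(1)] show "v \<in> N" by simp
  next
    note l = latticesD[OF N(1)]
    fix v assume v: "v \<in> N"
    then have "v \<in> Dk k" using N(2) by blast
    then obtain x where x: "v - hk k x \<in> VJ" by (rule Dk_hk)
    then have "v - (v - hk k x) \<in> N" using subgrp_diff[OF l(1) v] VJl[OF N(1)] by blast
    then show "v \<in> \<psi> (\<phi> N)" using x unfolding \<phi>_def \<psi>_def by auto
  qed
  show ?thesis
  proof (cases "2 * f * k \<le> j")
    case True
    let ?T = "{N \<in> lattices p (P l). idx UNIV N = p ^ (j - 2 * f * k)}"
    have split: "p ^ j = p ^ (2 * f * k) * p ^ (j - 2 * f * k)" using True by (simp flip: power_add)
    have "bij_betw \<phi> ?S ?T"
    proof (rule bij_betw_byWitness[where f' = \<psi>])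
      show "\<phi> ` ?S \<subseteq> ?T" using idx\<phi> \<phi>_lat split p0 by auto
      show "\<psi> ` ?T \<subseteq> ?S" using idx\<phi>[of "\<psi> _"] \<psi>_lat split by auto
    qed (use \<psi>\<phi> \<psi>_lat in auto)
    then show ?thesis using True bij_betw_same_card by simp
  next
    case False
    have "?S = {}"
    proof (rule ccontr)
      assume "?S \<noteq> {}"
      then obtain N where "N \<in> lattices p (P l)" "N \<subseteq> Dk k" "idx UNIV N = p ^ j" by blast
      then have "p ^ j = p ^ (2 * f * k) * idx UNIV (\<phi> N)" using idx\<phi>[of N] by simp
      then have "p ^ (2 * f * k) dvd p ^ j" by (rule dvdI)
      then show False using False p1 by (metis power_dvd_imp_le)
    qed
    then show ?thesis using False by (simp only: card.empty if_False)
  qed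
qed

lemma Dk_antimono: "k \<le> l \<Longrightarrow> Dk l \<subseteq> Dk k"
  unfolding Dk_def by (intro vbox_mono I_antimono) auto

text \<open>For the maximal k, a coordinate of some element of N is w^k times a unit; its
  R-multiples, which normality puts into the third coordinate, fill w^k R.\<close>

lemma ncond_iff:
  assumes "N \<in> lattices p VJ"
  shows "ncond N \<longleftrightarrow> (\<exists>k. N \<in> lattices p (P k) \<and> N \<subseteq> Dk k \<and> \<not> N \<subseteq> Dk (Suc k))"
proof
  note l = latticesD[OF assms]
  assume nc: "ncond N"
  obtain i where i: "\<forall>x. of_nat p ^ i * x \<in> N" using l(3) by blast
  \<comment> \<open>A maximal k exists: N contains p^i times the first unit vector, and p^i has
    valuation e i.\<close>
  have "\<not> N \<subseteq> Dk (Suc (e * i))"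
  proof
    assume "N \<subseteq> Dk (Suc (e * i))"
    then have "of_nat p ^ i * vector [1, 0, 0] \<in> Dk (Suc (e * i))" using i by blast
    then have "of_nat p ^ i * 1 \<in> I (Suc (e * i))" by (simp add: Dk_def vbox_def ppow_nth del: vector_mult_component)
    then have "w ^ (e * i) * 1 \<in> I (e * i + 1)"
      using I_cong[of "of_nat p ^ i * 1" "w ^ (e * i) * 1" "Suc (e * i)"] ppow_mult[of i 1] J_sub_I by auto
    then show False using wpow_I_iff[of "e * i" 1 1] one_notin_I[of 1] by simp
  qed
  then have ex: "\<exists>k. \<not> N \<subseteq> Dk (Suc k)" by blast
  define k where "k = (LEAST k. \<not> N \<subseteq> Dk (Suc k))"
  have k1: "\<not> N \<subseteq> Dk (Suc k)" unfolding k_def using ex by (rule LeastI_ex)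
  have k0: "N \<subseteq> Dk k"
  proof (cases k)
    case 0
    then show ?thesis by (simp add: Dk_def I_0 vbox_UNIV)
  next
    case (Suc k')
    then have "k' < (LEAST k. \<not> N \<subseteq> Dk (Suc k))" by (simp add: k_def)
    from not_less_Least[OF this] show ?thesis using Suc by simp
  qed
  obtain v where v: "v \<in> N" "v \<notin> Dk (Suc k)" using k1 by blast
  have "\<exists>a. a \<in> I k \<and> a \<notin> I (Suc k) \<and> (\<forall>r. vector [0, 0, r * a] \<in> N)"
  proof -
    have "v \<in> Dk k" using v k0 by blast
    then have "v $ 1 \<in> I k" "v $ 2 \<in> I k" "v $ 1 \<notin> I (Suc k) \<or> v $ 2 \<notin> I (Suc k)"
      using v(2) by (auto simp: Dk_def vbox_def)
    then show ?thesis using nc v(1) unfolding ncond_def by metis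
  qed
  then obtain a where a: "a \<in> I k" "a \<notin> I (Suc k)" "\<And>r. vector [0, 0, r * a] \<in> N" by blast
  obtain u where u: "a - w ^ k * u \<in> J" using a(1) by (auto simp: I_def)
  have "u \<notin> I 1"
  proof
    assume "u \<in> I 1"
    then have "w ^ k * u \<in> I (Suc k)" using wpow_I_iff[of k u 1] by simp
    then show False using I_cong[of a "w ^ k * u" "Suc k"] u J_sub_I a(2) by blast
  qed
  then obtain u' where u': "u * u' - 1 \<in> J" using unit_mod[of u] by (auto simp: I_def)
  have "P k \<subseteq> N"
  proof
    fix x assume x: "x \<in> P k"
    then obtain y where y: "x $ 3 - w ^ k * y \<in> J" by (auto simp: P_def vbox_def I_def)
    \<comment> \<open>With a = w^k u and u u' = 1 modulo J, the multiplier y u' turns a into w^k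
      y.\<close>
    have "x $ 3 - y * u' * a = (x $ 3 - w ^ k * y) - (y * u') * (a - w ^ k * u) - (w ^ k * y) * (u * u' - 1)"
      by (simp add: algebra_simps)
    also have "\<dots> \<in> J" by (intro J_diff y J_mult u u')
    finally have "x - vector [0, 0, y * u' * a] \<in> VJ" using x by (simp add: P_def vbox_def)
    then have "x - vector [0, 0, y * u' * a] \<in> N" using l(2) by blast
    from subgrp_add[OF l(1) this a(3)[of "y * u'"]] show "x \<in> N" by simp
  qed
  then have "N \<in> lattices p (P k)" using l by (simp add: lattices_def)
  then show "\<exists>k. N \<in> lattices p (P k) \<and> N \<subseteq> Dk k \<and> \<not> N \<subseteq> Dk (Suc k)" using k0 k1 by blast
next
  assume "\<exists>k. N \<in> lattices p (P k) \<and> N \<subseteq> Dk k \<and> \<not> N \<subseteq> Dk (Suc k)"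
  then obtain k where k: "N \<in> lattices p (P k)" "N \<subseteq> Dk k" by blast
  show "ncond N"
    unfolding ncond_def
  proof (intro ballI allI conjI)
    fix v r assume "v \<in> N"
    then have "v $ 1 \<in> I k" "v $ 2 \<in> I k" using k(2) by (auto simp: Dk_def vbox_def)
    then have "vector [0, 0, r * v $ 1] \<in> P k" "vector [0, 0, r * v $ 2] \<in> P k"
      using I_mult J_0 by (simp_all add: P_def vbox_def)
    then show "vector [0, 0, r * v $ 1] \<in> N" "vector [0, 0, r * v $ 2] \<in> N"
      using latticesD(2)[OF k(1)] by blast+
  qed
qed

text \<open>The lattices with exact k are those in Dk k without those in Dk (k + 1). By
  \<open>card_lat_Dk\<close> the second family is counted by the same numbers at an exponent lower
  by 2f; hence the factor 1 - y^(2f).\<close>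

lemma card_normal:
  "int (card {N \<in> lattices p VJ. ncond N \<and> idx UNIV N = p ^ j})
    = (\<Sum>k\<le>j div (2 * f). int (card {N \<in> lattices p (P k). idx UNIV N = p ^ (j - 2 * f * k)}))
      - (if 2 * f \<le> j then \<Sum>k\<le>(j - 2 * f) div (2 * f).
          int (card {N \<in> lattices p (P k). idx UNIV N = p ^ (j - 2 * f - 2 * f * k)}) else 0)"
proof -
  define S where "S k = {N \<in> lattices p (P k). N \<subseteq> Dk k \<and> \<not> N \<subseteq> Dk (Suc k) \<and> idx UNIV N = p ^ j}" for k
  define g where "g k i = int (card {N \<in> lattices p (P k). idx UNIV N = p ^ i})" for k i
  let ?K = "j div (2 * f)"
  have fin: "finite {N \<in> lattices p (P k). N \<subseteq> Dk l \<and> idx UNIV N = p ^ j}" for k l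
    by (rule finite_subset[OF _ L.finite_lat[OF VJ_P[of k], of j]]) auto
  have finS: "finite (S k)" for k by (rule finite_subset[OF _ fin[of k k]]) (auto simp: S_def)
  have cS: "int (card (S k)) = (if 2 * f * k \<le> j then g k (j - 2 * f * k) else 0)
      - (if 2 * f * Suc k \<le> j then g k (j - 2 * f * Suc k) else 0)" for k
  proof -
    have "{N \<in> lattices p (P k). N \<subseteq> Dk k \<and> idx UNIV N = p ^ j}
        = S k \<union> {N \<in> lattices p (P k). N \<subseteq> Dk (Suc k) \<and> idx UNIV N = p ^ j}"
      using Dk_antimono[of k "Suc k"] by (auto simp: S_def)
    moreover have "S k \<inter> {N \<in> lattices p (P k). N \<subseteq> Dk (Suc k) \<and> idx UNIV N = p ^ j} = {}"
      by (auto simp: S_def)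
    ultimately have "card {N \<in> lattices p (P k). N \<subseteq> Dk k \<and> idx UNIV N = p ^ j}
        = card (S k) + card {N \<in> lattices p (P k). N \<subseteq> Dk (Suc k) \<and> idx UNIV N = p ^ j}"
      using card_Un_disjoint[OF finS fin] by simp
    then show ?thesis unfolding card_lat_Dk g_def by (simp split: if_splits)
  qed
  have SK: "k \<le> ?K" if "N \<in> S k" for N k
  proof -
    have "card {N \<in> lattices p (P k). N \<subseteq> Dk k \<and> idx UNIV N = p ^ j} \<noteq> 0"
      using that fin[of k k] by (auto simp: S_def)
    then have "2 * f * k \<le> j" unfolding card_lat_Dk by (simp split: if_splits)
    then show ?thesis using f1 by (simp add: less_eq_div_iff_mult_less_eq mult.commute)
  qed
  have lattices_VJ: "N \<in> lattices p VJ" if "N \<in> lattices p (P k)" for N k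
    using that VJ_P by (auto simp: lattices_def)
  have "{N \<in> lattices p VJ. ncond N \<and> idx UNIV N = p ^ j} = (\<Union>k\<le>?K. S k)"
  proof (intro equalityI subsetI)
    fix N assume N: "N \<in> {N \<in> lattices p VJ. ncond N \<and> idx UNIV N = p ^ j}"
    then obtain k where "N \<in> S k" using ncond_iff[of N] by (auto simp: S_def)
    then show "N \<in> (\<Union>k\<le>?K. S k)" using SK by blast
  next
    fix N assume "N \<in> (\<Union>k\<le>?K. S k)"
    then obtain k where "N \<in> S k" by blast
    then show "N \<in> {N \<in> lattices p VJ. ncond N \<and> idx UNIV N = p ^ j}"
      using ncond_iff[of N] lattices_VJ by (auto simp: S_def)
  qed
  moreover have "S k \<inter> S l = {}" if "k \<noteq> l" for k l
  proof -
    have "S k \<inter> S l = {}" if "k < l" for k l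
    proof -
      have "Dk l \<subseteq> Dk (Suc k)" using that by (intro Dk_antimono) simp
      then show ?thesis by (auto simp: S_def)
    qed
    then show ?thesis using that by (metis Int_commute linorder_neqE_nat)
  qed
  then have "card (\<Union>k\<le>?K. S k) = (\<Sum>k\<le>?K. card (S k))"
    by (intro card_UN_disjoint) (auto simp: finS)
  ultimately have "int (card {N \<in> lattices p VJ. ncond N \<and> idx UNIV N = p ^ j}) = (\<Sum>k\<le>?K. int (card (S k)))"
    by simp
  also have "\<dots> = (\<Sum>k\<le>?K. if 2 * f * k \<le> j then g k (j - 2 * f * k) else 0)
      - (\<Sum>k\<le>?K. if 2 * f * Suc k \<le> j then g k (j - 2 * f * Suc k) else 0)"
    unfolding cS by (rule sum_subtractf)
  also have "(\<Sum>k\<le>?K. if 2 * f * k \<le> j then g k (j - 2 * f * k) else 0) = (\<Sum>k\<le>?K. g k (j - 2 * f * k))"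
    using f1 by (intro sum.cong) (auto simp: less_eq_div_iff_mult_less_eq mult.commute)
  also have "(\<Sum>k\<le>?K. if 2 * f * Suc k \<le> j then g k (j - 2 * f * Suc k) else 0)
      = (if 2 * f \<le> j then \<Sum>k\<le>(j - 2 * f) div (2 * f). g k (j - 2 * f - 2 * f * k) else 0)"
  proof (cases "2 * f \<le> j")
    case True
    have iff: "2 * f * Suc k \<le> j \<longleftrightarrow> k \<le> (j - 2 * f) div (2 * f)" for k
      using f1 True by (simp add: less_eq_div_iff_mult_less_eq mult.commute le_diff_conv2 add.commute)
    have "(\<Sum>k\<le>?K. if 2 * f * Suc k \<le> j then g k (j - 2 * f * Suc k) else 0)
        = (\<Sum>k\<le>(j - 2 * f) div (2 * f). if 2 * f * Suc k \<le> j then g k (j - 2 * f * Suc k) else 0)"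
    proof (rule sum.mono_neutral_right)
      show "{..(j - 2 * f) div (2 * f)} \<subseteq> {..?K}" by (auto intro: order.trans div_le_mono)
      show "\<forall>i\<in>{..?K} - {..(j - 2 * f) div (2 * f)}. (if 2 * f * Suc i \<le> j then g i (j - 2 * f * Suc i) else 0) = 0"
        using iff by auto
    qed simp
    also have "\<dots> = (\<Sum>k\<le>(j - 2 * f) div (2 * f). g k (j - 2 * f - 2 * f * k))"
      using iff by (intro sum.cong) auto
    finally show ?thesis using True by simp
  next
    case False
    then show ?thesis by (auto intro!: sum.neutral)
  qed
  finally show ?thesis unfolding g_def .
qed

definition nfps :: "'c::comm_ring_1 fps" where
  "nfps = Abs_fps (\<lambda>j. of_nat (card {N \<in> lattices p VJ. ncond N \<and> idx UNIV N = p ^ j}))"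

definition NV :: "nat \<Rightarrow> 'c::comm_ring_1 fps" where
  "NV d = shift_sum (2 * f) (\<lambda>k. V k d) 0"

lemma nfps_eq: "nfps = (1 - fps_X ^ (2 * f)) * (\<Sum>d\<le>3 * n. NV d :: 'c::comm_ring_1 fps)"
proof (rule fps_ext)
  fix j
  have g: "(\<Sum>d\<le>3 * n. fps_nth (V k d) i) = (of_nat (card {N \<in> lattices p (P k). idx UNIV N = p ^ i}) :: 'c)" for k i
    by (simp add: V_def L.card_lat_conv_cnt[OF VJ_P])
  have S: "fps_nth (\<Sum>d\<le>3 * n. NV d) i
      = (\<Sum>k\<le>i div (2 * f). of_nat (card {N \<in> lattices p (P k). idx UNIV N = p ^ (i - 2 * f * k)}) :: 'c)" for i
    unfolding fps_sum_nth NV_def shift_sum_def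
    by (simp add: g[symmetric]) (rule sum.swap)
  have "fps_nth nfps j = (of_int (int (card {N \<in> lattices p VJ. ncond N \<and> idx UNIV N = p ^ j})) :: 'c)"
    by (simp add: nfps_def)
  also have "\<dots> = fps_nth ((1 - fps_X ^ (2 * f)) * (\<Sum>d\<le>3 * n. NV d)) j"
    unfolding card_normal left_diff_distrib mult_1 fps_sub_nth fps_X_power_mult_nth S by simp
  finally show "fps_nth nfps j = fps_nth ((1 - fps_X ^ (2 * f)) * (\<Sum>d\<le>3 * n. NV d) :: 'c fps) j" .
qed

text \<open>The terms k < e are split off; the tail is u^e times the series of the V (k + e), and V
  (k + e) is the operator of size 3n applied to V k. That this operator may be pulled out of the
  infinite sum follows from the common recursion of both sides.\<close>

lemma NV_eq:
  "(NV d :: 'c::comm_ring_1 fps) = (\<Sum>b<e. (fps_X ^ (2 * f)) ^ b * transfer (of_nat p) fps_X (2 * n + b * f) (V 0) d)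
    + (fps_X ^ (2 * f)) ^ e * transfer (of_nat p) fps_X (3 * n) NV (d :: nat)"
proof -
  let ?u = "fps_X ^ (2 * f) :: 'c fps"
  define A :: "nat \<Rightarrow> nat \<Rightarrow> 'c fps" where "A d s = shift_sum (2 * f) (\<lambda>k. V k d) s" for d s
  have r: "2 * f \<ge> 1" using f1 by simp
  have rec: "A d s = V s d + ?u * A d (Suc s)" for d s unfolding A_def by (rule shift_sum_rec[OF r])
  have fin: "A d 0 = (\<Sum>b<i. ?u ^ b * V b d) + ?u ^ i * A d i" for i
  proof (induction i)
    case (Suc i)
    note Suc.IH
    also have "A d i = V i d + ?u * A d (Suc i)" by (rule rec)
    finally show ?case by (simp add: distrib_left mult_ac)
  qed simp
  define D where "D s = A d (s + e) - transfer (of_nat p) fps_X (3 * n) (\<lambda>d. A d s) d" for s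
  have Vs: "V (s + e) d = transfer (of_nat p) fps_X (3 * n) (V s) d" for s
    using V_rec[of "s + e" d] by simp
  have "D s = ?u * D (Suc s)" for s
  proof -
    have "transfer (of_nat p) fps_X (3 * n) (\<lambda>d. A d s) d
        = transfer (of_nat p) fps_X (3 * n) (\<lambda>d. V s d + ?u * A d (Suc s)) d"
      by (rule arg_cong[of _ _ "\<lambda>v. transfer (of_nat p) fps_X (3 * n) v d"], rule ext, rule rec)
    also have "\<dots> = V (s + e) d + ?u * transfer (of_nat p) fps_X (3 * n) (\<lambda>d. A d (Suc s)) d"
      by (simp only: transfer_add transfer_scale Vs)
    finally have t: "transfer (of_nat p) fps_X (3 * n) (\<lambda>d. A d s) d
        = V (s + e) d + ?u * transfer (of_nat p) fps_X (3 * n) (\<lambda>d. A d (Suc s)) d" .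
    have "D s = (V (s + e) d + ?u * A d (Suc (s + e))) - transfer (of_nat p) fps_X (3 * n) (\<lambda>d. A d s) d"
      unfolding D_def using rec[of d "s + e"] by (simp only:)
    then show ?thesis unfolding t D_def by (simp add: right_diff_distrib)
  qed
  then have "D 0 = 0" by (rule fps_shift_unique[OF _ r])
  then have Ae: "A d e = transfer (of_nat p) fps_X (3 * n) (\<lambda>d. A d 0) d" by (simp add: D_def)
  have "(V b d :: 'c fps) = transfer (of_nat p) fps_X (2 * n + b * f) (V 0) d" if "b < e" for b
    using V_rec[of b d, where ?'c = 'c] that by simp
  then have "(\<Sum>b<e. ?u ^ b * V b d) = (\<Sum>b<e. ?u ^ b * transfer (of_nat p) fps_X (2 * n + b * f) (V 0) d)"
    by (intro sum.cong refl) simp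
  then have "A d 0 = (\<Sum>b<e. ?u ^ b * transfer (of_nat p) fps_X (2 * n + b * f) (V 0) d) + ?u ^ e * A d e"
    using fin[of e] by simp
  from this[unfolded Ae] show ?thesis unfolding A_def NV_def .
qed

lemma V0_eq: "transfer (of_nat p) fps_X (2 * n) (V 0) = (V 0 :: nat \<Rightarrow> 'c::comm_ring_1 fps)"
proof
  fix d
  show "transfer (of_nat p) fps_X (2 * n) (V 0) d = (V 0 d :: 'c fps)"
    using V_rec[of 0 d, where ?'c = 'c] by (simp only: min_0L mult_zero_left add_0_right diff_0_eq_0)
qed

end

section \<open>The functional equation\<close>

text \<open>The closed formulas are evaluated in polynomials, power series, complex numbers and
  rational functions; homomorphisms carry them from one ring to another.\<close>

locale rhom =
  fixes h :: "'a::comm_ring_1 \<Rightarrow> 'b::comm_ring_1"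
  assumes hadd: "h (a + b) = h a + h b" and hmult: "h (a * b) = h a * h b" and hone: "h 1 = 1"
begin

lemma hzero: "h 0 = 0"
  using hadd[of 0 0] by simp

lemma hdiff: "h (a - b) = h a - h b"
  using hadd[of "a - b" b] by simp

lemma hsum: "h (sum g A) = (\<Sum>i\<in>A. h (g i))"
  by (induction A rule: infinite_finite_induct) (simp_all add: hzero hadd)

lemma hprod: "h (prod g A) = (\<Prod>i\<in>A. h (g i))"
  by (induction A rule: infinite_finite_induct) (simp_all add: hone hmult)

lemma hpower: "h (a ^ k) = h a ^ k"
  by (induction k) (simp_all add: hone hmult)

lemma hqbin: "h (qbin q n k) = qbin (h q) n k"
  by (induction q n k rule: qbin.induct) (simp_all add: hone hzero hadd hmult hpower)

lemma htr: "h (transfer_coeff x y m i j) = transfer_coeff (h x) (h y) m i j"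
  by (simp add: transfer_coeff_def hmult hpower hqbin)

lemma htmat: "h (transfer x y m v i) = transfer (h x) (h y) m (\<lambda>i. h (v i)) i"
  by (simp add: transfer_def hsum hmult htr hzero)

end

text \<open>\<open>trisol\<close> clears denominators in the solution of a lower triangular linear system with
  diagonal \<open>D\<close>.\<close>

fun trisol :: "(nat \<Rightarrow> 'a::comm_ring_1) \<Rightarrow> (nat \<Rightarrow> nat \<Rightarrow> 'a) \<Rightarrow> (nat \<Rightarrow> 'a) \<Rightarrow> nat \<Rightarrow> 'a" where
  "trisol D L b i = b i * (\<Prod>l<i. D l)
     + (\<Sum>j\<in>set [0..<i]. L i j * trisol D L b j * (\<Prod>l\<in>{j<..<i}. D l))"

declare trisol.simps [simp del]

lemma trisol_rec: "trisol D L b i = b i * (\<Prod>l<i. D l)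
     + (\<Sum>j<i. L i j * trisol D L b j * (\<Prod>l\<in>{j<..<i}. D l))"
  by (subst trisol.simps) (simp add: atLeast0LessThan)

lemma (in rhom) htrisol:
  "h (trisol D L b i) = trisol (\<lambda>i. h (D i)) (\<lambda>i j. h (L i j)) (\<lambda>i. h (b i)) i"
proof (induction i rule: less_induct)
  case (less i)
  then show ?case
    by (subst (1 2) trisol_rec) (simp add: hadd hmult hsum hprod)
qed

lemma prod_split_at:
  fixes D :: "nat \<Rightarrow> 'a::comm_ring_1"
  shows "j < i \<Longrightarrow> (\<Prod>l\<le>j. D l) * (\<Prod>l\<in>{j<..<i}. D l) = (\<Prod>l<i. D l)"
    and "i \<le> m \<Longrightarrow> (\<Prod>l\<le>i. D l) * (\<Prod>l\<in>{i<..m}. D l) = (\<Prod>l\<le>m. D l)"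
proof -
  assume "j < i"
  then have "{..<i} = {..j} \<union> {j<..<i}" by auto
  then show "(\<Prod>l\<le>j. D l) * (\<Prod>l\<in>{j<..<i}. D l) = (\<Prod>l<i. D l)"
    by (simp add: prod.union_disjoint[symmetric] disjoint_iff)
next
  assume "i \<le> m"
  then have "{..m} = {..i} \<union> {i<..m}" by auto
  then show "(\<Prod>l\<le>i. D l) * (\<Prod>l\<in>{i<..m}. D l) = (\<Prod>l\<le>m. D l)"
    by (simp add: prod.union_disjoint[symmetric] disjoint_iff)
qed

text \<open>Holds over any commutative ring; the product of the diagonal entries up to i acts as the
  denominator of coordinate i.\<close>

lemma trisol_eq:
  assumes "\<And>i. i \<le> m \<Longrightarrow> D i * v i = b i + (\<Sum>j<i. L i j * v j)" "i \<le> m"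
  shows "trisol D L b i = v i * (\<Prod>l\<le>i. D l)"
  using assms(2)
proof (induction i rule: less_induct)
  case (less i)
  have "(\<Sum>j<i. L i j * trisol D L b j * (\<Prod>l\<in>{j<..<i}. D l)) = (\<Sum>j<i. L i j * v j * (\<Prod>l<i. D l))"
  proof (rule sum.cong[OF refl])
    fix j assume "j \<in> {..<i}"
    then have "trisol D L b j = v j * (\<Prod>l\<le>j. D l)" "j < i" using less by auto
    then show "L i j * trisol D L b j * (\<Prod>l\<in>{j<..<i}. D l) = L i j * v j * (\<Prod>l<i. D l)"
      using prod_split_at(1)[of j i D] by (simp add: mult.assoc)
  qed
  then have "trisol D L b i = (b i + (\<Sum>j<i. L i j * v j)) * (\<Prod>l<i. D l)"
    by (subst trisol_rec) (simp add: distrib_right sum_distrib_right)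
  also have "\<dots> = v i * (\<Prod>l\<le>i. D l)"
    unfolding assms(1)[OF less.prems, symmetric] by (simp add: lessThan_Suc_atMost[symmetric] mult_ac)
  finally show ?case .
qed

lemma triangular_solution:
  fixes D :: "nat \<Rightarrow> 'a::field"
  assumes "\<And>i. D i \<noteq> 0"
  shows "\<exists>v. \<forall>i. D i * v i = b i + (\<Sum>j<i. L i j * v j)"
proof (intro exI allI)
  fix i
  let ?v = "\<lambda>i. trisol D L b i / (\<Prod>l\<le>i. D l)"
  have nz: "(\<Prod>l<i. D l) \<noteq> 0" for i using assms by simp
  have "(\<Sum>j<i. L i j * trisol D L b j * (\<Prod>l\<in>{j<..<i}. D l)) = (\<Sum>j<i. L i j * ?v j) * (\<Prod>l<i. D l)"
    unfolding sum_distrib_right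
  proof (rule sum.cong[OF refl])
    fix j assume "j \<in> {..<i}"
    then have s: "(\<Prod>l<i. D l) = (\<Prod>l\<le>j. D l) * (\<Prod>l\<in>{j<..<i}. D l)"
      by (simp add: prod_split_at(1))
    have "(\<Prod>l\<le>j. D l) \<noteq> 0" using assms by simp
    then show "L i j * trisol D L b j * (\<Prod>l\<in>{j<..<i}. D l) = L i j * ?v j * (\<Prod>l<i. D l)"
      unfolding s by simp
  qed
  then have "trisol D L b i = (b i + (\<Sum>j<i. L i j * ?v j)) * (\<Prod>l<i. D l)"
    by (subst trisol_rec) (simp add: distrib_right)
  moreover have "D i * ?v i = trisol D L b i / (\<Prod>l<i. D l)"
    using assms by (simp add: lessThan_Suc_atMost[symmetric])
  ultimately show "D i * ?v i = b i + (\<Sum>j<i. L i j * ?v j)" using nz by simp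
qed

text \<open>The diagonal entry of \<open>1 - T\<close> at \<open>0\<close> vanishes; the fixed vector \<open>Z\<close> of \<open>T\<close> is normalized by \<open>Z 0 = 1\<close>
  instead. The vector \<open>N\<close> stands for \<open>\<Sum>\<^sub>k y\<^bsup>2fk\<^esup> V\<^sub>k\<close>.\<close>

definition Zdiag :: "'a::comm_ring_1 \<Rightarrow> 'a \<Rightarrow> nat \<Rightarrow> nat \<Rightarrow> 'a" where
  "Zdiag x y n i = (if i = 0 then 1 else 1 - transfer_coeff x y (2 * n) i i)"

definition Znum :: "'a::comm_ring_1 \<Rightarrow> 'a \<Rightarrow> nat \<Rightarrow> nat \<Rightarrow> 'a" where
  "Znum x y n i = (if i \<le> 2 * n
     then trisol (Zdiag x y n) (transfer_coeff x y (2 * n)) (\<lambda>i. if i = 0 then 1 else 0) i * (\<Prod>l\<in>{i<..2 * n}. Zdiag x y n l)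
     else 0)"

definition Ndiag :: "'a::comm_ring_1 \<Rightarrow> 'a \<Rightarrow> nat \<Rightarrow> nat \<Rightarrow> nat \<Rightarrow> 'a" where
  "Ndiag x y e f i = 1 - (y ^ (2 * f)) ^ e * transfer_coeff x y (3 * (e * f)) i i"

definition Nnum :: "'a::comm_ring_1 \<Rightarrow> 'a \<Rightarrow> nat \<Rightarrow> nat \<Rightarrow> nat \<Rightarrow> 'a" where
  "Nnum x y e f i = trisol (Ndiag x y e f) (\<lambda>i j. (y ^ (2 * f)) ^ e * transfer_coeff x y (3 * (e * f)) i j)
     (\<lambda>i. \<Sum>b<e. (y ^ (2 * f)) ^ b * transfer x y (2 * (e * f) + b * f) (Znum x y (e * f)) i) i"

text \<open>Free of division, so that it makes sense in every commutative ring and commutes with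
  ring homomorphisms. The products over \<open>l\<close> bring each coordinate to the common
  denominator \<open>zeta_den\<close>.\<close>

definition zeta_num :: "nat \<Rightarrow> nat \<Rightarrow> 'a::comm_ring_1 \<Rightarrow> 'a \<Rightarrow> 'a" where
  "zeta_num e f x y = (1 - y ^ (2 * f)) *
     (\<Sum>i\<le>3 * (e * f). Nnum x y e f i * (\<Prod>l\<in>{i<..3 * (e * f)}. Ndiag x y e f l))"

definition zeta_den :: "nat \<Rightarrow> nat \<Rightarrow> 'a::comm_ring_1 \<Rightarrow> 'a \<Rightarrow> 'a" where
  "zeta_den e f x y = (\<Prod>l\<le>2 * (e * f). Zdiag x y (e * f) l) * (\<Prod>l\<le>3 * (e * f). Ndiag x y e f l)"

lemma (in rhom) hzeta: "h (zeta_num e f x y) = zeta_num e f (h x) (h y)"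
  "h (zeta_den e f x y) = zeta_den e f (h x) (h y)"
proof -
  have Zd: "h (Zdiag x y n i) = Zdiag (h x) (h y) n i" for n i
    by (simp add: Zdiag_def hone hdiff htr)
  have Zn: "h (Znum x y n i) = Znum (h x) (h y) n i" for n i
    by (simp add: Znum_def hmult hprod htrisol Zd htr hzero hone if_distrib[of h] cong: if_cong)
  have Nd: "h (Ndiag x y e f i) = Ndiag (h x) (h y) e f i" for i
    by (simp add: Ndiag_def hone hdiff htr hmult hpower)
  have Nn: "h (Nnum x y e f i) = Nnum (h x) (h y) e f i" for i
    by (simp add: Nnum_def htrisol Nd hmult hpower htr hsum htmat Zn)
  show "h (zeta_num e f x y) = zeta_num e f (h x) (h y)"
    by (simp add: zeta_num_def hmult hdiff hone hpower hsum hprod Nn Nd)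
  show "h (zeta_den e f x y) = zeta_den e f (h x) (h y)"
    by (simp add: zeta_den_def hmult hprod Zd Nd)
qed

lemma transfer_split:
  "i \<le> m \<Longrightarrow> transfer x y m v i = transfer_coeff x y m i i * v i + (\<Sum>j<i. transfer_coeff x y m i j * v j)"
  by (simp add: transfer_def lessThan_Suc_atMost[symmetric])

text \<open>Used twice: with the vectors of an actual ring of integers it evaluates the zeta
  function, and with a solution over a field it transports the functional equation to the closed
  formula.\<close>

lemma zeta_num_eq:
  fixes x y :: "'a::comm_ring_1"
  assumes Z: "transfer x y (2 * (e * f)) Z = Z" "Z 0 = 1"
    and N: "\<And>i. N i = (\<Sum>b<e. (y ^ (2 * f)) ^ b * transfer x y (2 * (e * f) + b * f) Z i)
      + (y ^ (2 * f)) ^ e * transfer x y (3 * (e * f)) N i"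
  shows "zeta_num e f x y = (1 - y ^ (2 * f)) * (\<Sum>i\<le>3 * (e * f). N i) * zeta_den e f x y"
proof -
  let ?n = "e * f" and ?u = "y ^ (2 * f)"
  define P where "P = (\<Prod>l\<le>2 * ?n. Zdiag x y ?n l)"
  define Q where "Q = (\<Prod>l\<le>3 * ?n. Ndiag x y e f l)"
  have Zs: "trisol (Zdiag x y ?n) (transfer_coeff x y (2 * ?n)) (\<lambda>i. if i = 0 then 1 else 0) i = Z i * (\<Prod>l\<le>i. Zdiag x y ?n l)"
    if "i \<le> 2 * ?n" for i
  proof (rule trisol_eq[OF _ that])
    fix i assume i: "i \<le> 2 * ?n"
    show "Zdiag x y ?n i * Z i = (if i = 0 then 1 else 0) + (\<Sum>j<i. transfer_coeff x y (2 * ?n) i j * Z j)"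
    proof (cases "i = 0")
      case True
      then show ?thesis by (simp add: Zdiag_def Z(2))
    next
      case False
      have "Z i = transfer_coeff x y (2 * ?n) i i * Z i + (\<Sum>j<i. transfer_coeff x y (2 * ?n) i j * Z j)"
        using transfer_split[OF i, of x y Z] unfolding Z(1) .
      then have "Z i - transfer_coeff x y (2 * ?n) i i * Z i = (\<Sum>j<i. transfer_coeff x y (2 * ?n) i j * Z j)"
        by (simp only: diff_eq_eq add.commute)
      then show ?thesis using False by (simp add: Zdiag_def left_diff_distrib)
    qed
  qed
  have Zn: "Znum x y ?n i = P * Z i" for i
  proof (cases "i \<le> 2 * ?n")
    case True
    then show ?thesis using Zs[OF True] prod_split_at(2)[OF True, of "Zdiag x y ?n"]
      by (simp add: Znum_def P_def mult.assoc mult.commute)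
  next
    case False
    then have "Z i = 0" using fun_cong[OF Z(1), of i] by (simp add: transfer_def)
    then show ?thesis using False by (simp add: Znum_def)
  qed
  have Ns: "Nnum x y e f i = (P * N i) * (\<Prod>l\<le>i. Ndiag x y e f l)" if "i \<le> 3 * ?n" for i
    unfolding Nnum_def
  proof (rule trisol_eq[OF _ that])
    fix i assume i: "i \<le> 3 * ?n"
    let ?W = "\<Sum>b<e. ?u ^ b * transfer x y (2 * ?n + b * f) Z i"
    have W: "(\<Sum>b<e. ?u ^ b * transfer x y (2 * ?n + b * f) (Znum x y ?n) i) = P * ?W"
    proof -
      have "transfer x y m (Znum x y ?n) i = P * transfer x y m Z i" for m
        unfolding Zn[abs_def] by (rule transfer_scale)
      then show ?thesis by (simp add: sum_distrib_left mult_ac)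
    qed
    have "N i = ?W + ?u ^ e * (transfer_coeff x y (3 * ?n) i i * N i + (\<Sum>j<i. transfer_coeff x y (3 * ?n) i j * N j))"
      using N[of i] unfolding transfer_split[OF i, of x y N] .
    then have "N i - ?u ^ e * transfer_coeff x y (3 * ?n) i i * N i = ?W + ?u ^ e * (\<Sum>j<i. transfer_coeff x y (3 * ?n) i j * N j)"
      by (simp only: diff_eq_eq) (simp only: algebra_simps)
    then have "P * (N i - ?u ^ e * transfer_coeff x y (3 * ?n) i i * N i) = P * (?W + ?u ^ e * (\<Sum>j<i. transfer_coeff x y (3 * ?n) i j * N j))"
      by (simp only:)
    moreover have "P * (?u ^ e * (\<Sum>j<i. transfer_coeff x y (3 * ?n) i j * N j)) = (\<Sum>j<i. ?u ^ e * transfer_coeff x y (3 * ?n) i j * (P * N j))"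
      by (simp only: sum_distrib_left mult_ac)
    ultimately have "P * (N i - ?u ^ e * transfer_coeff x y (3 * ?n) i i * N i) = P * ?W + (\<Sum>j<i. ?u ^ e * transfer_coeff x y (3 * ?n) i j * (P * N j))"
      by (simp only: distrib_left)
    moreover have "Ndiag x y e f i * (P * N i) = P * (N i - ?u ^ e * transfer_coeff x y (3 * ?n) i i * N i)"
      by (simp add: Ndiag_def left_diff_distrib right_diff_distrib mult_ac)
    ultimately show "Ndiag x y e f i * (P * N i) = (\<Sum>b<e. ?u ^ b * transfer x y (2 * ?n + b * f) (Znum x y ?n) i)
        + (\<Sum>j<i. ?u ^ e * transfer_coeff x y (3 * ?n) i j * (P * N j))"
      unfolding W by (simp only:)
  qed
  have "(\<Sum>i\<le>3 * ?n. Nnum x y e f i * (\<Prod>l\<in>{i<..3 * ?n}. Ndiag x y e f l)) = (\<Sum>i\<le>3 * ?n. N i * (P * Q))"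
  proof (rule sum.cong[OF refl])
    fix i assume i: "i \<in> {..3 * ?n}"
    show "Nnum x y e f i * (\<Prod>l\<in>{i<..3 * ?n}. Ndiag x y e f l) = N i * (P * Q)"
      using Ns[of i] prod_split_at(2)[of i "3 * ?n" "Ndiag x y e f"] i by (simp add: Q_def mult_ac)
  qed
  then show ?thesis unfolding zeta_num_def zeta_den_def P_def[symmetric] Q_def[symmetric]
    by (simp add: sum_distrib_right mult.assoc)
qed

lemma zeta_den_nonzero:
  fixes x y :: "'a::idom"
  assumes "e \<ge> 1" "f \<ge> 1" and gen: "\<And>i k. 0 < i \<Longrightarrow> y ^ i * x ^ k \<noteq> 1"
  shows "zeta_den e f x y \<noteq> 0"
proof -
  have "Zdiag x y n i \<noteq> 0" for n i
    using gen[of i "i * (2 * n - i)"] by (auto simp: Zdiag_def transfer_coeff_def)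
  moreover have "Ndiag x y e f i \<noteq> 0" for i
  proof -
    have "(y ^ (2 * f)) ^ e * transfer_coeff x y (3 * (e * f)) i i = y ^ (2 * f * e + i) * x ^ (i * (3 * (e * f) - i))"
      by (simp add: transfer_coeff_def power_add power_mult)
    moreover have "2 * f * e + i > 0" using assms by simp
    ultimately show ?thesis using gen by (auto simp: Ndiag_def)
  qed
  ultimately show ?thesis by (simp add: zeta_den_def)
qed

text \<open>Over a general field no lattices supply the vectors, so the triangular systems are
  solved directly; \<open>gen\<close> makes their diagonals invertible. The solutions are cut off at
  2n and 3n because the operators are.\<close>

lemma zeta_solution:
  fixes x y :: "'a::field"
  assumes ef: "e \<ge> 1" "f \<ge> 1" and gen: "\<And>i k. 0 < i \<Longrightarrow> y ^ i * x ^ k \<noteq> 1"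
  shows "\<exists>Z N. transfer x y (2 * (e * f)) Z = Z \<and> Z 0 = 1 \<and> (\<forall>i. N i = (\<Sum>b<e. (y ^ (2 * f)) ^ b * transfer x y (2 * (e * f) + b * f) Z i)
      + (y ^ (2 * f)) ^ e * transfer x y (3 * (e * f)) N i)"
proof -
  let ?n = "e * f" and ?u = "y ^ (2 * f)"
  have "Zdiag x y ?n i \<noteq> 0" for i
    using gen[of i "i * (2 * ?n - i)"] by (auto simp: Zdiag_def transfer_coeff_def)
  then obtain v where v: "\<And>i. Zdiag x y ?n i * v i = (if i = 0 then 1 else 0) + (\<Sum>j<i. transfer_coeff x y (2 * ?n) i j * v j)"
    using triangular_solution[of "Zdiag x y ?n" "\<lambda>i. if i = 0 then 1 else 0" "transfer_coeff x y (2 * ?n)"] by blast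
  define Z where "Z i = (if i \<le> 2 * ?n then v i else 0)" for i
  have Z0: "Z 0 = 1" using v[of 0] by (simp add: Z_def Zdiag_def)
  have Z: "transfer x y (2 * ?n) Z = Z"
  proof
    fix i
    show "transfer x y (2 * ?n) Z i = Z i"
    proof (cases "i \<le> 2 * ?n")
      case False
      then show ?thesis by (simp add: transfer_def Z_def)
    next
      case True
      have s: "(\<Sum>j<i. transfer_coeff x y (2 * ?n) i j * Z j) = (\<Sum>j<i. transfer_coeff x y (2 * ?n) i j * v j)"
        using True by (intro sum.cong) (auto simp: Z_def)
      show ?thesis
      proof (cases "i = 0")
        case True
        then show ?thesis by (simp add: transfer_0)
      next
        case i0: False
        have "v i - transfer_coeff x y (2 * ?n) i i * v i = (\<Sum>j<i. transfer_coeff x y (2 * ?n) i j * v j)"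
          using v[of i] i0 by (simp add: Zdiag_def left_diff_distrib)
        then show ?thesis unfolding transfer_split[OF True] s using True by (simp add: Z_def algebra_simps)
      qed
    qed
  qed
  have lt: "b * f < ?n" if "b < e" for b using that ef by simp
  have "Ndiag x y e f i \<noteq> 0" for i
  proof -
    have "?u ^ e * transfer_coeff x y (3 * ?n) i i = y ^ (2 * f * e + i) * x ^ (i * (3 * ?n - i))"
      by (simp add: transfer_coeff_def power_add power_mult)
    moreover have "2 * f * e + i > 0" using ef by simp
    ultimately show ?thesis using gen by (auto simp: Ndiag_def)
  qed
  then obtain w where w: "\<And>i. Ndiag x y e f i * w i = (\<Sum>b<e. ?u ^ b * transfer x y (2 * ?n + b * f) Z i)
      + (\<Sum>j<i. ?u ^ e * transfer_coeff x y (3 * ?n) i j * w j)"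
    using triangular_solution[of "Ndiag x y e f" "\<lambda>i. \<Sum>b<e. ?u ^ b * transfer x y (2 * ?n + b * f) Z i"
      "\<lambda>i j. ?u ^ e * transfer_coeff x y (3 * ?n) i j"] by blast
  define N where "N i = (if i \<le> 3 * ?n then w i else 0)" for i
  have N: "N i = (\<Sum>b<e. ?u ^ b * transfer x y (2 * ?n + b * f) Z i) + ?u ^ e * transfer x y (3 * ?n) N i" for i
  proof (cases "i \<le> 3 * ?n")
    case False
    have "transfer x y (2 * ?n + b * f) Z i = 0" if "b < e" for b
    proof -
      have "\<not> i \<le> 2 * ?n + b * f" using lt[OF that] False by linarith
      then show ?thesis by (simp add: transfer_def)
    qed
    then show ?thesis using False by (simp add: N_def transfer_def)
  next
    case True
    have s: "(\<Sum>j<i. transfer_coeff x y (3 * ?n) i j * N j) = (\<Sum>j<i. transfer_coeff x y (3 * ?n) i j * w j)"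
      using True by (intro sum.cong) (auto simp: N_def)
    have "w i - ?u ^ e * transfer_coeff x y (3 * ?n) i i * w i = (\<Sum>b<e. ?u ^ b * transfer x y (2 * ?n + b * f) Z i)
        + ?u ^ e * (\<Sum>j<i. transfer_coeff x y (3 * ?n) i j * w j)"
      using w[of i] by (simp add: Ndiag_def left_diff_distrib sum_distrib_left mult.assoc)
    then show ?thesis unfolding transfer_split[OF True] s using True by (simp add: N_def algebra_simps)
  qed
  show ?thesis using Z Z0 N by blast
qed

theorem zeta_functional_equation:
  fixes x y :: "'a::field"
  assumes ef: "e \<ge> 1" "f \<ge> 1" and n: "n = e * f" and x: "x \<noteq> 0" and y: "y \<noteq> 0"
    and gen: "\<And>i k. 0 < i \<Longrightarrow> y ^ i * x ^ k \<noteq> 1"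
  shows "zeta_num e f (inverse x) (inverse y) / zeta_den e f (inverse x) (inverse y)
    = (- 1) ^ (3 * n) * x ^ (3 * n choose 2) * y ^ (5 * n + 2 * (e - 1) * f) * (zeta_num e f x y / zeta_den e f x y)"
proof -
  have gen': "inverse y ^ i * inverse x ^ k \<noteq> 1" if "0 < i" for i k
    using gen[OF that, of k] by (simp add: power_inverse inverse_mult_distrib[symmetric] del: inverse_mult_distrib)
  obtain Z N where ZN: "transfer x y (2 * (e * f)) Z = Z" "Z 0 = 1"
    "\<And>i. N i = (\<Sum>b<e. (y ^ (2 * f)) ^ b * transfer x y (2 * (e * f) + b * f) Z i)
      + (y ^ (2 * f)) ^ e * transfer x y (3 * (e * f)) N i"
    using zeta_solution[OF ef gen] by blast
  obtain Z' N' where ZN': "transfer (inverse x) (inverse y) (2 * (e * f)) Z' = Z'" "Z' 0 = 1"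
    "\<And>i. N' i = (\<Sum>b<e. (inverse y ^ (2 * f)) ^ b * transfer (inverse x) (inverse y) (2 * (e * f) + b * f) Z' i)
      + (inverse y ^ (2 * f)) ^ e * transfer (inverse x) (inverse y) (3 * (e * f)) N' i"
    using zeta_solution[OF ef gen'] by blast
  have 1: "zeta_num e f x y / zeta_den e f x y = (1 - y ^ (2 * f)) * (\<Sum>i\<le>3 * n. N i)"
    using zeta_num_eq[OF ZN] zeta_den_nonzero[OF ef gen] n by simp
  have 2: "zeta_num e f (inverse x) (inverse y) / zeta_den e f (inverse x) (inverse y)
      = (1 - inverse (y ^ (2 * f))) * (\<Sum>i\<le>3 * n. N' i)"
    using zeta_num_eq[OF ZN'] zeta_den_nonzero[OF ef gen'] n by (simp add: power_inverse)
  have 3: "N' i = (\<Sum>b<e. inverse (y ^ (2 * f)) ^ b * transfer (inverse x) (inverse y) (2 * (e * f) + b * f) Z' i)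
      + inverse (y ^ (2 * f)) ^ e * transfer (inverse x) (inverse y) (3 * (e * f)) N' i" for i
    using ZN'(3)[of i] by (simp only: power_inverse)
  show ?thesis unfolding 1 2
    by (rule functional_equation[OF n ef x y gen ZN[folded n] ZN'(1,2)[folded n] 3[folded n]])
qed

section \<open>The extension \<open>\<int>[X][[Y]]/(X\<^sup>f - a, Y\<^sup>e - p)\<close>\<close>

text \<open>a is a primitive root modulo p, so its power with exponent (p - 1)/f has order exactly
  f.\<close>

lemma ex_power_residues:
  assumes p: "Factorial_Ring.prime p" and f: "f \<ge> 1" "f dvd p - 1"
  obtains a z :: int where "[z ^ f = 1] (mod int p)" "z = a ^ ((p - 1) div f)"
    "\<And>i. 0 < i \<Longrightarrow> i < f \<Longrightarrow> \<not> [z ^ i = 1] (mod int p)"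
proof -
  have p1: "p > 1" using prime_gt_1_nat[OF p] .
  have "card {x\<in>totatives p. ord p x = p - 1} = totient (p - 1)"
    using prime_card_elements_with_ord_eq_totient[OF p1 p, of "p - 1"] by simp
  also have "\<dots> > 0" using p1 by simp
  finally have "{x\<in>totatives p. ord p x = p - 1} \<noteq> {}" by (metis card.empty less_irrefl)
  then obtain x where x: "ord p x = p - 1" by blast
  define k where "k = (p - 1) div f"
  have kf: "k * f = p - 1" using f by (simp add: k_def)
  have k0: "k > 0" using kf p1 by (cases k) auto
  have conv: "[(int x ^ k) ^ i = 1] (mod int p) \<longleftrightarrow> p - 1 dvd k * i" for i
  proof -
    have "[(int x ^ k) ^ i = 1] (mod int p) \<longleftrightarrow> [x ^ (k * i) = 1] (mod p)"
      using cong_int_iff[of "x ^ (k * i)" 1 p] by (simp add: power_mult)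
    also have "\<dots> \<longleftrightarrow> p - 1 dvd k * i" unfolding ord_divides x ..
    finally show ?thesis .
  qed
  show thesis
  proof (rule that)
    show "[(int x ^ k) ^ f = 1] (mod int p)" unfolding conv kf by simp
    show "int x ^ k = int x ^ ((p - 1) div f)" by (simp add: k_def)
    fix i assume i: "0 < i" "i < f"
    show "\<not> [(int x ^ k) ^ i = 1] (mod int p)"
    proof
      assume "[(int x ^ k) ^ i = 1] (mod int p)"
      then have "k * f dvd k * i" using conv kf by simp
      then have "f dvd i" using k0 by simp
      then show False using i by (simp add: nat_dvd_not_less)
    qed
  qed
qed

lemma pcompose_diff_dvd:
  fixes P u v :: "'a::comm_ring_1 poly"
  shows "u - v dvd pcompose P u - pcompose P v"
proof (induction P)
  case (pCons c P)
  have "pcompose (pCons c P) u - pcompose (pCons c P) v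
      = u * (pcompose P u - pcompose P v) + (u - v) * pcompose P v"
    by (simp add: pcompose_pCons algebra_simps)
  then show ?case using pCons by simp
qed simp

lemma freshman_dvd:
  fixes u v :: "'a::comm_ring_1"
  assumes "Factorial_Ring.prime p"
  shows "of_nat p dvd (u + v) ^ p - u ^ p - v ^ p"
proof -
  have p0: "p > 0" using prime_gt_0_nat[OF assms] .
  let ?t = "\<lambda>k. of_nat (p choose k) * u ^ k * v ^ (p - k)"
  have "{..p} = insert 0 (insert p {0<..<p})" using p0 by auto
  then have "(\<Sum>k\<le>p. ?t k) = ?t 0 + (?t p + (\<Sum>k\<in>{0<..<p}. ?t k))"
    using p0 by (simp only:) (subst sum.insert; simp)+
  then have "(u + v) ^ p = v ^ p + (u ^ p + (\<Sum>k\<in>{0<..<p}. ?t k))"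
    unfolding binomial_ring by simp
  then have "(u + v) ^ p - u ^ p - v ^ p = (\<Sum>k\<in>{0<..<p}. ?t k)"
    by simp
  also have "of_nat p dvd \<dots>"
  proof (rule dvd_sum)
    fix k assume "k \<in> {0<..<p}"
    then have "p dvd p choose k" using dvd_choose_prime[of k p] assms by auto
    then obtain l where "p choose k = p * l" by (rule dvdE)
    then have "of_nat p dvd (of_nat (p choose k) :: 'a)" by simp
    then show "of_nat p dvd of_nat (p choose k) * u ^ k * v ^ (p - k)" by simp
  qed
  finally show ?thesis .
qed

text \<open>Induction on P: the freshman identity separates the constant term from the rest, and
  Fermat handles the constant.\<close>

lemma frobenius_poly:
  fixes P :: "int poly"
  assumes p: "Factorial_Ring.prime p"
  shows "of_nat p dvd P ^ p - pcompose P ([:0, 1:] ^ p)"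
proof (induction P)
  case 0
  then show ?case using prime_gt_0_nat[OF p] by (simp add: power_0_left)
next
  case (pCons c P)
  let ?X = "[:0, 1:] :: int poly"
  have "pCons c P = [:c:] + ?X * P" by simp
  then have "of_nat p dvd (pCons c P) ^ p - [:c:] ^ p - (?X * P) ^ p"
    using freshman_dvd[OF p, of "[:c:]" "?X * P"] by simp
  moreover have "of_nat p dvd [:c:] ^ p - [:c:]"
  proof -
    have "[c ^ p = c] (mod int p)"
    proof (cases "int p dvd c")
      case True
      then have "int p dvd c ^ p" using prime_gt_0_nat[OF p] by (meson dvd_power dvd_trans)
      then show ?thesis using True by (simp add: cong_iff_dvd_diff)
    next
      case False
      define n where "n = nat (c mod int p)"
      have n: "int n = c mod int p" using prime_gt_0_nat[OF p] by (simp add: n_def)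
      then have cn: "[c = int n] (mod int p)" by (simp add: cong_def)
      then have "\<not> int p dvd int n" using False cong_dvd_iff by blast
      then have "\<not> p dvd n" by simp
      then have "[n ^ (p - 1) = 1] (mod p)" using fermat_theorem[OF p] by blast
      then have "[int n ^ (p - 1) = 1] (mod int p)" using cong_int_iff[of "n ^ (p - 1)" 1 p] by simp
      then have "[c ^ (p - 1) = 1] (mod int p)" using cong_pow[OF cn, of "p - 1"] cong_trans by blast
      from cong_mult[OF this cong_refl[of c]] show ?thesis
        by (simp only: power_minus_mult[OF prime_gt_0_nat[OF p]] mult_1_left)
    qed
    then obtain d where "c ^ p - c = int p * d" by (auto simp: cong_iff_dvd_diff)
    then have "[:c:] ^ p - [:c:] = of_nat p * [:d:]"
      by (simp add: poly_const_pow of_nat_poly)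
    then show ?thesis by (metis dvd_triv_left)
  qed
  moreover have "of_nat p dvd ?X ^ p * (P ^ p - pcompose P (?X ^ p))" using pCons by simp
  ultimately have "of_nat p dvd ((pCons c P) ^ p - [:c:] ^ p - (?X * P) ^ p) + ([:c:] ^ p - [:c:])
      + ?X ^ p * (P ^ p - pcompose P (?X ^ p))" by (intro dvd_add)
  also have "\<dots> = (pCons c P) ^ p - pcompose (pCons c P) (?X ^ p)"
    by (simp only: pcompose_pCons power_mult_distrib) (simp add: algebra_simps)
  finally show ?case .
qed

text \<open>For G = g, q = p and w = Y: a multiple of w^(k+1) - q trades q for a power of w, so an
  element of (G, q, w) is a multiple of w modulo the ideal (G, w^(k+1) - q).\<close>

lemma eisenstein_step1:
  fixes x :: "'a::comm_ring_1"
  assumes "x = a * G + b * q + w * s"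
  shows "x - w * (s + b * w ^ k) = a * G + (- b) * (w ^ Suc k - q)"
  unfolding assms by (simp add: algebra_simps)

text \<open>The terms q d G cancel. So a relation whose constant terms come from the trivial syzygy
  of G and q is w times another relation.\<close>

lemma eisenstein_step2:
  fixes A :: "'a::comm_ring_1"
  assumes "A = q * d + w * A'" "B = d * G + w * B'"
  shows "A * G + B * (w ^ Suc k - q) = w * ((A' + d * w ^ k) * G + B' * (w ^ Suc k - q))"
  unfolding assms by (simp add: algebra_simps)

definition resid :: "nat \<Rightarrow> int poly \<Rightarrow> int poly set" where
  "resid p g = {P. \<exists>A B. P = A * g + of_nat p * B}"

text \<open>As f divides p - 1, the field with p elements contains the f-th roots of unity, and its
  extension of degree f is a Kummer extension, generated by an f-th root of a. The exact order of z
  takes the place of irreducibility of X^f - a.\<close>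

locale kummer =
  fixes p f :: nat and a z :: int
  assumes p: "Factorial_Ring.prime p" and f: "f \<ge> 1" "f dvd p - 1"
    and zf: "[z ^ f = 1] (mod int p)" and za: "z = a ^ ((p - 1) div f)"
    and z_order: "\<And>i. 0 < i \<Longrightarrow> i < f \<Longrightarrow> \<not> [z ^ i = 1] (mod int p)"
begin

abbreviation "X \<equiv> [:0, 1:] :: int poly"

definition g :: "int poly" where "g = X ^ f - [:a:]"

abbreviation "R0 \<equiv> resid p g"

lemma R0_I: "P = A * g + of_nat p * B \<Longrightarrow> P \<in> R0"
  by (auto simp: resid_def)

lemma subgrp_R0: "subgrp R0"
  unfolding subgrp_def
proof (intro conjI ballI)
  show "0 \<in> R0" by (rule R0_I[of _ 0 0]) simp
  fix P Q assume "P \<in> R0" "Q \<in> R0"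
  then obtain A B A' B' where "P = A * g + of_nat p * B" "Q = A' * g + of_nat p * B'" by (auto simp: resid_def)
  then show "P - Q \<in> R0" by (intro R0_I[of _ "A - A'" "B - B'"]) (simp add: algebra_simps)
qed

lemma R0_mult: "P \<in> R0 \<Longrightarrow> Q * P \<in> R0"
proof -
  assume "P \<in> R0"
  then obtain A B where "P = A * g + of_nat p * B" by (auto simp: resid_def)
  then show "Q * P \<in> R0" by (intro R0_I[of _ "Q * A" "Q * B"]) (simp add: algebra_simps)
qed

lemma g_dvd_R0: "g dvd P \<Longrightarrow> P \<in> R0"
  by (elim dvdE) (auto intro!: R0_I[of _ _ 0] simp: mult.commute)

lemma p_dvd_R0: "of_nat p dvd P \<Longrightarrow> P \<in> R0"
  by (elim dvdE) (auto intro!: R0_I[of _ 0])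

lemma R0_power_diff: "P - Q \<in> R0 \<Longrightarrow> P ^ k - Q ^ k \<in> R0"
proof (induction k)
  case (Suc k)
  have "P ^ Suc k - Q ^ Suc k = P * (P ^ k - Q ^ k) + Q ^ k * (P - Q)" by (simp add: algebra_simps)
  also have "\<dots> \<in> R0" using Suc by (intro subgrp_add[OF subgrp_R0] R0_mult) auto
  finally show ?case .
qed (simp add: subgrp_0[OF subgrp_R0])

lemma R0_trans: "P - Q \<in> R0 \<Longrightarrow> Q - S \<in> R0 \<Longrightarrow> P - S \<in> R0"
  using subgrp_add[OF subgrp_R0, of "P - Q" "Q - S"] by simp

lemma coeff_g: "Polynomial.coeff g i = (if i = f then 1 else if i = 0 then - a else 0)"
proof -
  have "X ^ f = Polynomial.monom 1 f" by (simp add: monom_altdef)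
  then show ?thesis using f(1) by (auto simp: g_def coeff_pCons split: nat.split)
qed

text \<open>g is monic, so division works over the integers: X times a remainder is corrected by its
  coefficient at X^f.\<close>

lemma division: "\<exists>A r. P = A * g + r \<and> (\<forall>i\<ge>f. Polynomial.coeff r i = 0)"
proof (induction P)
  case 0
  show ?case by (intro exI[of _ 0]) simp
next
  case (pCons c P)
  then obtain A r where A: "P = A * g + r" "\<forall>i\<ge>f. Polynomial.coeff r i = 0" by blast
  define l where "l = Polynomial.coeff r (f - 1)"
  define r' where "r' = pCons c r - [:l:] * g"
  have "pCons c P = (X * A + [:l:]) * g + r'"
    by (simp add: A(1) r'_def algebra_simps)
  moreover have "Polynomial.coeff r' i = 0" if "i \<ge> f" for i
    using that f(1) A(2) by (cases i) (auto simp: r'_def coeff_g l_def)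
  ultimately show ?case by blast
qed

lemma mult_g_eq_0:
  assumes "\<forall>i\<ge>f. Polynomial.coeff (Q * g) i = 0"
  shows "Q = 0"
proof (rule ccontr)
  assume Q: "Q \<noteq> 0"
  have dg: "degree g = f"
    by (rule antisym) (auto intro!: degree_le le_degree simp: coeff_g)
  have g0: "g \<noteq> 0" using coeff_g[of f] by auto
  have "Polynomial.coeff (Q * g) (degree Q + f) = lead_coeff Q * lead_coeff g"
    using coeff_mult_degree_sum[of Q g] dg by simp
  also have "\<dots> \<noteq> 0" using Q g0 by simp
  finally show False using assms by simp
qed

text \<open>Remainders of degree below f are unique because g is monic, so membership is tested on
  coefficients modulo p.\<close>

lemma R0_reduced_iff:
  assumes "\<forall>i\<ge>f. Polynomial.coeff r i = 0"
  shows "r \<in> R0 \<longleftrightarrow> (\<forall>i. int p dvd Polynomial.coeff r i)"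
proof
  assume "r \<in> R0"
  then obtain A B where AB: "r = A * g + of_nat p * B" by (auto simp: resid_def)
  obtain B' b where B: "B = B' * g + b" "\<forall>i\<ge>f. Polynomial.coeff b i = 0" using division by blast
  have "(A + of_nat p * B') * g = r - of_nat p * b" unfolding AB B(1) by (simp add: algebra_simps)
  moreover have "Polynomial.coeff (r - of_nat p * b) i = 0" if "i \<ge> f" for i
    using assms B(2) that by (simp add: of_nat_poly)
  ultimately have "A + of_nat p * B' = 0" using mult_g_eq_0 by metis
  then have "r = of_nat p * b" using \<open>(A + of_nat p * B') * g = _\<close> by simp
  then show "\<forall>i. int p dvd Polynomial.coeff r i" by (simp add: of_nat_poly)
next
  assume *: "\<forall>i. int p dvd Polynomial.coeff r i"
  have "r = of_nat p * map_poly (\<lambda>c. c div int p) r"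
    by (rule poly_eqI) (use * in \<open>simp add: of_nat_poly coeff_map_poly\<close>)
  then show "r \<in> R0" by (intro p_dvd_R0) (metis dvd_triv_left)
qed

definition rem :: "int poly \<Rightarrow> int poly" where
  "rem P = (SOME r. \<exists>A. P = A * g + r \<and> (\<forall>i\<ge>f. Polynomial.coeff r i = 0))"

lemma rem: "P - rem P \<in> R0" "\<forall>i\<ge>f. Polynomial.coeff (rem P) i = 0"
proof -
  have "\<exists>A. P = A * g + rem P \<and> (\<forall>i\<ge>f. Polynomial.coeff (rem P) i = 0)"
    unfolding rem_def by (rule someI_ex) (use division[of P] in blast)
  then obtain A where "P = A * g + rem P" "\<forall>i\<ge>f. Polynomial.coeff (rem P) i = 0" by blast
  then show "\<forall>i\<ge>f. Polynomial.coeff (rem P) i = 0" "P - rem P \<in> R0"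
    by (auto intro!: g_dvd_R0) (metis add_diff_cancel_right' dvd_triv_right)
qed

lemma card_R0: "idx UNIV R0 = p ^ f"
proof -
  have p0: "p > 0" using prime_gt_0_nat[OF p] .
  define \<phi> where "\<phi> P = (\<lambda>i\<in>{..<f}. Polynomial.coeff (rem P) i mod int p)" for P
  have "idx UNIV R0 = card (\<phi> ` UNIV)"
    unfolding idx_def
  proof (rule card_image_eq)
    fix P Q :: "int poly"
    have "(+) P ` R0 = (+) Q ` R0 \<longleftrightarrow> P - Q \<in> R0" by (rule coset_eq_iff[OF subgrp_R0])
    also have "\<dots> \<longleftrightarrow> rem P - rem Q \<in> R0"
    proof -
      have *: "(P - rem P) - (Q - rem Q) \<in> R0" by (intro subgrp_diff[OF subgrp_R0] rem)
      have "P - Q = ((P - rem P) - (Q - rem Q)) + (rem P - rem Q)"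
        "rem P - rem Q = (P - Q) - ((P - rem P) - (Q - rem Q))" by simp_all
      then show ?thesis using * subgrp_add[OF subgrp_R0] subgrp_diff[OF subgrp_R0] by metis
    qed
    also have "\<dots> \<longleftrightarrow> (\<forall>i. int p dvd Polynomial.coeff (rem P - rem Q) i)"
      by (rule R0_reduced_iff) (use rem(2) in simp)
    also have "\<dots> \<longleftrightarrow> (\<forall>i<f. Polynomial.coeff (rem P) i mod int p = Polynomial.coeff (rem Q) i mod int p)"
      using rem(2)[of P] rem(2)[of Q] by (simp add: mod_eq_dvd_iff) (metis diff_self dvd_0_right not_le)
    also have "\<dots> \<longleftrightarrow> \<phi> P = \<phi> Q" by (auto simp: \<phi>_def fun_eq_iff restrict_def)
    finally show "(+) P ` R0 = (+) Q ` R0 \<longleftrightarrow> \<phi> P = \<phi> Q" .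
  qed
  also have "\<phi> ` UNIV = {..<f} \<rightarrow>\<^sub>E {0..<int p}"
  proof (intro equalityI subsetI)
    fix h assume "h \<in> \<phi> ` UNIV"
    then obtain P where P: "h = \<phi> P" by blast
    show "h \<in> {..<f} \<rightarrow>\<^sub>E {0..<int p}" unfolding P \<phi>_def using p0 by (simp add: restrict_PiE_iff)
  next
    fix h assume h: "h \<in> {..<f} \<rightarrow>\<^sub>E {0..<int p}"
    define P where "P = (\<Sum>i<f. Polynomial.monom (h i) i)"
    have cP: "Polynomial.coeff P i = (if i < f then h i else 0)" for i
      by (simp add: P_def coeff_sum if_distrib sum.delta cong: if_cong)
    have "P - rem P \<in> R0" by (rule rem)
    moreover have "\<forall>i\<ge>f. Polynomial.coeff (P - rem P) i = 0" using rem(2)[of P] by (simp add: cP)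
    ultimately have "\<forall>i. int p dvd Polynomial.coeff (P - rem P) i" using R0_reduced_iff by blast
    then have dv: "int p dvd Polynomial.coeff (P - rem P) i" for i by blast
    have *: "Polynomial.coeff (rem P) i mod int p = h i mod int p" if "i < f" for i
    proof -
      have "int p dvd h i - Polynomial.coeff (rem P) i" using dv[of i] that by (simp add: cP)
      then have "h i mod int p = Polynomial.coeff (rem P) i mod int p" by (simp only: mod_eq_dvd_iff)
      then show ?thesis by (rule sym)
    qed
    have "\<phi> P = h"
    proof
      fix i
      show "\<phi> P i = h i"
      proof (cases "i < f")
        case True
        then have "h i \<in> {0..<int p}" using PiE_mem[OF h, of i] by simp
        then have "h i mod int p = h i" by simp
        then show ?thesis using True *[OF True] by (simp only: \<phi>_def restrict_apply lessThan_iff if_True)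
      next
        case False
        then have "h i = undefined" using PiE_arb[OF h, of i] by simp
        then show ?thesis using False by (simp only: \<phi>_def restrict_apply lessThan_iff if_False)
      qed
    qed
    then show "h \<in> \<phi> ` UNIV" by blast
  qed
  also have "card ({..<f} \<rightarrow>\<^sub>E {0..<int p}) = p ^ f" by (simp add: card_PiE)
  finally show ?thesis .
qed

text \<open>Modulo \<open>(p, g)\<close> one has \<open>X\<^sup>p = z X\<close>, so \<open>\<sigma> i\<close> is the \<open>i\<close>-th power of the Frobenius map.\<close>

abbreviation "\<sigma> i P \<equiv> pcompose P [:0, z ^ i:]"

lemma X_p: "X ^ p - [:0, z:] \<in> R0"
proof -
  define k where "k = (p - 1) div f"
  have "p = Suc (f * k)" using f prime_gt_0_nat[OF p] by (simp add: k_def)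
  moreover have "[:0, z:] = X * [:a:] ^ k" unfolding za k_def[symmetric] by (simp add: poly_const_pow)
  ultimately have "X ^ p - [:0, z:] = X * ((X ^ f) ^ k - [:a:] ^ k)"
    by (simp only: power_Suc power_mult right_diff_distrib)
  also have "\<dots> \<in> R0"
  proof (rule R0_mult, rule R0_power_diff)
    show "X ^ f - [:a:] \<in> R0" by (rule g_dvd_R0) (simp add: g_def)
  qed
  finally show ?thesis .
qed

lemma frob1: "P ^ p - pcompose P [:0, z:] \<in> R0"
proof (rule R0_trans)
  show "P ^ p - pcompose P (X ^ p) \<in> R0" by (rule p_dvd_R0[OF frobenius_poly[OF p]])
  obtain Q where "pcompose P (X ^ p) - pcompose P [:0, z:] = (X ^ p - [:0, z:]) * Q"
    using pcompose_diff_dvd by (rule dvdE)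
  then show "pcompose P (X ^ p) - pcompose P [:0, z:] \<in> R0"
    using R0_mult[OF X_p, of Q] by (simp add: mult.commute)
qed

lemma frob: "P ^ (p ^ i) - \<sigma> i P \<in> R0"
proof (induction i)
  case 0
  have "[:0, 1:] = X" by simp
  then show ?case using subgrp_0[OF subgrp_R0] by (simp add: pcompose_idR)
next
  case (Suc i)
  have "(P ^ (p ^ i)) ^ p - (\<sigma> i P) ^ p \<in> R0" by (rule R0_power_diff[OF Suc])
  moreover have "(\<sigma> i P) ^ p - pcompose (\<sigma> i P) [:0, z:] \<in> R0" by (rule frob1)
  moreover have "pcompose (\<sigma> i P) [:0, z:] = \<sigma> (Suc i) P"
    by (subst pcompose_assoc[symmetric]) (simp add: pcompose_pCons mult.commute)
  moreover have "P ^ p ^ Suc i = (P ^ (p ^ i)) ^ p" by (simp add: mult.commute flip: power_mult)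
  ultimately show ?case using R0_trans by metis
qed

text \<open>z^f = 1 modulo p, so the f-th power of Frobenius is the identity.\<close>

lemma frob_f: "P ^ (p ^ f) - P \<in> R0"
proof (rule R0_trans[OF frob])
  obtain Q where Q: "\<sigma> f P - pcompose P X = ([:0, z ^ f:] - X) * Q"
    using pcompose_diff_dvd by (rule dvdE)
  obtain d where "z ^ f - 1 = int p * d" using zf by (auto simp: cong_iff_dvd_diff)
  then have "[:0, z ^ f:] - X = of_nat p * [:0, d:]" by (simp add: of_nat_poly)
  then have "\<sigma> f P - P = of_nat p * ([:0, d:] * Q)" using Q by (simp add: pcompose_idR mult.assoc)
  then show "\<sigma> f P - P \<in> R0" by (intro p_dvd_R0 dvdI)
qed

lemma coeff_sigma: "Polynomial.coeff (pcompose P [:0, z:]) i = z ^ i * Polynomial.coeff P i"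
proof (induction P arbitrary: i)
  case (pCons c P)
  then show ?case by (cases i) (simp_all add: pcompose_pCons mult_ac)
qed simp

text \<open>The norm y = P^(1 + p + ... + p^(f-1)) is fixed by Frobenius, hence constant modulo (p,
  g). It is a nonzero constant, so it is invertible modulo p, and the remaining power of P completes
  the inverse.\<close>

lemma inverse_mod:
  assumes P: "P \<notin> R0"
  shows "\<exists>Q. P * Q - 1 \<in> R0"
proof -
  have p1: "p > 1" using prime_gt_1_nat[OF p] .
  define M where "M = (\<Sum>i<f. p ^ i)"
  have pM: "p * M = M + (p ^ f - 1)"
  proof -
    have "int (p * M) - int M = int (p ^ f) - 1"
      using power_diff_1_eq[of "int p" f] p1 by (simp add: M_def algebra_simps)
    moreover have "p ^ f \<ge> 1" using p1 by simp
    ultimately show ?thesis by linarith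
  qed
  have M1: "M \<ge> 1"
    using member_le_sum[of 0 "{..<f}" "\<lambda>i. p ^ i"] f(1) by (simp add: M_def)
  have Mq: "M \<le> p ^ f"
  proof -
    have "2 * M \<le> p * M" using prime_ge_2_nat[OF p] by (rule mult_le_mono1)
    then show ?thesis using pM by linarith
  qed
  define y where "y = P ^ M"
  have yp: "y ^ p - y \<in> R0"
  proof -
    have "p ^ f \<ge> 1" using p1 by simp
    then have "M * p = (M - 1) + p ^ f" using pM M1 by (simp add: mult.commute)
    then have "y ^ p = P ^ (M - 1) * P ^ (p ^ f)"
      by (simp only: y_def power_mult[symmetric] power_add)
    moreover have "y = P ^ (M - 1) * P"
      unfolding y_def by (rule power_minus_mult[symmetric]) (use M1 in simp)
    ultimately have "y ^ p - y = P ^ (M - 1) * (P ^ (p ^ f) - P)" by (simp add: algebra_simps)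
    then show ?thesis using R0_mult[OF frob_f] by simp
  qed
  define r where "r = rem y"
  have yr: "y - r \<in> R0" unfolding r_def by (rule rem)
  have "pcompose r [:0, z:] - r \<in> R0"
  proof -
    have "pcompose r [:0, z:] - r ^ p \<in> R0" using frob1[of r] subgrp_diff_commute[OF subgrp_R0] by blast
    moreover have "r ^ p - y ^ p \<in> R0"
      using R0_power_diff[OF yr, of p] subgrp_diff_commute[OF subgrp_R0] by blast
    ultimately show ?thesis using yp yr R0_trans by meson
  qed
  moreover have "\<forall>i\<ge>f. Polynomial.coeff (pcompose r [:0, z:] - r) i = 0" using rem(2)[of y] by (simp add: coeff_sigma r_def)
  ultimately have dv: "int p dvd z ^ i * Polynomial.coeff r i - Polynomial.coeff r i" for i
    using R0_reduced_iff[of "pcompose r [:0, z:] - r"] by (simp add: coeff_sigma)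
  \<comment> \<open>Frobenius multiplies the coefficient of X^i by z^i, and z^i - 1 is prime to p
    for 0 < i < f; so a fixed element is constant.\<close>
  have ri: "int p dvd Polynomial.coeff r i" if "i > 0" for i
  proof (cases "i < f")
    case True
    have "int p dvd (z ^ i - 1) * Polynomial.coeff r i" using dv[of i] by (simp add: algebra_simps)
    moreover have "\<not> int p dvd z ^ i - 1" using z_order[OF that True] by (simp add: cong_iff_dvd_diff)
    ultimately show ?thesis using p by (simp add: prime_dvd_mult_iff)
  next
    case False
    then show ?thesis using rem(2)[of y] by (simp add: r_def)
  qed
  define c where "c = Polynomial.coeff r 0"
  have yc: "y - [:c:] \<in> R0"
  proof (rule R0_trans[OF yr])
    have "int p dvd Polynomial.coeff (r - [:c:]) i" for i using ri[of i] by (cases i) (simp_all add: c_def)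
    moreover have "\<forall>i\<ge>f. Polynomial.coeff (r - [:c:]) i = 0" using rem(2)[of y] f(1) by (auto simp: r_def coeff_pCons split: nat.split)
    ultimately show "r - [:c:] \<in> R0" using R0_reduced_iff by blast
  qed
  \<comment> \<open>Otherwise a power of P, and then P = P^(p^f) itself, would be 0 modulo (p,
    g).\<close>
  have "\<not> int p dvd c"
  proof
    assume "int p dvd c"
    then obtain d where "c = int p * d" by auto
    then have "[:c:] = of_nat p * [:d:]" by (simp add: of_nat_poly)
    then have "[:c:] \<in> R0" by (intro p_dvd_R0 dvdI)
    from subgrp_add[OF subgrp_R0 yc this] have "y \<in> R0" by simp
    then have "P ^ (p ^ f - M) * y \<in> R0" by (rule R0_mult)
    then have "P ^ (p ^ f) \<in> R0" using Mq by (simp add: y_def flip: power_add)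
    from subgrp_diff[OF subgrp_R0 this frob_f[of P]] P show False by simp
  qed
  then have "coprime (int p) c" using p by (simp add: prime_imp_coprime)
  then obtain c' d where "c' * c + d * int p = 1"
    using bezout_int[of c "int p"] by (auto simp: coprime_iff_gcd_eq_1 gcd.commute)
  then have cc: "[:c':] * [:c:] - 1 = of_nat p * [:- d:]" by (simp add: of_nat_poly one_pCons algebra_simps)
  have "P * (P ^ (M - 1) * [:c':]) - 1 = [:c':] * (y - [:c:]) + ([:c':] * [:c:] - 1)"
    using M1 by (simp add: y_def algebra_simps power_eq_if)
  also have "\<dots> \<in> R0" unfolding cc by (intro subgrp_add[OF subgrp_R0] R0_mult yc p_dvd_R0 dvd_triv_left)
  finally show ?thesis by blast
qed

section \<open>The ramified extension by an e-th root of p\<close>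

definition JJ :: "nat \<Rightarrow> int poly fps set" where
  "JJ e = {x. \<exists>A B. x = A * fps_const g + B * (fps_X ^ e - of_nat p)}"

lemma JJ_I: "x = A * fps_const g + B * (fps_X ^ e - of_nat p) \<Longrightarrow> x \<in> JJ e"
  unfolding JJ_def by blast

lemma JJ_E: "x \<in> JJ e \<Longrightarrow> \<exists>A B. x = A * fps_const g + B * (fps_X ^ e - of_nat p)"
  unfolding JJ_def by blast

lemma fps_decomp: "(x :: 'a::comm_ring_1 fps) = fps_const (fps_nth x 0) + fps_X * fps_shift 1 x"
  by (rule fps_ext) (auto simp: fps_X_mult_nth)

text \<open>Modulo Y the relation Y^e = p kills p, so the residue ring is the one of the unramified
  part.\<close>

lemma JJ_0_mem:
  assumes e: "e \<ge> 1"
  shows "(\<exists>y. x - fps_X * y \<in> JJ e) \<longleftrightarrow> fps_nth x 0 \<in> R0"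
proof
  assume "\<exists>y. x - fps_X * y \<in> JJ e"
  then obtain y A B where "x - fps_X * y = A * fps_const g + B * (fps_X ^ e - of_nat p)" using JJ_E by blast
  then have "fps_nth (x - fps_X * y) 0 = fps_nth (A * fps_const g + B * (fps_X ^ e - of_nat p)) 0" by simp
  then have "fps_nth x 0 = fps_nth A 0 * g - of_nat p * fps_nth B 0"
    using e by (simp add: fps_X_power_nth fps_of_nat[symmetric] mult.commute)
  then show "fps_nth x 0 \<in> R0" by (intro R0_I[of _ "fps_nth A 0" "- fps_nth B 0"]) simp
next
  assume "fps_nth x 0 \<in> R0"
  then obtain A B where AB: "fps_nth x 0 = A * g + of_nat p * B" by (auto simp: resid_def)
  obtain e' where e': "e = Suc e'" using e by (cases e) auto
  have "x = fps_const A * fps_const g + fps_const B * of_nat p + fps_X * fps_shift 1 x"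
    by (subst fps_decomp) (simp add: AB fps_of_nat[symmetric] mult.commute)
  from eisenstein_step1[OF this]
  have "x - fps_X * (fps_shift 1 x + fps_const B * fps_X ^ e') = fps_const A * fps_const g + (- fps_const B) * (fps_X ^ e - of_nat p)"
    unfolding e' .
  then show "\<exists>y. x - fps_X * y \<in> JJ e" using JJ_I by blast
qed

text \<open>Taking power series in Y makes limits and inverses available at once; the work lies in
  showing that the ideal does not spoil cancellation of Y and separatedness.\<close>

lemma ring_model:
  assumes e: "e \<ge> 1"
  shows "ring_model p e f (JJ e) fps_X"
proof
  have sgJ: "subgrp (JJ e)"
    unfolding subgrp_def
  proof (intro conjI ballI)
    show "0 \<in> JJ e" by (rule JJ_I[of _ 0 0]) simp
    fix x y assume "x \<in> JJ e" "y \<in> JJ e"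
    then obtain A B A' B' where x: "x = A * fps_const g + B * (fps_X ^ e - of_nat p)"
      and y: "y = A' * fps_const g + B' * (fps_X ^ e - of_nat p)" using JJ_E by metis
    show "x - y \<in> JJ e" unfolding x y by (rule JJ_I[of _ "A - A'" "B - B'"]) (simp only: algebra_simps)
  qed
  have multJ: "r * x \<in> JJ e" if xJ: "x \<in> JJ e" for r x
  proof -
    obtain A B where x: "x = A * fps_const g + B * (fps_X ^ e - of_nat p)" using JJ_E[OF xJ] by blast
    show "r * x \<in> JJ e" unfolding x by (rule JJ_I[of _ "r * A" "r * B"]) (simp only: algebra_simps)
  qed
  \<comment> \<open>The constant terms satisfy A_0 g = p B_0; as p and the monic g form a regular
    sequence, B_0 = D g and A_0 = p D, and a factor Y can be cancelled from the relation.\<close>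
  have cancel: "x \<in> JJ e" if x: "fps_X * x \<in> JJ e" for x
  proof -
    obtain A B where AB: "fps_X * x = A * fps_const g + B * (fps_X ^ e - of_nat p)" using JJ_E[OF x] by blast
    have "fps_nth (fps_X * x) 0 = fps_nth (A * fps_const g + B * (fps_X ^ e - of_nat p)) 0" using AB by simp
    then have 0: "fps_nth A 0 * g = of_nat p * fps_nth B 0"
      using e by (simp add: fps_X_power_nth fps_of_nat[symmetric] mult.commute)
    obtain D b where D: "fps_nth B 0 = D * g + b" "\<forall>i\<ge>f. Polynomial.coeff b i = 0" using division by blast
    have "(fps_nth A 0 - of_nat p * D) * g = of_nat p * b" using 0 D(1) by (simp add: algebra_simps)
    moreover have "\<forall>i\<ge>f. Polynomial.coeff (of_nat p * b) i = 0" using D(2) by (simp add: of_nat_poly)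
    ultimately have z: "fps_nth A 0 - of_nat p * D = 0" using mult_g_eq_0 by metis
    then have "of_nat p * b = 0" using \<open>(fps_nth A 0 - of_nat p * D) * g = of_nat p * b\<close> by simp
    then have "b = 0" using prime_gt_0_nat[OF p] by simp
    then have B0: "fps_nth B 0 = D * g" and A0: "fps_nth A 0 = of_nat p * D" using D(1) z by simp_all
    obtain e' where e': "e = Suc e'" using e by (cases e) auto
    have A: "A = of_nat p * fps_const D + fps_X * fps_shift 1 A"
      by (subst fps_decomp) (simp add: A0 fps_of_nat[symmetric])
    have B: "B = fps_const D * fps_const g + fps_X * fps_shift 1 B"
      by (subst fps_decomp) (simp add: B0)
    have "fps_X * x = fps_X * ((fps_shift 1 A + fps_const D * fps_X ^ e') * fps_const g + fps_shift 1 B * (fps_X ^ e - of_nat p))"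
      unfolding AB e' by (rule eisenstein_step2[OF A B])
    then have "x = (fps_shift 1 A + fps_const D * fps_X ^ e') * fps_const g + fps_shift 1 B * (fps_X ^ e - of_nat p)"
      by simp
    then show ?thesis by (rule JJ_I)
  qed
  show "Factorial_Ring.prime p" "e \<ge> 1" "f \<ge> 1" by (fact p e f)+
  show "subgrp (JJ e)" by (rule sgJ)
  show "\<And>x r. x \<in> JJ e \<Longrightarrow> r * x \<in> JJ e" by (rule multJ)
  show "\<And>x. fps_X * x \<in> JJ e \<Longrightarrow> x \<in> JJ e" by (rule cancel)
  show "of_nat p - fps_X ^ e \<in> JJ e" by (rule JJ_I[of _ 0 "-1"]) simp
  show "idx UNIV {x. \<exists>y. x - fps_X * y \<in> JJ e} = p ^ f"
  proof -
    have eq: "{x. \<exists>y. x - fps_X * y \<in> JJ e} = {x. fps_nth x 0 \<in> R0}" using JJ_0_mem[OF e] by blast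
    have "idx UNIV {x. fps_nth x 0 \<in> R0} = idx UNIV R0"
    proof (rule idx_transfer[where h = "\<lambda>x. fps_nth x 0"])
      show "subgrp {x. fps_nth x 0 \<in> R0}" using subgrp_R0 by (simp add: subgrp_def)
      fix q :: "int poly"
      show "\<exists>x\<in>UNIV. fps_nth x 0 - q \<in> R0" using subgrp_0[OF subgrp_R0] by (intro bexI[of _ "fps_const q"]) simp_all
    qed (simp_all add: subgrp_R0)
    then show ?thesis unfolding eq card_R0 .
  qed
  show "\<exists>y. x * y - 1 \<in> JJ e" if "\<nexists>y. x - fps_X * y \<in> JJ e" for x
  proof -
    have "fps_nth x 0 \<notin> R0" using that JJ_0_mem[OF e] by blast
    then obtain q where "fps_nth x 0 * q - 1 \<in> R0" using inverse_mod by blast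
    then have "fps_nth (x * fps_const q - 1) 0 \<in> R0" by simp
    then obtain y where y: "x * fps_const q - 1 - fps_X * y \<in> JJ e" using JJ_0_mem[OF e] by blast
    \<comment> \<open>An inverse modulo Y becomes an inverse after multiplication by the power
      series inverse of 1 + Y y.\<close>
    define v where "v = fps_left_inverse (1 + fps_X * y) 1"
    have v: "v * (1 + fps_X * y) = 1" unfolding v_def by (rule fps_left_inverse) simp
    have "x * (fps_const q * v) - 1 = v * (x * fps_const q - 1 - fps_X * y) + (v * (1 + fps_X * y) - 1)"
      by (simp add: algebra_simps)
    also have "\<dots> \<in> JJ e" using multJ[OF y, of v] v by simp
    finally show ?thesis by blast
  qed
  show "x \<in> JJ e" if sep: "\<And>k. \<exists>y. x - fps_X ^ k * y \<in> JJ e" for x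
  proof -
    \<comment> \<open>Dividing by Y again and again yields coefficients A and B which, summed with
      growing powers of Y, converge to a relation for x: the ideal is closed.\<close>
    define S where "S = {x. \<forall>k. \<exists>y. x - fps_X ^ k * y \<in> JJ e}"
    have step: "\<exists>A B x'. x = A * fps_const g + B * (fps_X ^ e - of_nat p) + fps_X * x' \<and> x' \<in> S" if "x \<in> S" for x
    proof -
      have xS: "\<exists>y. x - fps_X ^ k * y \<in> JJ e" for k using that by (simp add: S_def)
      obtain x' where x': "x - fps_X ^ 1 * x' \<in> JJ e" using xS by blast
      then obtain A B where "x - fps_X ^ 1 * x' = A * fps_const g + B * (fps_X ^ e - of_nat p)" using JJ_E by blast
      then have "x = A * fps_const g + B * (fps_X ^ e - of_nat p) + fps_X * x'" by (simp add: algebra_simps)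
      moreover have "\<exists>y. x' - fps_X ^ k * y \<in> JJ e" for k
      proof -
        obtain y where y: "x - fps_X ^ Suc k * y \<in> JJ e" using xS by blast
        have "fps_X * (x' - fps_X ^ k * y) = (x - fps_X ^ Suc k * y) - (x - fps_X ^ 1 * x')"
          by (simp add: algebra_simps)
        also have "\<dots> \<in> JJ e" by (rule subgrp_diff[OF sgJ y x'])
        finally show ?thesis using cancel by blast
      qed
      then have "x' \<in> S" by (simp add: S_def)
      ultimately show ?thesis by blast
    qed
    then obtain A B N where ABN: "\<And>x. x \<in> S \<Longrightarrow> x = A x * fps_const g + B x * (fps_X ^ e - of_nat p) + fps_X * N x"
      "\<And>x. x \<in> S \<Longrightarrow> N x \<in> S" by metis
    define xs where "xs i = (N ^^ i) x" for i
    have xsS: "xs i \<in> S" for i by (induction i) (use sep ABN(2) in \<open>auto simp: xs_def S_def\<close>)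
    define SA where "SA = shift_sum 1 (\<lambda>i. A (xs i))"
    define SB where "SB = shift_sum 1 (\<lambda>i. B (xs i))"
    define D where "D i = xs i - (SA i * fps_const g + SB i * (fps_X ^ e - of_nat p))" for i
    have "D i = fps_X ^ 1 * D (Suc i)" for i
    proof -
      have "SA i = A (xs i) + fps_X ^ 1 * SA (Suc i)" "SB i = B (xs i) + fps_X ^ 1 * SB (Suc i)"
        unfolding SA_def SB_def by (rule shift_sum_rec, simp)+
      moreover have "xs i = A (xs i) * fps_const g + B (xs i) * (fps_X ^ e - of_nat p) + fps_X * xs (Suc i)"
        using ABN(1)[OF xsS[of i]] by (simp add: xs_def)
      ultimately show ?thesis unfolding D_def by (simp only: power_one_right) (simp add: algebra_simps)
    qed
    then have "D 0 = 0" by (rule fps_shift_unique) simp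
    then have "x = SA 0 * fps_const g + SB 0 * (fps_X ^ e - of_nat p)" by (simp add: D_def xs_def)
    then show ?thesis by (rule JJ_I)
  qed
  show "\<exists>x. \<forall>k. \<exists>y. x - (\<Sum>i<k. fps_X ^ i * c i) - fps_X ^ k * y \<in> JJ e" for c :: "nat \<Rightarrow> int poly fps"
  proof -
    define s where "s = shift_sum 1 c"
    have rec: "s i = c i + fps_X * s (Suc i)" for i
      unfolding s_def using shift_sum_rec[of 1 c i] by simp
    have "s 0 = (\<Sum>i<k. fps_X ^ i * c i) + fps_X ^ k * s k" for k
    proof (induction k)
      case (Suc k)
      note Suc.IH
      also have "s k = c k + fps_X * s (Suc k)" by (rule rec)
      finally show ?case by (simp add: distrib_left mult_ac)
    qed simp
    then have "s 0 - (\<Sum>i<k. fps_X ^ i * c i) - fps_X ^ k * s k = 0" for k by (simp add: algebra_simps)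
    then have "s 0 - (\<Sum>i<k. fps_X ^ i * c i) - fps_X ^ k * s k \<in> JJ e" for k using subgrp_0[OF sgJ] by simp
    then show ?thesis by blast
  qed
qed

end

section \<open>The ring as a finite extension of the \<open>p\<close>-adic integers\<close>

text \<open>c encodes each coset of J by a single value of type 'r, so that the quotient becomes a
  ring on a prescribed type.\<close>

locale coded_ring = ring_model p e f J w for p e f :: nat and J :: "'b::comm_ring_1 set" and w +
  fixes c :: "'b \<Rightarrow> 'r"
  assumes c_eq_iff: "c x = c y \<longleftrightarrow> x - y \<in> J"
begin

definition dec :: "'r \<Rightarrow> 'b" where
  "dec u = (SOME x. c x = u)"

definition R :: "'r ring" where
  "R = \<lparr> carrier = range c, mult = \<lambda>u v. c (dec u * dec v), one = c 1,
         zero = c 0, add = \<lambda>u v. c (dec u + dec v) \<rparr>"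

lemma dec_c: "dec (c x) - x \<in> J"
proof -
  have "c (dec (c x)) = c x" unfolding dec_def by (rule someI) (rule refl)
  then show ?thesis by (simp add: c_eq_iff)
qed

lemma carrier_R: "carrier R = range c" and one_R: "\<one>\<^bsub>R\<^esub> = c 1" and zero_R: "\<zero>\<^bsub>R\<^esub> = c 0"
  by (simp_all add: R_def)

lemma c_carrier [simp]: "c x \<in> carrier R"
  by (simp add: carrier_R)

lemma c_mult: "c x \<otimes>\<^bsub>R\<^esub> c y = c (x * y)"
proof -
  have "dec (c x) * dec (c y) - x * y = dec (c x) * (dec (c y) - y) + y * (dec (c x) - x)"
    by (simp add: algebra_simps)
  also have "\<dots> \<in> J" by (intro J_add J_mult dec_c)
  finally show ?thesis by (simp add: R_def c_eq_iff)
qed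

lemma c_add: "c x \<oplus>\<^bsub>R\<^esub> c y = c (x + y)"
proof -
  have "dec (c x) + dec (c y) - (x + y) = (dec (c x) - x) + (dec (c y) - y)"
    by simp
  also have "\<dots> \<in> J" by (intro J_add dec_c)
  finally show ?thesis by (simp add: R_def c_eq_iff)
qed

lemma cring_R: "cring R"
proof (rule cringI)
  show "abelian_group R"
  proof (rule abelian_groupI)
    fix x assume "x \<in> carrier R"
    then obtain a where "x = c a" by (auto simp: carrier_R)
    then have "c (- a) \<oplus>\<^bsub>R\<^esub> x = \<zero>\<^bsub>R\<^esub>" by (simp add: c_add zero_R)
    then show "\<exists>y\<in>carrier R. y \<oplus>\<^bsub>R\<^esub> x = \<zero>\<^bsub>R\<^esub>" by (rule bexI) simp
  qed (auto simp: carrier_R c_add zero_R add_ac)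
  show "comm_monoid R"
    by (rule comm_monoidI) (auto simp: carrier_R c_mult one_R mult_ac)
qed (auto simp: carrier_R c_add c_mult algebra_simps)

sublocale CR: cring R
  by (rule cring_R)

lemma c_nat: "[k] \<cdot>\<^bsub>R\<^esub> \<one>\<^bsub>R\<^esub> = c (of_nat k)"
  by (induction k) (simp_all add: one_R zero_R c_add add.commute)

lemma c_mem_I: "c x \<in> c ` I k \<longleftrightarrow> x \<in> I k"
proof
  assume "c x \<in> c ` I k"
  then obtain y where "y \<in> I k" "x - y \<in> J" by (auto simp: c_eq_iff)
  then show "x \<in> I k" using I_cong[of x y k] J_sub_I by blast
qed auto

lemma J_proper: "1 \<notin> J"
  using one_notin_I[of 1] J_sub_I by auto

lemma I_mem_factor: "x \<in> I k \<longleftrightarrow> (\<exists>y. c x = c (y * w ^ k))"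
  by (auto simp: I_def c_eq_iff mult.commute)

lemma PIdl_w: "PIdl\<^bsub>R\<^esub> (c (w ^ k)) = c ` I k"
proof -
  have "PIdl\<^bsub>R\<^esub> (c (w ^ k)) = range (\<lambda>y. c (y * w ^ k))"
  proof -
    have "c (y * w ^ k) = c y \<otimes>\<^bsub>R\<^esub> c (w ^ k)" for y by (simp add: c_mult)
    then show ?thesis unfolding cgenideal_def carrier_R by auto
  qed
  also have "\<dots> = c ` I k"
  proof (intro equalityI subsetI)
    fix u assume "u \<in> range (\<lambda>y. c (y * w ^ k))"
    then obtain y where "u = c (y * w ^ k)" by blast
    moreover have "y * w ^ k \<in> I k" by (subst I_mem_factor) blast
    ultimately show "u \<in> c ` I k" by blast
  next
    fix u assume "u \<in> c ` I k"
    then show "u \<in> range (\<lambda>y. c (y * w ^ k))" using I_mem_factor by auto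
  qed
  finally show ?thesis .
qed

lemma ideal_I: "ideal (c ` I k) R"
  unfolding PIdl_w[symmetric] by (rule CR.cgenideal_ideal) simp

text \<open>By separatedness some power of w fails to divide x; at the last one that does, the
  cofactor is a unit.\<close>

lemma valuation:
  assumes "x \<notin> J"
  obtains v u u' where "x - w ^ v * u \<in> J" "u * u' - 1 \<in> J"
proof -
  have ex: "\<exists>k. x \<notin> I k" using separated[of x] assms by (auto simp: I_def)
  define k where "k = (LEAST k. x \<notin> I k)"
  have k: "x \<notin> I k" unfolding k_def using ex by (rule LeastI_ex)
  have "k \<noteq> 0" using k I_0 by (metis UNIV_I)
  then obtain v where v: "k = Suc v" by (cases k) auto
  have "x \<in> I v" using not_less_Least[of v "\<lambda>k. x \<notin> I k"] v k_def by auto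
  then obtain u where u: "x - w ^ v * u \<in> J" by (auto simp: I_def)
  have "u \<notin> I 1"
  proof
    assume "u \<in> I 1"
    then have "w ^ v * u \<in> I (Suc v)" using wpow_I_iff[of v u 1] by simp
    then show False using I_cong[of x "w ^ v * u" "Suc v"] u J_sub_I k v by blast
  qed
  then obtain u' where "u * u' - 1 \<in> J" using unit_mod[of u] by (auto simp: I_def)
  with u show thesis by (rule that)
qed

lemma wpow_notin_J: "w ^ k \<notin> J"
  using wpow_cancel[of k 1] J_proper by auto

lemma domain_R: "domain R"
proof (rule domainI)
  show "cring R" by (rule cring_R)
  show "\<one>\<^bsub>R\<^esub> \<noteq> \<zero>\<^bsub>R\<^esub>" using J_proper by (simp add: one_R zero_R c_eq_iff)
  fix a b assume ab: "a \<otimes>\<^bsub>R\<^esub> b = \<zero>\<^bsub>R\<^esub>" "a \<in> carrier R" "b \<in> carrier R"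
  then obtain x y where xy: "a = c x" "b = c y" by (auto simp: carrier_R)
  have xyJ: "x * y \<in> J" using ab(1) by (simp add: xy c_mult zero_R c_eq_iff)
  show "a = \<zero>\<^bsub>R\<^esub> \<or> b = \<zero>\<^bsub>R\<^esub>"
  proof (rule ccontr)
    assume "\<not> (a = \<zero>\<^bsub>R\<^esub> \<or> b = \<zero>\<^bsub>R\<^esub>)"
    then have "x \<notin> J" "y \<notin> J" by (simp_all add: xy zero_R c_eq_iff)
    obtain k u u' where x: "x - w ^ k * u \<in> J" "u * u' - 1 \<in> J" using valuation[OF \<open>x \<notin> J\<close>] .
    obtain l v v' where y: "y - w ^ l * v \<in> J" "v * v' - 1 \<in> J" using valuation[OF \<open>y \<notin> J\<close>] .
    \<comment> \<open>If x y were 0 in R, replacing x by w^k u and y by w^l v and cancelling the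
      units would make a power of w vanish.\<close>
    have "w ^ (k + l) = u' * v' * (x * y) - u' * v' * y * (x - w ^ k * u) - u' * v' * (w ^ k * u) * (y - w ^ l * v)
        - w ^ (k + l) * v * v' * (u * u' - 1) - w ^ (k + l) * (v * v' - 1)"
      by (simp add: algebra_simps power_add)
    also have "\<dots> \<in> J" by (intro J_diff J_mult xyJ x y)
    finally show False using wpow_notin_J by blast
  qed
qed

text \<open>The least power of w in a nonzero ideal generates it, since every nonzero element is a
  power of w times a unit.\<close>

lemma ideal_cases:
  assumes "ideal A R"
  shows "A = {\<zero>\<^bsub>R\<^esub>} \<or> (\<exists>k. A = c ` I k)"
proof (cases "A = {\<zero>\<^bsub>R\<^esub>}")
  case False
  interpret A: ideal A R by fact
  have sub: "A \<subseteq> carrier R" by (rule A.Icarr[THEN subsetI])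
  have pw: "\<exists>v. c (w ^ v) \<in> A \<and> x \<in> I v" if xA: "c x \<in> A" and xJ: "x \<notin> J" for x
  proof -
    obtain v u u' where v: "x - w ^ v * u \<in> J" "u * u' - 1 \<in> J" using valuation[OF xJ] .
    have "c u' \<otimes>\<^bsub>R\<^esub> c x \<in> A" using xA by (rule A.I_l_closed) simp
    moreover have "u' * x - w ^ v = u' * (x - w ^ v * u) + w ^ v * (u * u' - 1)" by (simp add: algebra_simps)
    then have "u' * x - w ^ v \<in> J" using J_add[OF J_mult[OF v(1), of u'] J_mult[OF v(2), of "w ^ v"]] by simp
    then have "c (u' * x) = c (w ^ v)" by (simp add: c_eq_iff)
    ultimately show ?thesis using v(1) by (auto simp: c_mult I_def)
  qed
  obtain a where "a \<in> A" "a \<noteq> \<zero>\<^bsub>R\<^esub>" using False A.zero_closed by blast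
  then obtain x where x: "c x \<in> A" "x \<notin> J" using sub by (auto simp: carrier_R zero_R c_eq_iff)
  then have ex: "\<exists>v. c (w ^ v) \<in> A" using pw by blast
  define k where "k = (LEAST v. c (w ^ v) \<in> A)"
  have k: "c (w ^ k) \<in> A" unfolding k_def using ex by (rule LeastI_ex)
  have "A = c ` I k"
  proof (intro equalityI subsetI)
    fix b assume b: "b \<in> A"
    then obtain y where y: "b = c y" using sub by (auto simp: carrier_R)
    show "b \<in> c ` I k"
    proof (cases "y \<in> J")
      case True
      then show ?thesis using y J_sub_I by blast
    next
      case False
      then obtain v where v: "c (w ^ v) \<in> A" "y \<in> I v" using pw b y by blast
      have "k \<le> v" unfolding k_def using v(1) by (rule Least_le)
      then show ?thesis using v(2) I_antimono y by blast
    qed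
  next
    fix b assume "b \<in> c ` I k"
    then obtain y where "b = c y \<otimes>\<^bsub>R\<^esub> c (w ^ k)" using I_mem_factor by (auto simp: c_mult)
    then show "b \<in> A" using k A.I_l_closed by simp
  qed
  then show ?thesis by blast
qed simp

lemma principal_domain_R: "principal_domain R"
proof -
  interpret domain R by (rule domain_R)
  show ?thesis
  proof
    fix A assume "ideal A R"
    then consider "A = {\<zero>\<^bsub>R\<^esub>}" | k where "A = c ` I k" using ideal_cases by blast
    then show "\<exists>a\<in>carrier R. A = PIdl\<^bsub>R\<^esub> a"
    proof cases
      case 1
      then show ?thesis using CR.cgenideal_eq_genideal[of "\<zero>\<^bsub>R\<^esub>"] CR.genideal_zero by (intro bexI[of _ "\<zero>\<^bsub>R\<^esub>"]) auto
    next
      case 2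
      then show ?thesis using PIdl_w by (intro bexI[of _ "c (w ^ k)"]) auto
    qed
  qed
qed

lemma I_subset_iff: "c ` I k \<subseteq> c ` I l \<longleftrightarrow> l \<le> k"
proof
  assume "c ` I k \<subseteq> c ` I l"
  then have "w ^ k * 1 \<in> I l" using wpow_I[of k 1] c_mem_I by blast
  show "l \<le> k"
  proof (rule ccontr)
    assume "\<not> l \<le> k"
    then have "w ^ k * 1 \<in> I (k + (l - k))" using \<open>w ^ k * 1 \<in> I l\<close> by simp
    then have "1 \<in> I (l - k)" using wpow_I_iff by blast
    then show False using one_notin_I[of "l - k"] \<open>\<not> l \<le> k\<close> by simp
  qed
next
  assume "l \<le> k" then show "c ` I k \<subseteq> c ` I l" using I_antimono by blast
qed

lemma maximalideal_iff: "maximalideal A R \<longleftrightarrow> A = c ` I 1"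
proof
  have I0: "c ` I 0 = carrier R" by (simp add: I_0 carrier_R)
  have z: "{\<zero>\<^bsub>R\<^esub>} \<subset> c ` I k" for k
  proof -
    have "\<zero>\<^bsub>R\<^esub> \<in> c ` I k" unfolding zero_R using subgrp_0[OF subgrp_I] by blast
    moreover have "c (w ^ k) \<in> c ` I k" using wpow_I[of k 1] by simp
    moreover have "c (w ^ k) \<noteq> \<zero>\<^bsub>R\<^esub>" using wpow_notin_J by (simp add: zero_R c_eq_iff)
    ultimately show ?thesis by blast
  qed
  have ne: "c ` I 1 \<noteq> carrier R" using I_subset_iff[of 0 1] by (simp add: I0[symmetric])
  assume "maximalideal A R"
  then interpret A: maximalideal A R .
  have "ideal A R" by (rule A.is_ideal)
  then consider "A = {\<zero>\<^bsub>R\<^esub>}" | k where "A = c ` I k" using ideal_cases by blast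
  then have "A \<subseteq> c ` I 1"
  proof cases
    case 1
    then show ?thesis using z by blast
  next
    case (2 k)
    then have "k \<noteq> 0" using A.I_notcarr I0 by auto
    then show ?thesis unfolding 2 I_subset_iff by simp
  qed
  then show "A = c ` I 1"
    using A.I_maximal[OF ideal_I[of 1]] ne by (auto simp: carrier_R)
next
  have I0: "c ` I 0 = carrier R" by (simp add: I_0 carrier_R)
  assume A: "A = c ` I 1"
  show "maximalideal A R" unfolding A
  proof (rule maximalidealI[OF ideal_I])
    show "carrier R \<noteq> c ` I 1" using I_subset_iff[of 0 1] by (auto simp: I0[symmetric])
    fix B assume B: "ideal B R" "c ` I 1 \<subseteq> B" "B \<subseteq> carrier R"
    from ideal_cases[OF B(1)] show "B = c ` I 1 \<or> B = carrier R"
    proof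
      assume "B = {\<zero>\<^bsub>R\<^esub>}"
      then have "c (w ^ 1) = \<zero>\<^bsub>R\<^esub>" using B(2) wpow_I[of 1 1] by auto
      then show ?thesis using wpow_notin_J[of 1] by (simp add: zero_R c_eq_iff)
    next
      assume "\<exists>k. B = c ` I k"
      then obtain k where k: "B = c ` I k" by blast
      then have "k \<le> 1" using B(2) I_subset_iff by simp
      then have "k = 0 \<or> k = 1" by auto
      then show ?thesis using k I0 by auto
    qed
  qed
qed

lemma max_ideal_R: "max_ideal R = c ` I 1"
  unfolding max_ideal_def maximalideal_iff by simp

lemma discrete_valuation_ring_R: "discrete_valuation_ring R"
  unfolding discrete_valuation_ring_def maximalideal_iff
proof (intro conjI)
  show "\<not> field R"
  proof
    assume "field R"
    then interpret field R .
    have "c (w ^ 1) \<in> Units R" using wpow_notin_J[of 1] by (simp add: field_Units zero_R c_eq_iff)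
    then obtain y where "y \<in> carrier R" "y \<otimes>\<^bsub>R\<^esub> c (w ^ 1) = \<one>\<^bsub>R\<^esub>" unfolding Units_def by blast
    then obtain x where "c (x * w ^ 1) = c 1" by (auto simp: carrier_R c_mult one_R)
    then have "1 \<in> I 1" using I_mem_factor[of 1 1] by metis
    then show False using one_notin_I[of 1] by simp
  qed
qed (use principal_domain_R in auto)

lemma ideal_prod_I: "ideal_prod R (c ` I k) (c ` I l) = c ` I (k + l)"
proof (intro equalityI subsetI)
  fix u assume "u \<in> ideal_prod R (c ` I k) (c ` I l)"
  then show "u \<in> c ` I (k + l)"
  proof (induction rule: ideal_prod.induct)
    case (prod i j)
    from prod obtain a b where ab: "i = c (a * w ^ k)" "j = c (b * w ^ l)" using I_mem_factor by blast
    have "i \<otimes>\<^bsub>R\<^esub> j = c (a * b * w ^ (k + l))" by (simp add: ab c_mult power_add mult_ac)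
    moreover have "a * b * w ^ (k + l) \<in> I (k + l)" by (subst I_mem_factor) blast
    ultimately show ?case by blast
  next
    case (sum s t)
    then obtain a b where "a \<in> I (k + l)" "b \<in> I (k + l)" "s = c a" "t = c b" by blast
    then show ?case using subgrp_add[OF subgrp_I] by (auto simp: c_add)
  qed
next
  fix u assume "u \<in> c ` I (k + l)"
  then obtain y where y: "u = c (y * w ^ (k + l))" using I_mem_factor by blast
  have "u = c (y * w ^ k) \<otimes>\<^bsub>R\<^esub> c (w ^ l)" by (simp add: y c_mult power_add mult_ac)
  moreover have "c (y * w ^ k) \<in> c ` I k" using I_mem_factor c_mem_I by blast
  moreover have "c (w ^ l) \<in> c ` I l" using wpow_I[of l 1] by simp
  ultimately show "u \<in> ideal_prod R (c ` I k) (c ` I l)" by (metis ideal_prod.prod)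
qed

lemma max_ideal_pow: "max_ideal R [^]\<^bsub>ideals_set R\<^esub> k = c ` I k"
proof (induction k)
  case 0
  then show ?case by (simp add: ideals_set_def I_0 carrier_R)
next
  case (Suc k)
  have "max_ideal R [^]\<^bsub>ideals_set R\<^esub> Suc k = ideal_prod R (max_ideal R [^]\<^bsub>ideals_set R\<^esub> k) (max_ideal R)"
    by (simp add: ideals_set_def)
  also have "\<dots> = ideal_prod R (c ` I k) (max_ideal R)" unfolding Suc ..
  also have "\<dots> = ideal_prod R (c ` I k) (c ` I 1)" unfolding max_ideal_R ..
  also have "\<dots> = c ` I (Suc k)" using ideal_prod_I[of k 1] by simp
  finally show ?case .
qed

lemma ramification_R: "has_ramification_index p R e"
proof -
  have "c (of_nat p) = c (w ^ e)" using p_w by (simp add: c_eq_iff)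
  then show ?thesis unfolding has_ramification_index_def max_ideal_pow c_nat using PIdl_w by simp
qed

lemma of_nat_I_iff: "of_nat k \<in> I 1 \<longleftrightarrow> p dvd k"
proof
  have pI: "of_nat p \<in> I 1"
  proof -
    have "of_nat p \<in> I e" by (rule I_I[of _ _ 1]) (simp add: p_w)
    then show ?thesis using I_antimono[OF e1] by blast
  qed
  {
    assume "p dvd k"
    then obtain l where "k = p * l" by auto
    then have "of_nat k = (of_nat l * of_nat p :: 'b)" by (simp add: mult.commute)
    then show "of_nat k \<in> I 1" using I_mult[OF pI] by simp
  }
  {
    assume k: "of_nat k \<in> I 1"
    show "p dvd k"
    proof (rule ccontr)
      assume "\<not> p dvd k"
      then have "coprime (int p) (int k)" using prime_p by (simp add: prime_imp_coprime)
      then have "gcd (int p) (int k) = 1" by (rule coprime_imp_gcd_eq_1)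
      then obtain a b where ab: "a * int p + b * int k = 1"
        using bezout_int[of "int p" "int k"] by metis
      have "1 = (of_int (a * int p + b * int k) :: 'b)" by (simp add: ab)
      also have "\<dots> = of_int a * of_nat p + of_int b * of_nat k" by simp
      also have "\<dots> \<in> I 1" by (intro subgrp_add[OF subgrp_I] I_mult pI k)
      finally show False using one_notin_I[of 1] by simp
    qed
  }
qed

text \<open>A nonzero k is p^v k' with k' prime to p; p cancels modulo J, and k' does not even lie
  in the maximal ideal.\<close>

lemma characteristic_R: "has_characteristic R 0"
  unfolding has_characteristic_def
proof (intro allI)
  fix k :: nat
  have "k = 0" if "of_nat k \<in> J"
  proof (rule ccontr)
    assume "k \<noteq> 0"
    moreover have "\<not> is_unit p" using prime_p not_prime_unit by blast
    ultimately obtain k' where "k = p ^ multiplicity p k * k'" "\<not> p dvd k'"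
      using multiplicity_decompose'[of k p] by blast
    then obtain v where k: "k = p ^ v * k'" "\<not> p dvd k'" by blast
    have "of_nat k' \<in> J"
      using \<open>of_nat k \<in> J\<close> unfolding k(1) by (induction v) (auto simp: mult.assoc dest: p_cancel)
    then have "of_nat k' \<in> I 1" using J_sub_I by blast
    then show False using of_nat_I_iff k(2) by blast
  qed
  then show "[k] \<cdot>\<^bsub>R\<^esub> \<one>\<^bsub>R\<^esub> = \<zero>\<^bsub>R\<^esub> \<longleftrightarrow> 0 dvd k"
    unfolding c_nat zero_R c_eq_iff using J_0 by auto
qed

section \<open>The residue field and its dimension over the prime field\<close>

abbreviation "Q \<equiv> residue_field R"

definition q :: "'b \<Rightarrow> 'r set" where
  "q x = (c ` I 1) +>\<^bsub>R\<^esub> c x"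

lemma q_conv: "q x = c ` {y. y - x \<in> I 1}"
proof -
  have "q x = {c (i + x) | i. i \<in> I 1}" by (auto simp: q_def a_r_coset_def' c_add)
  also have "\<dots> = c ` {y. y - x \<in> I 1}" by (auto simp: image_iff) (metis add_diff_cancel_right' diff_add_cancel)+
  finally show ?thesis .
qed

lemma coset_eq_c: "(c ` I k) +>\<^bsub>R\<^esub> c x = c ` {y. y - x \<in> I k}"
proof -
  have "(c ` I k) +>\<^bsub>R\<^esub> c x = {c (i + x) | i. i \<in> I k}" by (auto simp: a_r_coset_def' c_add)
  also have "\<dots> = c ` {y. y - x \<in> I k}" by (auto simp: image_iff) (metis add_diff_cancel_right' diff_add_cancel)+
  finally show ?thesis .
qed

lemma c_mem_coset: "c y \<in> (c ` I k) +>\<^bsub>R\<^esub> c x \<longleftrightarrow> y - x \<in> I k"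
  unfolding coset_eq_c
proof
  assume "c y \<in> c ` {y. y - x \<in> I k}"
  then obtain z where z: "z - x \<in> I k" "y - z \<in> J" by (auto simp: c_eq_iff)
  then have "(y - z) + (z - x) \<in> I k" using J_sub_I by (intro subgrp_add[OF subgrp_I]) auto
  then show "y - x \<in> I k" by simp
qed auto

lemma coset_eq_coset: "y - x \<in> I k \<Longrightarrow> (c ` I k) +>\<^bsub>R\<^esub> c y = (c ` I k) +>\<^bsub>R\<^esub> c x"
proof -
  assume yx: "y - x \<in> I k"
  have "z - y \<in> I k \<longleftrightarrow> z - x \<in> I k" for z
    using I_cong[of "z - x" "z - y" k] yx by simp
  then show ?thesis unfolding coset_eq_c by simp
qed

lemma q_eq_iff: "q x = q y \<longleftrightarrow> x - y \<in> I 1"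
proof
  assume "q x = q y"
  moreover have "c x \<in> q x" unfolding q_def c_mem_coset using subgrp_0[OF subgrp_I] by simp
  ultimately show "x - y \<in> I 1" unfolding q_def using c_mem_coset by blast
next
  assume "x - y \<in> I 1"
  then show "q x = q y" unfolding q_def by (rule coset_eq_coset)
qed

lemma ideal_1: "ideal (c ` I 1) R"
  by (rule ideal_I)

lemma Q_ring: "ring Q"
  unfolding max_ideal_R using ideal.quotient_is_ring[OF ideal_1] .

lemma Q_carrier: "carrier Q = range q"
  unfolding max_ideal_R by (auto simp: FactRing_def A_RCOSETS_def' q_def carrier_R)

lemma Q_zero: "\<zero>\<^bsub>Q\<^esub> = q 0"
proof -
  have "q 0 = c ` I 1" by (simp add: q_conv)
  then show ?thesis unfolding max_ideal_R by (simp add: FactRing_def)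
qed

lemma Q_one: "\<one>\<^bsub>Q\<^esub> = q 1"
  unfolding max_ideal_R by (simp add: FactRing_def q_def one_R)

lemma Q_add: "q x \<oplus>\<^bsub>Q\<^esub> q y = q (x + y)"
proof -
  interpret M: ideal "c ` I 1" R by (rule ideal_1)
  show ?thesis unfolding max_ideal_R q_def by (simp add: FactRing_def M.a_rcos_sum[unfolded One_nat_def] c_add)
qed

lemma Q_mult: "q x \<otimes>\<^bsub>Q\<^esub> q y = q (x * y)"
proof -
  interpret M: ideal "c ` I 1" R by (rule ideal_1)
  show ?thesis unfolding max_ideal_R q_def by (simp add: FactRing_def M.rcoset_mult_add[unfolded One_nat_def] c_mult)
qed

sublocale QR: ring Q
  by (rule Q_ring)

lemma q_carrier: "q x \<in> carrier Q"
  by (simp add: Q_carrier)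

lemma q_nat:
  fixes k :: nat
  shows "[k] \<cdot>\<^bsub>Q\<^esub> \<one>\<^bsub>Q\<^esub> = q (of_nat k)"
proof (induction k)
  case 0
  then show ?case by (simp add: Q_zero)
next
  case (Suc k)
  then show ?case by (simp add: Q_one Q_add add.commute)
qed

lemma q_uminus: "\<ominus>\<^bsub>Q\<^esub> q x = q (- x)"
  by (rule QR.minus_equality) (simp_all add: Q_add Q_zero q_carrier)

lemma q_int:
  fixes k :: int
  shows "[k] \<cdot>\<^bsub>Q\<^esub> \<one>\<^bsub>Q\<^esub> = q (of_int k)"
proof (cases "k \<ge> 0")
  case True
  then obtain m where "k = int m" using nonneg_int_cases by blast
  then show ?thesis using q_nat[of m] by (simp add: add_pow_int_ge)
next
  case False
  then obtain m where m: "k = - int m" by (metis neg_int_cases not_le)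
  have "[k] \<cdot>\<^bsub>Q\<^esub> \<one>\<^bsub>Q\<^esub> = \<ominus>\<^bsub>Q\<^esub> ([m] \<cdot>\<^bsub>Q\<^esub> \<one>\<^bsub>Q\<^esub>)"
    using False m by (simp add: add_pow_int_lt)
  then show ?thesis unfolding q_nat q_uminus by (simp add: m)
qed

lemma residue_characteristic: "has_characteristic Q p"
  unfolding has_characteristic_def q_nat Q_zero q_eq_iff using of_nat_I_iff by simp

text \<open>\<open>dimension\<close> grows by one line at a time, so a chain of subgroups of sizes
  1, p, ..., p^f modulo I 1 is built by adjoining elements; the last one is everything.\<close>

lemma inertia_R: "has_inertia_degree R f"
proof -
  define K where "K = range (\<lambda>k::int. [k] \<cdot>\<^bsub>Q\<^esub> \<one>\<^bsub>Q\<^esub>)"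
  have K: "K = range (\<lambda>k::int. q (of_int k))" unfolding K_def q_int ..
  have ex: "\<exists>S. subgrp S \<and> I 1 \<subseteq> S \<and> QR.dimension m K (q ` S) \<and> idx S (I 1) = p ^ m" if "m \<le> f" for m
    using that
  proof (induction m)
    case 0
    have "q ` I 1 = {\<zero>\<^bsub>Q\<^esub>}"
    proof -
      have "q x = q 0" if "x \<in> I 1" for x using that q_eq_iff[of x 0] by simp
      then show ?thesis using subgrp_0[OF subgrp_I[of 1]] unfolding Q_zero by blast
    qed
    then have dim: "QR.dimension 0 K (q ` I 1)" using QR.zero_dim by simp
    show ?case
    proof (intro exI conjI)
      show "subgrp (I 1)" by (rule subgrp_I)
      show "I 1 \<subseteq> I 1" by (rule subset_refl)
      show "QR.dimension 0 K (q ` I 1)" by (rule dim)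
      show "idx (I 1) (I 1) = p ^ 0" unfolding power_0 by (rule idx_self[OF subgrp_I])
    qed
  next
    case (Suc m)
    then obtain S where S: "subgrp S" "I 1 \<subseteq> S" "QR.dimension m K (q ` S)" "idx S (I 1) = p ^ m" by auto
    have "S \<noteq> UNIV"
    proof
      assume "S = UNIV"
      then have "p ^ f = p ^ m" using S(4) idx_UNIV_I[of 1] by simp
      then have "f = m" using p1 power_inject_exp by blast
      then show False using Suc.prems by simp
    qed
    then obtain v where v: "v \<notin> S" by blast
    have qv: "q v \<notin> q ` S"
    proof
      assume "q v \<in> q ` S"
      then obtain s where s: "s \<in> S" "v - s \<in> I 1" using q_eq_iff by auto
      then have "(v - s) + s \<in> S" using subgrp_add[OF S(1), of "v - s" s] S(2) by blast
      then show False using v by simp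
    qed
    have "QR.line_extension K (q v) (q ` S) = q ` adj S v"
    proof (intro equalityI subsetI)
      fix u assume "u \<in> QR.line_extension K (q v) (q ` S)"
      then obtain k s where "s \<in> S" "u = q (of_int k) \<otimes>\<^bsub>Q\<^esub> q v \<oplus>\<^bsub>Q\<^esub> q s"
        unfolding QR.line_extension_mem_iff K by blast
      then have "u = q (s + of_int k * v)" "s + of_int k * v \<in> adj S v"
        using adjI by (simp_all add: Q_add Q_mult add.commute) blast
      then show "u \<in> q ` adj S v" by blast
    next
      fix u assume "u \<in> q ` adj S v"
      then obtain s k where "s \<in> S" "u = q (s + of_int k * v)" by (auto simp: adj_def)
      then have "u = q (of_int k) \<otimes>\<^bsub>Q\<^esub> q v \<oplus>\<^bsub>Q\<^esub> q s" by (simp add: Q_add Q_mult add.commute)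
      then show "u \<in> QR.line_extension K (q v) (q ` S)"
        unfolding QR.line_extension_mem_iff K using \<open>s \<in> S\<close> by blast
    qed
    then have dim: "QR.dimension (Suc m) K (q ` adj S v)"
      using QR.Suc_dim[OF q_carrier qv S(3)] by simp
    have "of_nat p * v \<in> S"
    proof -
      have "of_nat p \<in> I 1" using of_nat_I_iff by simp
      then have "v * of_nat p \<in> I 1" by (rule I_mult)
      then show ?thesis using S(2) by (auto simp: mult.commute)
    qed
    from idx_adj[OF prime_p S(1) v this]
    have "idx (adj S v) (I 1) = p ^ Suc m"
      using idx_tower[OF subgrp_I S(1) subgrp_adj[OF S(1)] S(2) adj_base, of v] S(4) by simp
    moreover have "I 1 \<subseteq> adj S v" using S(2) adj_base by blast
    ultimately show ?case using subgrp_adj[OF S(1)] dim by blast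
  qed
  obtain S where S: "subgrp S" "I 1 \<subseteq> S" "QR.dimension f K (q ` S)" "idx S (I 1) = p ^ f"
    using ex[of f] by auto
  have "idx UNIV (I 1) = idx UNIV S * idx S (I 1)"
    by (rule idx_tower[OF subgrp_I S(1) subgrp_UNIV S(2)]) simp
  then have "p ^ f = idx UNIV S * p ^ f" unfolding S(4) idx_UNIV_I by simp
  then have "idx UNIV S = 1" using p0 by simp
  then have "S = UNIV" using idx_eq_1D[OF _ S(1) subgrp_UNIV] by blast
  then show ?thesis using S(3) unfolding has_inertia_degree_def K_def[symmetric] Q_carrier by simp
qed

section \<open>The adic topology and compactness\<close>

lemma openin_R: "openin (adic_topology R (max_ideal R)) U \<longleftrightarrow> U \<subseteq> carrier R \<and>
    (\<forall>x\<in>U. \<exists>k. (c ` I k) +>\<^bsub>R\<^esub> x \<subseteq> U)"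
proof -
  have "ideal (max_ideal R) R" unfolding max_ideal_R by (rule ideal_1)
  from openin_adic_topology[OF cring_R this, of U] show ?thesis unfolding max_ideal_pow .
qed

lemma openin_coset: "openin (adic_topology R (max_ideal R)) ((c ` I k) +>\<^bsub>R\<^esub> c x)"
  unfolding openin_R
proof (intro conjI ballI)
  show "(c ` I k) +>\<^bsub>R\<^esub> c x \<subseteq> carrier R" unfolding coset_eq_c by auto
  fix y assume "y \<in> (c ` I k) +>\<^bsub>R\<^esub> c x"
  then obtain z where "y = c z" "z - x \<in> I k" unfolding coset_eq_c by blast
  then have "(c ` I k) +>\<^bsub>R\<^esub> y = (c ` I k) +>\<^bsub>R\<^esub> c x" using coset_eq_coset by simp
  then show "\<exists>l. (c ` I l) +>\<^bsub>R\<^esub> y \<subseteq> (c ` I k) +>\<^bsub>R\<^esub> c x" by (metis subset_refl)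
qed

lemma topspace_R: "topspace (adic_topology R (max_ideal R)) = carrier R"
proof (rule antisym)
  show "topspace (adic_topology R (max_ideal R)) \<subseteq> carrier R"
    using openin_R openin_topspace by blast
  have "openin (adic_topology R (max_ideal R)) (carrier R)"
    unfolding openin_R
  proof (intro conjI ballI subset_refl)
    fix x assume "x \<in> carrier R"
    then obtain y where "x = c y" by (auto simp: carrier_R)
    then show "\<exists>k. (c ` I k) +>\<^bsub>R\<^esub> x \<subseteq> carrier R" using coset_eq_c by (intro exI[of _ 0]) auto
  qed
  then show "carrier R \<subseteq> topspace (adic_topology R (max_ideal R))" by (rule openin_subset)
qed

lemma finite_reps: "\<exists>D. finite D \<and> (\<forall>y. \<exists>d\<in>D. y - d \<in> I 1)"
proof -
  have "card ((\<lambda>x. (+) x ` I 1) ` UNIV) \<noteq> 0" using idx_UNIV_I[of 1] p0 by (simp add: idx_def)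
  then have "finite ((\<lambda>x. (+) x ` I 1) ` UNIV)" using card_ge_0_finite by blast
  then obtain D where D: "finite D" "(\<lambda>x. (+) x ` I 1) ` UNIV = (\<lambda>x. (+) x ` I 1) ` D"
    by (metis finite_subset_image subset_refl)
  have "\<exists>d\<in>D. y - d \<in> I 1" for y
  proof -
    have "(+) y ` I 1 \<in> (\<lambda>x. (+) x ` I 1) ` D" using D(2) by blast
    then obtain d where "d \<in> D" "(+) y ` I 1 = (+) d ` I 1" by blast
    then show ?thesis using coset_eq_iff[OF subgrp_I, of y 1 d] by blast
  qed
  then show ?thesis using D(1) by blast
qed

text \<open>A ball without finite subcover contains such a ball of the next level, since finitely
  many of these cover it. The centres converge by \<open>complete\<close>, and a member of the cover
  around the limit contains one of the balls.\<close>

lemma compact_R: "compact_space (adic_topology R (max_ideal R))"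
  unfolding compact_space_def compactin_def topspace_R
proof (intro conjI allI impI subset_refl)
  fix \<U> assume U: "(\<forall>U\<in>\<U>. openin (adic_topology R (max_ideal R)) U) \<and> carrier R \<subseteq> \<Union>\<U>"
  define fc where "fc A \<longleftrightarrow> (\<exists>F. finite F \<and> F \<subseteq> \<U> \<and> A \<subseteq> \<Union>F)" for A
  have fc_UN: "fc (\<Union>d\<in>D. A d)" if D: "finite D" "\<And>d. d \<in> D \<Longrightarrow> fc (A d)" for D :: "'b set" and A
  proof -
    have "\<forall>d\<in>D. \<exists>F. finite F \<and> F \<subseteq> \<U> \<and> A d \<subseteq> \<Union>F" using D(2) by (simp add: fc_def)
    then obtain F where F: "\<forall>d\<in>D. finite (F d) \<and> F d \<subseteq> \<U> \<and> A d \<subseteq> \<Union>(F d)"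
      using bchoice[of D "\<lambda>d F. finite F \<and> F \<subseteq> \<U> \<and> A d \<subseteq> \<Union>F"] by auto
    have "finite (\<Union>d\<in>D. F d)" using D(1) F by (intro finite_UN_I) simp_all
    moreover have "(\<Union>d\<in>D. F d) \<subseteq> \<U>" using F by (intro UN_least) simp
    moreover have "(\<Union>d\<in>D. A d) \<subseteq> \<Union>(\<Union>d\<in>D. F d)"
    proof (rule UN_least)
      fix d assume d: "d \<in> D"
      then have "A d \<subseteq> \<Union>(F d)" using F by simp
      also have "\<dots> \<subseteq> \<Union>(\<Union>d\<in>D. F d)" using d by (intro Union_mono UN_upper)
      finally show "A d \<subseteq> \<Union>(\<Union>d\<in>D. F d)" .
    qed
    ultimately show ?thesis unfolding fc_def by (intro exI conjI)
  qed
  have fc_mono: "fc A" if AB: "fc B" "A \<subseteq> B" for A B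
  proof -
    obtain F where "finite F" "F \<subseteq> \<U>" "B \<subseteq> \<Union>F" using AB(1) unfolding fc_def by (elim exE conjE)
    then show ?thesis unfolding fc_def using subset_trans[OF AB(2)] by (intro exI[of _ F] conjI)
  qed
  define B where "B x k = c ` {y. y - x \<in> I k}" for x k
  obtain D where D: "finite D" "\<And>y. \<exists>d\<in>D. y - d \<in> I 1" using finite_reps by blast
  have step: "\<exists>d. \<not> fc (B (x + w ^ k * d) (Suc k))" if "\<not> fc (B x k)" for x k
  proof (rule ccontr)
    assume "\<nexists>d. \<not> fc (B (x + w ^ k * d) (Suc k))"
    then have "fc (\<Union>d\<in>D. B (x + w ^ k * d) (Suc k))" by (intro fc_UN[OF D(1)]) simp
    moreover have "B x k \<subseteq> (\<Union>d\<in>D. B (x + w ^ k * d) (Suc k))"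
    proof
      fix u assume "u \<in> B x k"
      then obtain y where y: "u = c y" "y - x \<in> I k" by (auto simp: B_def)
      then obtain z where z: "y - x - w ^ k * z \<in> J" by (auto simp: I_def)
      obtain d where d: "d \<in> D" "z - d \<in> I 1" using D(2) by blast
      have "w ^ k * (z - d) \<in> I (Suc k)" using wpow_I_iff[of k "z - d" 1] d(2) by simp
      then have "(y - x - w ^ k * z) + w ^ k * (z - d) \<in> I (Suc k)"
        using z J_sub_I by (intro subgrp_add[OF subgrp_I]) auto
      moreover have "(y - x - w ^ k * z) + w ^ k * (z - d) = y - (x + w ^ k * d)" by (simp add: algebra_simps)
      ultimately have "u \<in> B (x + w ^ k * d) (Suc k)" using y(1) by (auto simp: B_def)
      then show "u \<in> (\<Union>d\<in>D. B (x + w ^ k * d) (Suc k))" using d(1) by blast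
    qed
    ultimately have "fc (B x k)" by (rule fc_mono)
    then show False using that by contradiction
  qed
  have "fc (carrier R)"
  proof (rule ccontr)
    assume "\<not> fc (carrier R)"
    then have bad0: "\<not> fc (B 0 0)" by (simp add: B_def I_0 carrier_R)
    define g where "g k x = (SOME d. \<not> fc (B (x + w ^ k * d) (Suc k)))" for k x
    define xs where "xs = rec_nat 0 (\<lambda>k x. x + w ^ k * g k x)"
    have xs: "xs 0 = 0" "xs (Suc k) = xs k + w ^ k * g k (xs k)" for k by (simp_all add: xs_def)
    have bad: "\<not> fc (B (xs k) k)" for k
    proof (induction k)
      case (Suc k)
      show ?case unfolding xs(2) g_def using step[OF Suc] by (rule someI_ex)
    qed (simp add: xs bad0)
    have sum: "xs k = (\<Sum>i<k. w ^ i * g i (xs i))" for k by (induction k) (simp_all add: xs)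
    obtain x where x: "\<And>k. \<exists>y. x - (\<Sum>i<k. w ^ i * g i (xs i)) - w ^ k * y \<in> J"
      using complete[of "\<lambda>i. g i (xs i)"] by blast
    have xI: "xs k - x \<in> I k" for k
      using x[of k] subgrp_diff_commute[OF subgrp_I, of x "xs k" k] unfolding sum[symmetric] I_def by blast
    have "c x \<in> \<Union>\<U>" using U c_carrier[of x] by (intro subsetD[of "carrier R" "\<Union>\<U>"]) simp_all
    then obtain U where U': "U \<in> \<U>" "c x \<in> U" by (elim UnionE)
    have "openin (adic_topology R (max_ideal R)) U" using U U'(1) by simp
    then obtain k where k: "(c ` I k) +>\<^bsub>R\<^esub> c x \<subseteq> U" using U'(2) unfolding openin_R by metis
    have "B (xs k) k = (c ` I k) +>\<^bsub>R\<^esub> c x" using coset_eq_coset[OF xI[of k]] unfolding B_def coset_eq_c by simp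
    then have "B (xs k) k \<subseteq> U" using k by simp
    then have "fc (B (xs k) k)" unfolding fc_def using U'(1) by (intro exI[of _ "{U}"]) simp
    then show False using bad by simp
  qed
  then show "\<exists>\<F>. finite \<F> \<and> \<F> \<subseteq> \<U> \<and> carrier R \<subseteq> \<Union>\<F>" by (simp add: fc_def)
qed

lemma finite_extension_R: "finite_extension_of_Zp p R"
  unfolding finite_extension_of_Zp_def
  using discrete_valuation_ring_R compact_R characteristic_R residue_characteristic by blast

end

section \<open>Normal subgroups of the Heisenberg group\<close>

lemma interval_1_3: "{1..3::nat} = {1, 2, 3}"
  by auto

context coded_ring
begin

abbreviation "Hs \<equiv> heisenberg R"
abbreviation "ix \<equiv> {1..3::nat} \<times> {1..3::nat}"

definition em :: "'b ^ 3 \<Rightarrow> nat \<Rightarrow> nat \<Rightarrow> 'b" where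
  "em v i j = (if i = j then 1 else if i = 1 \<and> j = 2 then v $ 1
     else if i = 2 \<and> j = 3 then v $ 2 else if i = 1 \<and> j = 3 then v $ 3 else 0)"

definition hmat :: "'b ^ 3 \<Rightarrow> nat \<times> nat \<Rightarrow> 'r" where
  "hmat v = (\<lambda>(i, j)\<in>ix. c (em v i j))"

text \<open>In the entries (1,2), (2,3), (1,3), matrix multiplication is addition up to the cocycle
  u_1 v_2 in the centre.\<close>

definition hm :: "'b ^ 3 \<Rightarrow> 'b ^ 3 \<Rightarrow> 'b ^ 3" where
  "hm u v = u + v + vector [0, 0, u $ 1 * v $ 2]"

lemma mat_apply: "i \<in> {1..3} \<Longrightarrow> j \<in> {1..3} \<Longrightarrow> hmat v (i, j) = c (em v i j)"
  by (simp add: hmat_def)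

lemma mat_apply_pair: "x \<in> ix \<Longrightarrow> hmat v x = c (em v (fst x) (snd x))"
  by (auto simp: mat_apply)

lemma c_dec: "u \<in> carrier R \<Longrightarrow> c (dec u) = u"
  using dec_c by (auto simp: carrier_R c_eq_iff)

lemma carrier_Hs: "carrier Hs = range hmat"
proof (intro equalityI subsetI)
  fix A assume "A \<in> carrier Hs"
  then have A: "A \<in> ix \<rightarrow>\<^sub>E carrier R" "\<And>i. i \<in> {1..3} \<Longrightarrow> A (i, i) = \<one>\<^bsub>R\<^esub>"
    "\<And>i j. i \<in> {1..3} \<Longrightarrow> j \<in> {1..3} \<Longrightarrow> j < i \<Longrightarrow> A (i, j) = \<zero>\<^bsub>R\<^esub>"
    by (simp_all add: heisenberg_def)
  define v :: "'b ^ 3" where "v = vector [dec (A (1, 2)), dec (A (2, 3)), dec (A (1, 3))]"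
  have Ac: "A (i, j) \<in> carrier R" if "i \<in> {1..3}" "j \<in> {1..3}" for i j
    using PiE_mem[OF A(1), of "(i, j)"] that by simp
  have "A = hmat v"
  proof
    fix x :: "nat \<times> nat"
    obtain i j where x: "x = (i, j)" by (cases x)
    show "A x = hmat v x"
    proof (cases "x \<in> ix")
      case False
      then show ?thesis using PiE_arb[OF A(1)] by (simp add: hmat_def)
    next
      case True
      have ij: "i \<in> {1, 2, 3}" "j \<in> {1, 2, 3}" using True unfolding x mem_Times_iff interval_1_3 by (simp_all only: fst_conv snd_conv)
      have m: "hmat v (i, j) = c (em v i j)" using True x by (simp add: hmat_def)
      have "A (i, j) = c (em v i j)"
        using ij A(2)[of i] A(3)[of i j] c_dec[OF Ac, of 1 2] c_dec[OF Ac, of 2 3] c_dec[OF Ac, of 1 3]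
        by (auto simp: em_def v_def one_R zero_R)
      then show ?thesis using m x by simp
    qed
  qed
  then show "A \<in> range hmat" by blast
next
  fix A assume "A \<in> range hmat"
  then obtain v where v: "A = hmat v" by blast
  show "A \<in> carrier Hs" unfolding v heisenberg_def
    by (auto simp: hmat_def em_def one_R zero_R)
qed

lemma mat_eq_iff: "hmat u = hmat v \<longleftrightarrow> u - v \<in> VJ"
proof
  assume eq: "hmat u = hmat v"
  have "em u i j - em v i j \<in> J" if "i \<in> {1..3}" "j \<in> {1..3}" for i j
    using fun_cong[OF eq, of "(i, j)"] that by (simp add: mat_apply c_eq_iff)
  from this[of 1 2] this[of 2 3] this[of 1 3] show "u - v \<in> VJ" by (simp add: vbox_def em_def)
next
  assume uv: "u - v \<in> VJ"
  then have "c (em u i j) = c (em v i j)" for i j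
    by (auto simp: em_def vbox_def c_eq_iff J_0)
  then show "hmat u = hmat v" by (auto simp: hmat_def fun_eq_iff)
qed

lemma finsum_c: "(\<Oplus>\<^bsub>R\<^esub>k\<in>{1..3::nat}. c (g k)) = c (g 1 + g 2 + g 3)"
  unfolding interval_1_3 by (simp add: c_add add_ac)

lemma mult_Hs: "hmat u \<otimes>\<^bsub>Hs\<^esub> hmat v = hmat (hm u v)"
proof
  fix x :: "nat \<times> nat"
  obtain i j where x: "x = (i, j)" by (cases x)
  show "(hmat u \<otimes>\<^bsub>Hs\<^esub> hmat v) x = hmat (hm u v) x"
  proof (cases "x \<in> ix")
    case False
    then show ?thesis unfolding x by (auto simp: heisenberg_def hmat_def)
  next
    case True
    then have ij: "i \<in> {1..3}" "j \<in> {1..3}" using x by auto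
    have ij': "i \<in> {1, 2, 3}" "j \<in> {1, 2, 3}" using ij unfolding interval_1_3 .
    have "(hmat u \<otimes>\<^bsub>Hs\<^esub> hmat v) x = (\<Oplus>\<^bsub>R\<^esub>k\<in>{1..3}. hmat u (i, k) \<otimes>\<^bsub>R\<^esub> hmat v (k, j))"
      using ij by (simp add: heisenberg_def x)
    also have "\<dots> = (\<Oplus>\<^bsub>R\<^esub>k\<in>{1..3}. c (em u i k * em v k j))"
      by (rule CR.finsum_cong') (use ij in \<open>auto simp: mat_apply c_mult\<close>)
    also have "\<dots> = c (em u i 1 * em v 1 j + em u i 2 * em v 2 j + em u i 3 * em v 3 j)"
      by (rule finsum_c)
    also have "em u i 1 * em v 1 j + em u i 2 * em v 2 j + em u i 3 * em v 3 j = em (hm u v) i j"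
      using ij' by (auto simp: em_def hm_def add_ac)
    also have "c (em (hm u v) i j) = hmat (hm u v) x" using ij x by (simp add: mat_apply)
    finally show ?thesis .
  qed
qed

lemma one_Hs: "\<one>\<^bsub>Hs\<^esub> = hmat 0"
  by (auto simp: heisenberg_def hmat_def em_def fun_eq_iff one_R zero_R)

lemma hm_assoc: "hm (hm u v) x = hm u (hm v x)"
  by (rule vec3_eqI) (simp_all add: hm_def algebra_simps)

definition hinv :: "'b ^ 3 \<Rightarrow> 'b ^ 3" where
  "hinv v = - v + vector [0, 0, v $ 1 * v $ 2]"

lemma hm_hinv: "hm (hinv v) v = 0" "hm v (hinv v) = 0"
  by (rule vec3_eqI; simp add: hm_def hinv_def)+

lemma hm_0: "hm 0 v = v" "hm v 0 = v"
  by (rule vec3_eqI; simp add: hm_def)+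

lemma group_Hs: "group Hs"
proof (rule groupI)
  fix x assume "x \<in> carrier Hs"
  then obtain v where v: "x = hmat v" by (auto simp: carrier_Hs)
  have "hmat (hinv v) \<otimes>\<^bsub>Hs\<^esub> x = \<one>\<^bsub>Hs\<^esub>" by (simp add: v mult_Hs hm_hinv one_Hs)
  then show "\<exists>y\<in>carrier Hs. y \<otimes>\<^bsub>Hs\<^esub> x = \<one>\<^bsub>Hs\<^esub>" by (auto simp: carrier_Hs)
qed (auto simp: carrier_Hs mult_Hs one_Hs hm_assoc hm_0)

lemma inv_Hs: "inv\<^bsub>Hs\<^esub> hmat v = hmat (hinv v)"
proof -
  interpret group Hs by (rule group_Hs)
  show ?thesis by (rule inv_equality) (simp_all add: mult_Hs hm_hinv one_Hs carrier_Hs)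
qed

lemma mat_mem_iff:
  assumes "subgrp S" "VJ \<subseteq> S"
  shows "hmat v \<in> hmat ` S \<longleftrightarrow> v \<in> S"
proof
  assume "hmat v \<in> hmat ` S"
  then obtain s where s: "s \<in> S" "v - s \<in> VJ" by (auto simp: mat_eq_iff)
  then have "v - s \<in> S" using assms(2) by blast
  from subgrp_add[OF assms(1) this s(1)] show "v \<in> S" by simp
qed auto

lemma ncond_center:
  assumes "ncond S" "v \<in> S"
  shows "vector [0, 0, r * v $ 1] \<in> S" "vector [0, 0, r * v $ 2] \<in> S"
  using assms unfolding ncond_def by blast+

text \<open>Under \<open>ncond\<close> the subgroup absorbs the cocycle, so multiplicative and
  additive cosets coincide; with the left version this gives both normality and equality of the
  indices.\<close>

lemma r_coset_mat:
  assumes S: "subgrp S" "ncond S"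
  shows "hmat ` S #>\<^bsub>Hs\<^esub> hmat x = hmat ` ((+) x ` S)"
proof (intro equalityI subsetI)
  fix y assume "y \<in> hmat ` S #>\<^bsub>Hs\<^esub> hmat x"
  then obtain n where n: "n \<in> S" "y = hmat (hm n x)" by (auto simp: r_coset_def mult_Hs)
  have "hm n x = x + (n + vector [0, 0, x $ 2 * n $ 1])" by (rule vec3_eqI) (simp_all add: hm_def)
  moreover have "n + vector [0, 0, x $ 2 * n $ 1] \<in> S"
    by (intro subgrp_add[OF S(1)] n ncond_center(1)[OF S(2)])
  ultimately show "y \<in> hmat ` ((+) x ` S)" using n(2) by auto
next
  fix y assume "y \<in> hmat ` ((+) x ` S)"
  then obtain s where s: "s \<in> S" "y = hmat (x + s)" by auto
  define n where "n = s - vector [0, 0, x $ 2 * s $ 1]"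
  have "n \<in> S" unfolding n_def by (intro subgrp_diff[OF S(1)] s ncond_center(1)[OF S(2)])
  moreover have "hm n x = x + s" by (rule vec3_eqI) (simp_all add: hm_def n_def)
  ultimately show "y \<in> hmat ` S #>\<^bsub>Hs\<^esub> hmat x" using s(2) by (auto simp: r_coset_def mult_Hs intro!: bexI[of _ n])
qed

lemma l_coset_mat:
  assumes S: "subgrp S" "ncond S"
  shows "hmat x <#\<^bsub>Hs\<^esub> hmat ` S = hmat ` ((+) x ` S)"
proof (intro equalityI subsetI)
  fix y assume "y \<in> hmat x <#\<^bsub>Hs\<^esub> hmat ` S"
  then obtain n where n: "n \<in> S" "y = hmat (hm x n)" by (auto simp: l_coset_def mult_Hs)
  have "hm x n = x + (n + vector [0, 0, x $ 1 * n $ 2])" by (rule vec3_eqI) (simp_all add: hm_def)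
  moreover have "n + vector [0, 0, x $ 1 * n $ 2] \<in> S"
    by (intro subgrp_add[OF S(1)] n ncond_center(2)[OF S(2)])
  ultimately show "y \<in> hmat ` ((+) x ` S)" using n(2) by auto
next
  fix y assume "y \<in> hmat ` ((+) x ` S)"
  then obtain s where s: "s \<in> S" "y = hmat (x + s)" by auto
  define n where "n = s - vector [0, 0, x $ 1 * s $ 2]"
  have "n \<in> S" unfolding n_def by (intro subgrp_diff[OF S(1)] s ncond_center(2)[OF S(2)])
  moreover have "hm x n = x + s" by (rule vec3_eqI) (simp_all add: hm_def n_def)
  ultimately show "y \<in> hmat x <#\<^bsub>Hs\<^esub> hmat ` S" using s(2) by (auto simp: l_coset_def mult_Hs intro!: bexI[of _ n])
qed

lemma normal_mat:
  assumes S: "subgrp S" "VJ \<subseteq> S" "ncond S"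
  shows "hmat ` S \<lhd> Hs"
proof -
  interpret group Hs by (rule group_Hs)
  show ?thesis
  proof (rule normalI)
    show "subgroup (hmat ` S) Hs"
    proof (rule subgroupI)
      show "hmat ` S \<subseteq> carrier Hs" by (auto simp: carrier_Hs)
      show "hmat ` S \<noteq> {}" using subgrp_0[OF S(1)] by blast
      fix a assume "a \<in> hmat ` S"
      then obtain u where u: "u \<in> S" "a = hmat u" by blast
      have "hinv u \<in> S" unfolding hinv_def
        by (intro subgrp_add[OF S(1)] subgrp_minus[OF S(1)] u ncond_center(2)[OF S(3)])
      then show "inv\<^bsub>Hs\<^esub> a \<in> hmat ` S" by (simp add: u(2) inv_Hs)
      fix b assume "b \<in> hmat ` S"
      then obtain v where v: "v \<in> S" "b = hmat v" by blast
      have "hm u v \<in> S" unfolding hm_def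
        by (intro subgrp_add[OF S(1)] u v ncond_center(2)[OF S(3)])
      then show "a \<otimes>\<^bsub>Hs\<^esub> b \<in> hmat ` S" by (simp add: u(2) v(2) mult_Hs)
    qed
    show "\<forall>x\<in>carrier Hs. hmat ` S #>\<^bsub>Hs\<^esub> x = x <#\<^bsub>Hs\<^esub> hmat ` S"
      using r_coset_mat[OF S(1,3)] l_coset_mat[OF S(1,3)] by (auto simp: carrier_Hs)
  qed
qed

text \<open>The commutator of \<open>v\<close> with \<open>x\<close> is central with entry \<open>x\<^sub>1 v\<^sub>2 - v\<^sub>1 x\<^sub>2\<close>; so a normal subgroup
  absorbs the cocycle and is also a subgroup for the addition.\<close>

lemma normal_pull:
  assumes "N \<lhd> Hs"
  defines "S \<equiv> {v. hmat v \<in> N}"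
  shows "subgrp S" "VJ \<subseteq> S" "ncond S" "N = hmat ` S"
proof -
  interpret group Hs by (rule group_Hs)
  interpret N: normal N Hs by (rule assms(1))
  show N: "N = hmat ` S" using N.subset by (auto simp: S_def carrier_Hs)
  have hm: "hm u v \<in> S" if "u \<in> S" "v \<in> S" for u v
    using N.m_closed[of "hmat u" "hmat v"] that by (simp add: S_def mult_Hs)
  have hinv: "hinv v \<in> S" if "v \<in> S" for v
    using N.m_inv_closed[of "hmat v"] that by (simp add: S_def inv_Hs)
  have sat: "u \<in> S" if "v \<in> S" "u - v \<in> VJ" for u v
    using that mat_eq_iff[of u v] by (simp add: S_def)
  have z: "0 \<in> S" using N.one_closed by (simp add: S_def one_Hs)
  have comm: "vector [0, 0, x $ 1 * v $ 2 - v $ 1 * x $ 2] \<in> S" if v: "v \<in> S" for x v :: "'b ^ 3"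
  proof -
    have "hmat x \<otimes>\<^bsub>Hs\<^esub> hmat v \<otimes>\<^bsub>Hs\<^esub> inv\<^bsub>Hs\<^esub> hmat x \<in> N"
      using N.inv_op_closed2[of "hmat x" "hmat v"] v by (simp add: S_def carrier_Hs)
    then have "hm (hm x v) (hinv x) \<in> S" by (simp add: S_def mult_Hs inv_Hs)
    then have "hm (hm (hm x v) (hinv x)) (hinv v) \<in> S" by (rule hm[OF _ hinv[OF v]])
    moreover have "hm (hm (hm x v) (hinv x)) (hinv v) = vector [0, 0, x $ 1 * v $ 2 - v $ 1 * x $ 2]"
      by (rule vec3_eqI) (simp_all add: hm_def hinv_def algebra_simps)
    ultimately show ?thesis by simp
  qed
  show nc: "ncond S"
    unfolding ncond_def
  proof (intro ballI allI conjI)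
    fix v r assume v: "v \<in> S"
    show "vector [0, 0, r * v $ 1] \<in> S" using comm[OF v, of "vector [0, - r, 0]"] by (simp add: mult.commute)
    show "vector [0, 0, r * v $ 2] \<in> S" using comm[OF v, of "vector [r, 0, 0]"] by simp
  qed
  show "VJ \<subseteq> S" using sat[OF z] by auto
  show "subgrp S"
    unfolding subgrp_def
  proof (intro conjI ballI z)
    fix u v assume u: "u \<in> S" and v: "v \<in> S"
    have 1: "hm u (hinv v) \<in> S" by (rule hm[OF u hinv[OF v]])
    have "vector [0, 0, u $ 1 * v $ 2] \<in> S" "vector [0, 0, (- v $ 1) * v $ 2] \<in> S"
      using nc v unfolding ncond_def by blast+
    \<comment> \<open>The group product of u and the inverse of v differs from u - v only by (v_1 -
      u_1) v_2 in the third coordinate, which central elements of S repair.\<close>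
    then have "hm (hm (hm u (hinv v)) (vector [0, 0, u $ 1 * v $ 2])) (vector [0, 0, (- v $ 1) * v $ 2]) \<in> S"
      by (intro hm 1)
    moreover have "hm (hm (hm u (hinv v)) (vector [0, 0, u $ 1 * v $ 2])) (vector [0, 0, (- v $ 1) * v $ 2]) = u - v"
      by (rule vec3_eqI) (simp_all add: hm_def hinv_def)
    ultimately show "u - v \<in> S" by simp
  qed
qed

lemma card_rcosets_mat:
  assumes S: "subgrp S" "VJ \<subseteq> S" "ncond S"
  shows "card (rcosets\<^bsub>Hs\<^esub> (hmat ` S)) = idx UNIV S"
proof -
  have "rcosets\<^bsub>Hs\<^esub> (hmat ` S) = range (\<lambda>x. hmat ` ((+) x ` S))"
    by (auto simp: RCOSETS_def carrier_Hs r_coset_mat[OF S(1,3)])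
  moreover have "card (range (\<lambda>x. hmat ` ((+) x ` S))) = card (range (\<lambda>x. (+) x ` S))"
  proof (rule card_image_eq)
    fix x y
    have "x - y \<in> S" if eq: "hmat ` ((+) x ` S) = hmat ` ((+) y ` S)"
    proof -
      have "hmat (x + 0) \<in> hmat ` ((+) x ` S)" using subgrp_0[OF S(1)] by blast
      then have "hmat x \<in> hmat ` ((+) y ` S)" unfolding eq by simp
      then obtain s where s: "s \<in> S" "x - (y + s) \<in> VJ" by (auto simp: mat_eq_iff)
      then have "x - (y + s) \<in> S" using S(2) by blast
      from subgrp_add[OF S(1) this s(1)] show ?thesis by simp
    qed
    then show "hmat ` ((+) x ` S) = hmat ` ((+) y ` S) \<longleftrightarrow> (+) x ` S = (+) y ` S"
      using coset_eq_iff[OF S(1), of x y] arg_cong[of "(+) x ` S" "(+) y ` S" "image hmat"] by argo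
  qed
  ultimately show ?thesis by (simp add: idx_def)
qed

abbreviation "TR \<equiv> adic_topology R (max_ideal R)"

lemma em_diff_mem:
  assumes "u - v \<in> vbox (I k) (I k) (I k)"
  shows "em u i j - em v i j \<in> I k"
  using assms subgrp_0[OF subgrp_I] by (auto simp: em_def vbox_def)

text \<open>A neighbourhood of the identity contains a product of balls, one for each of the nine
  entries; the largest exponent serves for all. Conversely, S is cut out by the union of such
  products around its elements.\<close>

lemma open_mat_iff:
  assumes S: "subgrp S" "VJ \<subseteq> S"
  shows "openin (heisenberg_topology R) (hmat ` S) \<longleftrightarrow> (\<exists>k. vbox (I k) (I k) (I k) \<subseteq> S)"
proof
  assume "openin (heisenberg_topology R) (hmat ` S)"
  then obtain U where U: "openin (product_topology (\<lambda>_. TR) ix) U" "hmat ` S = U \<inter> carrier Hs"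
    unfolding heisenberg_topology_def openin_subtopology by blast
  have "hmat 0 \<in> hmat ` S" by (intro imageI subgrp_0[OF S(1)])
  then have 0: "hmat 0 \<in> U" unfolding U(2) by simp
  have "\<forall>x\<in>U. \<exists>X. finite {i \<in> ix. X i \<noteq> topspace TR} \<and> (\<forall>i\<in>ix. openin TR (X i)) \<and> x \<in> Pi\<^sub>E ix X \<and> Pi\<^sub>E ix X \<subseteq> U"
    using U(1) unfolding openin_product_topology_alt .
  from bspec[OF this 0] obtain X where X: "\<forall>i\<in>ix. openin TR (X i)" "hmat 0 \<in> Pi\<^sub>E ix X" "Pi\<^sub>E ix X \<subseteq> U"
    by (elim exE conjE)
  have "\<exists>k. (c ` I k) +>\<^bsub>R\<^esub> c (em 0 (fst i) (snd i)) \<subseteq> X i" if "i \<in> ix" for i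
  proof -
    have "hmat 0 i \<in> X i" using PiE_mem[OF X(2) that] .
    moreover have "hmat 0 i = c (em 0 (fst i) (snd i))" using mat_apply_pair[OF that] .
    moreover have "\<forall>x\<in>X i. \<exists>k. (c ` I k) +>\<^bsub>R\<^esub> x \<subseteq> X i"
      using bspec[OF X(1) that] unfolding openin_R by (rule conjunct2)
    ultimately show ?thesis by simp
  qed
  then have "\<forall>i\<in>ix. \<exists>k. (c ` I k) +>\<^bsub>R\<^esub> c (em 0 (fst i) (snd i)) \<subseteq> X i" by (rule ballI)
  from bchoice[OF this] obtain kk where "\<forall>i\<in>ix. (c ` I (kk i)) +>\<^bsub>R\<^esub> c (em 0 (fst i) (snd i)) \<subseteq> X i"
    by (elim exE)
  note kk = bspec[OF this]
  define k where "k = Max (kk ` ix)"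
  have kle: "kk i \<le> k" if "i \<in> ix" for i unfolding k_def using that by (intro Max_ge) auto
  have "v \<in> S" if v: "v \<in> vbox (I k) (I k) (I k)" for v
  proof -
    have "hmat v \<in> Pi\<^sub>E ix X"
    proof (rule PiE_I)
      fix i assume i: "i \<in> ix"
      have "em v (fst i) (snd i) - em 0 (fst i) (snd i) \<in> I k" by (rule em_diff_mem) (use v in simp)
      then have "c (em v (fst i) (snd i)) \<in> (c ` I (kk i)) +>\<^bsub>R\<^esub> c (em 0 (fst i) (snd i))"
        unfolding c_mem_coset by (rule subsetD[OF I_antimono[OF kle[OF i]]])
      from subsetD[OF kk[OF i] this] show "hmat v i \<in> X i" unfolding mat_apply_pair[OF i] .
    qed (auto simp: hmat_def)
    from subsetD[OF X(3) this] have "hmat v \<in> hmat ` S" unfolding U(2) carrier_Hs by simp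
    then show "v \<in> S" using mat_mem_iff[OF S] by simp
  qed
  then show "\<exists>k. vbox (I k) (I k) (I k) \<subseteq> S" by (intro exI[of _ k] subsetI)
next
  assume "\<exists>k. vbox (I k) (I k) (I k) \<subseteq> S"
  then obtain k where k: "vbox (I k) (I k) (I k) \<subseteq> S" by (elim exE)
  define X where "X v = (\<lambda>i. (c ` I k) +>\<^bsub>R\<^esub> c (em v (fst i) (snd i)))" for v
  define U where "U = (\<Union>v\<in>S. Pi\<^sub>E ix (X v))"
  have "openin (product_topology (\<lambda>_. TR) ix) (Pi\<^sub>E ix (X v))" for v
  proof -
    have "\<forall>i\<in>ix. openin TR (X v i)" unfolding X_def by (intro ballI openin_coset)
    then show ?thesis by (subst openin_PiE) simp_all
  qed
  then have op: "openin (product_topology (\<lambda>_. TR) ix) U" unfolding U_def by (intro openin_Union) auto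
  have "hmat ` S = U \<inter> carrier Hs"
  proof (intro equalityI subsetI)
    fix A assume "A \<in> hmat ` S"
    then obtain v where v: "v \<in> S" "A = hmat v" by (elim imageE)
    have "hmat v \<in> Pi\<^sub>E ix (X v)"
    proof (rule PiE_I)
      fix i assume i: "i \<in> ix"
      show "hmat v i \<in> X v i" unfolding X_def mat_apply_pair[OF i] by (simp add: c_mem_coset subgrp_0[OF subgrp_I])
    qed (auto simp: hmat_def)
    then show "A \<in> U \<inter> carrier Hs" using v(1) unfolding v(2) carrier_Hs U_def by (intro IntI UN_I rangeI)
  next
    fix A assume A: "A \<in> U \<inter> carrier Hs"
    then obtain u where u: "A = hmat u" unfolding carrier_Hs by (elim IntE rangeE)
    obtain v where v: "v \<in> S" "hmat u \<in> Pi\<^sub>E ix (X v)" using A unfolding u U_def by (elim IntE UN_E)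
    have "em u i j - em v i j \<in> I k" if "i \<in> {1..3}" "j \<in> {1..3}" for i j
    proof -
      have "hmat u (i, j) \<in> X v (i, j)" by (rule PiE_mem[OF v(2)]) (use that in simp)
      then show ?thesis using that by (simp add: X_def mat_apply c_mem_coset)
    qed
    from this[of 1 2] this[of 2 3] this[of 1 3] have "u - v \<in> vbox (I k) (I k) (I k)"
      by (simp add: em_def vbox_def)
    from subsetD[OF k this] have "u - v \<in> S" .
    from subgrp_add[OF S(1) this v(1)] show "A \<in> hmat ` S" using u by simp
  qed
  with op show "openin (heisenberg_topology R) (hmat ` S)"
    unfolding heisenberg_topology_def openin_subtopology by (intro exI[of _ U] conjI)
qed

text \<open>p^i and w^(e i) agree modulo J, so the boxes and the multiples of powers of p are
  cofinal; this turns openness into the condition in \<open>lattices\<close>.\<close>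

lemma ex_vbox_iff:
  assumes S: "subgrp S" "VJ \<subseteq> S"
  shows "(\<exists>k. vbox (I k) (I k) (I k) \<subseteq> S) \<longleftrightarrow> (\<exists>i. \<forall>x. of_nat p ^ i * x \<in> S)"
proof
  assume "\<exists>k. vbox (I k) (I k) (I k) \<subseteq> S"
  then obtain k where k: "vbox (I k) (I k) (I k) \<subseteq> S" by (elim exE)
  have "of_nat p ^ k * y \<in> I k" for y
  proof -
    have "k \<le> e * k" using e1 by simp
    from subsetD[OF I_antimono[OF this] wpow_I] have "w ^ (e * k) * y \<in> I k" .
    then show ?thesis using I_cong[of "of_nat p ^ k * y" "w ^ (e * k) * y" k] subsetD[OF J_sub_I ppow_mult[of k y]] by simp
  qed
  then have "of_nat p ^ k * x \<in> vbox (I k) (I k) (I k)" for x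
    by (simp add: vbox_def ppow_nth del: vector_mult_component)
  then show "\<exists>i. \<forall>x. of_nat p ^ i * x \<in> S" by (intro exI[of _ k] allI subsetD[OF k])
next
  assume "\<exists>i. \<forall>x. of_nat p ^ i * x \<in> S"
  then obtain i where "\<forall>x. of_nat p ^ i * x \<in> S" by (elim exE)
  note i = spec[OF this]
  have "v \<in> S" if v: "v \<in> vbox (I (e * i)) (I (e * i)) (I (e * i))" for v
  proof -
    have *: "\<exists>y. x - of_nat p ^ i * y \<in> J" if "x \<in> I (e * i)" for x
    proof -
      obtain y where y: "x - w ^ (e * i) * y \<in> J" using \<open>x \<in> I (e * i)\<close> by (auto simp: I_def)
      have "x - of_nat p ^ i * y = (x - w ^ (e * i) * y) - (of_nat p ^ i * y - w ^ (e * i) * y)" by simp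
      also have "\<dots> \<in> J" by (rule J_diff[OF y ppow_mult])
      finally show ?thesis by (rule exI)
    qed
    obtain a b d where "v $ 1 - of_nat p ^ i * a \<in> J" "v $ 2 - of_nat p ^ i * b \<in> J" "v $ 3 - of_nat p ^ i * d \<in> J"
      using v *[of "v $ 1"] *[of "v $ 2"] *[of "v $ 3"] by (auto simp: vbox_def)
    then have "v - of_nat p ^ i * vector [a, b, d] \<in> VJ"
      by (simp add: vbox_def ppow_nth del: vector_mult_component)
    from subsetD[OF S(2) this] have "v - of_nat p ^ i * vector [a, b, d] \<in> S" .
    from subgrp_add[OF S(1) this i[of "vector [a, b, d]"]] show "v \<in> S" by simp
  qed
  then show "\<exists>k. vbox (I k) (I k) (I k) \<subseteq> S" by (intro exI[of _ "e * i"] subsetI)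
qed

theorem num_open_normal_Hs:
  "num_open_normal_subgroups Hs (heisenberg_topology R) m
    = card {S \<in> lattices p VJ. ncond S \<and> idx UNIV S = m}"
  unfolding num_open_normal_subgroups_def
proof (rule bij_betw_same_card[symmetric])
  let ?A = "{S \<in> lattices p VJ. ncond S \<and> idx UNIV S = m}"
  let ?B = "{N. N \<lhd> Hs \<and> openin (heisenberg_topology R) N \<and> card (rcosets\<^bsub>Hs\<^esub> N) = m}"
  show "bij_betw (\<lambda>S. hmat ` S) ?A ?B"
  proof (rule bij_betw_byWitness[where f' = "\<lambda>N. {v. hmat v \<in> N}"])
    show "\<forall>S\<in>?A. {v. hmat v \<in> hmat ` S} = S"
    proof
      fix S assume "S \<in> ?A"
      then have "S \<in> lattices p VJ" by simp
      then show "{v. hmat v \<in> hmat ` S} = S" using mat_mem_iff[OF latticesD(1,2)] by blast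
    qed
    show "\<forall>N\<in>?B. hmat ` {v. hmat v \<in> N} = N" using normal_pull(4) by blast
    show "(\<lambda>S. hmat ` S) ` ?A \<subseteq> ?B"
    proof
      fix N assume "N \<in> (\<lambda>S. hmat ` S) ` ?A"
      then obtain S where S: "S \<in> lattices p VJ" "ncond S" "idx UNIV S = m" and N: "N = hmat ` S" by blast
      note l = latticesD[OF S(1)]
      show "N \<in> ?B" unfolding N
        using normal_mat[OF l(1,2) S(2)] card_rcosets_mat[OF l(1,2) S(2)] S(3)
          open_mat_iff[OF l(1,2)] ex_vbox_iff[OF l(1,2)] l(3) by blast
    qed
    show "(\<lambda>N. {v. hmat v \<in> N}) ` ?B \<subseteq> ?A"
    proof
      fix S assume "S \<in> (\<lambda>N. {v. hmat v \<in> N}) ` ?B"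
      then obtain N where N: "N \<lhd> Hs" "openin (heisenberg_topology R) N" "card (rcosets\<^bsub>Hs\<^esub> N) = m"
        and S: "S = {v. hmat v \<in> N}" by blast
      note s = normal_pull[OF N(1), folded S]
      have "\<exists>i. \<forall>x. of_nat p ^ i * x \<in> S"
        using N(2) open_mat_iff[OF s(1,2)] ex_vbox_iff[OF s(1,2)] s(4) by simp
      then have "S \<in> lattices p VJ" using s(1,2) by (simp add: lattices_def)
      moreover have "idx UNIV S = m" using card_rcosets_mat[OF s(1-3)] s(4) N(3) by simp
      ultimately show "S \<in> ?A" using s(3) by simp
    qed
  qed
qed

end

section \<open>Comparison of rational functions\<close>

text \<open>The coefficients of a power series over Z[X] come from a countable set, so it can be
  coded as a sequence of integers; each coset is coded by a chosen representative. This places the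
  ring on the type over which the theorem quantifies.\<close>

lemma ex_code:
  fixes J :: "int poly fps set"
  assumes J: "subgrp J"
  obtains c :: "int poly fps \<Rightarrow> nat \<Rightarrow> int" where "\<And>x y. c x = c y \<longleftrightarrow> x - y \<in> J"
proof -
  define k :: "int poly fps \<Rightarrow> nat \<Rightarrow> int" where "k y = (\<lambda>i. int (to_nat (coeffs (fps_nth y i))))" for y
  define s where "s x = (SOME y. y - x \<in> J)" for x
  have inj: "x = y" if "k x = k y" for x y
  proof (rule fps_ext)
    fix i
    have "to_nat (coeffs (fps_nth x i)) = to_nat (coeffs (fps_nth y i))"
      using fun_cong[OF that, of i] by (simp add: k_def)
    then show "fps_nth x i = fps_nth y i" by (simp add: coeffs_eq_iff)
  qed
  have s: "s x - x \<in> J" for x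
    unfolding s_def by (rule someI[of _ x]) (simp add: subgrp_0[OF J])
  have "k (s x) = k (s y) \<longleftrightarrow> x - y \<in> J" for x y
  proof
    assume "k (s x) = k (s y)"
    then have "s x = s y" by (rule inj)
    then have "(s y - y) - (s x - x) = x - y" by simp
    then show "x - y \<in> J" using subgrp_diff[OF J s[of y] s[of x]] by simp
  next
    assume xy: "x - y \<in> J"
    have "z - x \<in> J \<longleftrightarrow> z - y \<in> J" for z
      using subgrp_add[OF J _ xy, of "z - x"] subgrp_diff[OF J _ xy, of "z - y"] by auto
    then show "k (s x) = k (s y)" unfolding s_def by simp
  qed
  then show thesis by (rule that)
qed

lemma (in ring_model) nfps_mult_zeta_den:
  "nfps * zeta_den e f (of_nat p) fps_X = (zeta_num e f (of_nat p) fps_X :: 'c::comm_ring_1 fps)"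
  unfolding nfps_eq by (rule zeta_num_eq[OF V0_eq V_0_0 NV_eq, symmetric])

lemma complex_powr_power:
  assumes "p > 0"
  shows "of_nat (p ^ j) powr (- complex_of_real s) = (of_nat p powr (- complex_of_real s)) ^ j"
proof -
  have *: "of_nat m powr (- complex_of_real s) = of_real (real m powr (- s))" for m
    using powr_of_real[of "real m" "- s"] by simp
  have "real (p ^ j) powr (- s) = (real p powr (- s)) ^ j"
    using assms by (simp add: powr_power powr_powr mult.commute flip: powr_realpow)
  then show ?thesis unfolding * by simp
qed

context coded_ring
begin

text \<open>Only indices that are powers of p contribute. The term for index m stands at position m
  - 1, hence the reindexing by p^j - 1.\<close>

lemma zeta_series:
  fixes s :: real
  assumes "summable (normal_zeta_term (heisenberg R) (heisenberg_topology R) (complex_of_real s))"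
  shows "(\<lambda>j. fps_nth nfps j * (of_nat p powr (- complex_of_real s)) ^ j) sums
    normal_zeta (heisenberg R) (heisenberg_topology R) (complex_of_real s)"
proof -
  let ?F = "normal_zeta_term (heisenberg R) (heisenberg_topology R) (complex_of_real s)"
  define g where "g j = p ^ j - 1" for j :: nat
  have p: "p > 0" "p > 1" using prime_gt_0_nat prime_gt_1_nat prime_p by blast+
  have Sg: "Suc (g j) = p ^ j" for j using p by (simp add: g_def)
  have g: "strict_mono g"
  proof (rule strict_monoI)
    fix i j :: nat assume "i < j"
    then have "p ^ i < p ^ j" using p(2) by (rule power_strict_increasing)
    then show "g i < g j" using Sg[of i] Sg[of j] by linarith
  qed
  have 0: "?F k = 0" if "k \<notin> range g" for k
  proof (rule ccontr)
    assume "?F k \<noteq> 0"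
    then have "card {S \<in> lattices p VJ. ncond S \<and> idx UNIV S = Suc k} \<noteq> 0"
      unfolding normal_zeta_term_def num_open_normal_Hs by auto
    then have "{S \<in> lattices p VJ. ncond S \<and> idx UNIV S = Suc k} \<noteq> {}" by (intro notI) simp
    then obtain S where S: "S \<in> lattices p VJ" "idx UNIV S = Suc k" by (auto simp only: ex_in_conv[symmetric] mem_Collect_eq)
    obtain j where "idx UNIV S = p ^ j" by (rule L.idx_lat[OF S(1) subset_refl])
    then have "k = g j" using S(2) Sg[of j] by simp
    then show False using that by blast
  qed
  have "?F (g j) = fps_nth nfps j * (of_nat p powr (- complex_of_real s)) ^ j" for j
    unfolding normal_zeta_term_def num_open_normal_Hs Sg complex_powr_power[OF p(1)] by (simp add: nfps_def)
  then show ?thesis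
    using sums_mono_reindex[of g ?F, OF g 0] summable_sums[OF assms] by (simp add: normal_zeta_def)
qed

text \<open>An identity of formal power series becomes one of values inside the disc of convergence.
  Convergence at \<sigma> + 1 gives a radius that strictly exceeds |p^(-s)| for s > \<sigma> +
  1.\<close>

lemma normal_zeta_mult_zeta_den:
  fixes s :: real
  assumes sm: "\<And>s. s > \<sigma> \<Longrightarrow> summable (normal_zeta_term (heisenberg R) (heisenberg_topology R) (complex_of_real s))"
    and s: "s > \<sigma> + 1"
  defines "z \<equiv> of_nat p powr (- complex_of_real s)"
  shows "normal_zeta (heisenberg R) (heisenberg_topology R) (complex_of_real s) * zeta_den e f (of_nat p) z
    = zeta_num e f (of_nat p) z"
proof -
  \<comment> \<open>Numerator and denominator are formed as polynomials in y, which can be read as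
    power series and also be evaluated at z.\<close>
  interpret h: rhom "fps_of_poly :: complex poly \<Rightarrow> complex fps"
    by unfold_locales (simp_all add: fps_of_poly_add fps_of_poly_mult)
  interpret ev: rhom "\<lambda>q. poly q z" by unfold_locales simp_all
  have pn: "fps_of_poly (of_nat k :: complex poly) = of_nat k" "poly (of_nat k) z = of_nat k" for k
    by (induction k) (simp_all add: fps_of_poly_add)
  let ?X = "[:0, 1:] :: complex poly"
  have D: "fps_of_poly (zeta_den e f (of_nat p) ?X) = zeta_den e f (of_nat p) fps_X"
    and N: "fps_of_poly (zeta_num e f (of_nat p) ?X) = zeta_num e f (of_nat p) fps_X"
    by (simp_all add: h.hzeta pn fps_of_poly_fps_X)
  have D': "poly (zeta_den e f (of_nat p) ?X) z = zeta_den e f (of_nat p) z"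
    and N': "poly (zeta_num e f (of_nat p) ?X) z = zeta_num e f (of_nat p) z"
    by (simp_all add: ev.hzeta pn)
  define z1 where "z1 = of_nat p powr (- complex_of_real (\<sigma> + 1))"
  have "summable (\<lambda>j. fps_nth nfps j * z1 ^ j)"
    unfolding z1_def by (rule sums_summable[OF zeta_series[OF sm]]) simp
  then have "ereal (norm z1) \<le> fps_conv_radius (nfps :: complex fps)"
    unfolding fps_conv_radius_def by (rule conv_radius_geI)
  moreover have "norm z < norm z1"
  proof -
    have *: "of_nat p powr (- complex_of_real r) = of_real (real p powr (- r))" for r
      using powr_of_real[of "real p" "- r"] by simp
    show ?thesis unfolding z_def z1_def * using s prime_gt_1_nat[OF prime_p] by (simp del: of_real_add)
  qed
  ultimately have r: "ereal (norm z) < fps_conv_radius (nfps :: complex fps)"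
    using less_le_trans[of "ereal (norm z)" "ereal (norm z1)"] by simp
  have "eval_fps (nfps * fps_of_poly (zeta_den e f (of_nat p) ?X)) z
    = eval_fps nfps z * eval_fps (fps_of_poly (zeta_den e f (of_nat p) ?X)) z"
    by (rule eval_fps_mult[OF r]) simp
  moreover have "eval_fps nfps z = normal_zeta (heisenberg R) (heisenberg_topology R) (complex_of_real s)"
    unfolding eval_fps_def z_def using sums_unique[OF zeta_series[OF sm, of s]] s by simp
  ultimately show ?thesis
    unfolding D nfps_mult_zeta_den N[symmetric] unfolding D[symmetric] by (simp add: D' N')
qed

end

text \<open>The bound \<sigma> is universally quantified because it comes from the hypothesis on W,
  which can be applied to R only after R has been obtained.\<close>

lemma ex_finite_extension:
  assumes p: "Factorial_Ring.prime p" and e: "e \<ge> 1" and f: "f \<ge> 1" "f dvd p - 1"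
  shows "\<exists>R :: (nat \<Rightarrow> int) ring. finite_extension_of_Zp p R \<and> has_ramification_index p R e \<and> has_inertia_degree R f \<and>
    (\<forall>\<sigma>. (\<forall>s>\<sigma>. summable (normal_zeta_term (heisenberg R) (heisenberg_topology R) (complex_of_real s))) \<longrightarrow>
      (\<forall>s>\<sigma> + 1. normal_zeta (heisenberg R) (heisenberg_topology R) (complex_of_real s)
          * zeta_den e f (of_nat p) (of_nat p powr (- complex_of_real s))
        = zeta_num e f (of_nat p) (of_nat p powr (- complex_of_real s))))"
proof -
  obtain a z where az: "[z ^ f = 1] (mod int p)" "z = a ^ ((p - 1) div f)"
    "\<And>i. 0 < i \<Longrightarrow> i < f \<Longrightarrow> \<not> [z ^ i = 1] (mod int p)"
    using ex_power_residues[OF p f] by blast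
  interpret K: kummer p f a z by (rule kummer.intro[OF p f az])
  interpret M: ring_model p e f "K.JJ e" fps_X by (rule K.ring_model[OF e])
  obtain c :: "int poly fps \<Rightarrow> nat \<Rightarrow> int" where c: "\<And>x y. c x = c y \<longleftrightarrow> x - y \<in> K.JJ e"
    using ex_code[OF M.subgrp_J] by blast
  interpret C: coded_ring p e f "K.JJ e" fps_X c by unfold_locales (rule c)
  show ?thesis
    by (intro exI[of _ C.R] conjI C.finite_extension_R C.ramification_R C.inertia_R allI impI
        C.normal_zeta_mult_zeta_den) simp_all
qed

lemma rhom_eval2: "rhom (\<lambda>P. eval2 P x y)"
proof
  have *: "map_poly (\<lambda>c. poly (map_poly of_rat c) x) (P + Q)
    = map_poly (\<lambda>c. poly (map_poly of_rat c) x) P + map_poly (\<lambda>c. poly (map_poly of_rat c) x) Q" for P Q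
    by (rule map_poly_hom_add) (simp_all add: map_poly_hom_add of_rat_add)
  show "eval2 (P + Q) x y = eval2 P x y + eval2 Q x y" for P Q
    unfolding eval2_def * by simp
  show "eval2 1 x y = 1" by (simp add: eval2_def map_poly_1)
qed (rule eval2_mult)

lemma eval2_vars [simp]: "eval2 [:[:0, 1:]:] x y = x" "eval2 [:0, 1:] x y = y"
  by (simp_all add: eval2_def map_poly_pCons)

text \<open>For each such x the specialized polynomial has infinitely many roots y, so it is 0; then
  each coefficient has infinitely many roots x.\<close>

lemma eval2_eq_0:
  fixes G :: "rat poly poly"
  assumes "infinite {x::'a::field_char_0. infinite {y. eval2 G x y = 0}}"
  shows "G = 0"
proof (rule poly_eqI)
  fix i
  have "poly (map_poly of_rat (Polynomial.coeff G i)) x = 0" if "infinite {y. eval2 G x y = 0}" for x :: 'a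
  proof -
    have "map_poly (\<lambda>c. poly (map_poly of_rat c) x) G = 0"
      using poly_roots_finite that unfolding eval2_def by blast
    from arg_cong[OF this, of "\<lambda>q. Polynomial.coeff q i"] show ?thesis by (simp add: coeff_map_poly)
  qed
  then have "{x::'a. infinite {y. eval2 G x y = 0}} \<subseteq> {x. poly (map_poly of_rat (Polynomial.coeff G i)) x = 0}"
    by blast
  then have "infinite {x::'a. poly (map_poly of_rat (Polynomial.coeff G i)) x = 0}"
    using assms finite_subset by blast
  then have "map_poly of_rat (Polynomial.coeff G i) = (0 :: 'a poly)"
    using poly_roots_finite by blast
  then show "Polynomial.coeff G i = Polynomial.coeff 0 i"
    by (simp add: map_poly_eq_0_iff)
qed

text \<open>Multiplied out, the value can be compared with any representation A/B, even one whose B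
  vanishes at the point.\<close>

lemma ratfun_eval_mult:
  assumes W: "W = Fraction_Field.Fract A B" "B \<noteq> 0" and "ratfun_defined_at W x y"
  shows "ratfun_eval W x y * eval2 B x y = eval2 A x y"
proof -
  obtain A' B' where *: "W = Fraction_Field.Fract A' B'" "B' \<noteq> 0" "eval2 B' x y \<noteq> 0"
    using assms(3) unfolding ratfun_defined_at_def by blast
  have "A' * B = A * B'" using W * by (simp add: eq_fract)
  then have "eval2 A' x y * eval2 B x y = eval2 A x y * eval2 B' x y" by (metis eval2_mult)
  then show ?thesis unfolding ratfun_eval_eq[OF *] using *(3) by (simp add: field_simps)
qed

text \<open>At Y = 0 the left side vanishes.\<close>

lemma vars_generic: "0 < i \<Longrightarrow> [:0, 1:] ^ i * [:[:0, 1:]:] ^ k \<noteq> (1 :: rat poly poly)"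
proof
  assume i: "0 < i" and "[:0, 1:] ^ i * [:[:0, 1:]:] ^ k = (1 :: rat poly poly)"
  from arg_cong[OF this(2), of "\<lambda>q. poly q 0"] show False using i by (simp add: power_0_left)
qed

lemma ratfun_vars_generic: "0 < i \<Longrightarrow> ratfun_Y ^ i * ratfun_X ^ k \<noteq> 1"
proof -
  interpret rhom "to_fract :: rat poly poly \<Rightarrow> ratfun2" by unfold_locales simp_all
  assume "0 < i"
  have "ratfun_Y ^ i * ratfun_X ^ k = to_fract ([:0, 1:] ^ i * [:[:0, 1:]:] ^ k)"
    by (simp only: ratfun_X_def ratfun_Y_def hmult hpower)
  then show ?thesis using vars_generic[OF \<open>0 < i\<close>, of k] by (metis hone to_fract_eq_iff)
qed

theorem theorem1p1:
  fixes e f n :: nat and W :: ratfun2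
  assumes "e \<ge> 1" and "f \<ge> 1" and "n = e * f"
    and "\<And>(p::nat) (R :: (nat \<Rightarrow> int) ring).
           Factorial_Ring.prime p \<Longrightarrow> finite_extension_of_Zp p R \<Longrightarrow>
           has_ramification_index p R e \<Longrightarrow> has_inertia_degree R f \<Longrightarrow>
           \<exists>\<sigma>::real. \<forall>s::complex. Re s > \<sigma> \<longrightarrow>
             summable (normal_zeta_term (heisenberg R) (heisenberg_topology R) s) \<and>
             ratfun_defined_at W (of_nat p) (of_nat p powr (- s)) \<and>
             normal_zeta (heisenberg R) (heisenberg_topology R) s =
               ratfun_eval W (of_nat p) (of_nat p powr (- s))"
  shows "ratfun_eval W (inverse ratfun_X) (inverse ratfun_Y) =
           (- 1) ^ (3 * n) * ratfun_X ^ (3 * n choose 2) *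
           ratfun_Y ^ (5 * n + 2 * (e - 1) * f) * W"
proof -
  define N where "N = zeta_num e f [:[:0, 1:]:] ([:0, 1:] :: rat poly poly)"
  define D where "D = zeta_den e f [:[:0, 1:]:] ([:0, 1:] :: rat poly poly)"
  have D0: "D \<noteq> 0" unfolding D_def by (rule zeta_den_nonzero[OF assms(1,2) vars_generic])
  have ND: "eval2 N x y = zeta_num e f x y" "eval2 D x y = zeta_den e f x y" for x y :: "'a::field_char_0"
    unfolding N_def D_def rhom.hzeta[OF rhom_eval2] by simp_all
  obtain A B where W: "W = Fraction_Field.Fract A B" "B \<noteq> 0" by (cases W)
  \<comment> \<open>G = 0 is equality of the fractions A/B and N/D; being a polynomial, G can be
    tested at points without regard to vanishing denominators.\<close>
  define G where "G = A * D - N * B"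
  have eval_G: "eval2 G x y = eval2 A x y * zeta_den e f x y - zeta_num e f x y * eval2 B x y" for x y :: complex
    unfolding G_def rhom.hdiff[OF rhom_eval2] eval2_mult ND by simp
  have inf: "infinite {y::complex. eval2 G (of_nat p) y = 0}" if p: "Factorial_Ring.prime p" "f dvd p - 1" for p
  proof -
    obtain R :: "(nat \<Rightarrow> int) ring" where R: "finite_extension_of_Zp p R" "has_ramification_index p R e"
      "has_inertia_degree R f"
      and eq: "\<forall>\<sigma>. (\<forall>s>\<sigma>. summable (normal_zeta_term (heisenberg R) (heisenberg_topology R) (complex_of_real s))) \<longrightarrow>
        (\<forall>s>\<sigma> + 1. normal_zeta (heisenberg R) (heisenberg_topology R) (complex_of_real s)
            * zeta_den e f (of_nat p) (of_nat p powr (- complex_of_real s))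
          = zeta_num e f (of_nat p) (of_nat p powr (- complex_of_real s)))"
      using ex_finite_extension[OF p(1) assms(1,2) p(2)] by (elim exE conjE)
    from assms(4)[OF p(1) R] obtain \<sigma> :: real where \<sigma>: "\<And>s::complex. Re s > \<sigma> \<Longrightarrow>
             summable (normal_zeta_term (heisenberg R) (heisenberg_topology R) s) \<and>
             ratfun_defined_at W (of_nat p) (of_nat p powr (- s)) \<and>
             normal_zeta (heisenberg R) (heisenberg_topology R) s =
               ratfun_eval W (of_nat p) (of_nat p powr (- s))" by blast
    define z where "z s = (of_nat p :: complex) powr (- complex_of_real s)" for s
    have "eval2 G (of_nat p) (z s) = 0" if s: "s > \<sigma> + 1" for s
    proof -
      let ?\<zeta> = "normal_zeta (heisenberg R) (heisenberg_topology R) (complex_of_real s)"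
      have \<zeta>: "ratfun_defined_at W (of_nat p) (z s)" "?\<zeta> = ratfun_eval W (of_nat p) (z s)"
        using \<sigma>[of "complex_of_real s"] s by (simp_all add: z_def)
      have 1: "?\<zeta> * eval2 B (of_nat p) (z s) = eval2 A (of_nat p) (z s)"
        unfolding \<zeta>(2) by (rule ratfun_eval_mult[OF W \<zeta>(1)])
      have 2: "?\<zeta> * zeta_den e f (of_nat p) (z s) = zeta_num e f (of_nat p) (z s)"
        unfolding z_def using eq[rule_format, OF _ s] \<sigma> by simp
      show ?thesis unfolding eval_G 1[symmetric] 2[symmetric] by (simp add: algebra_simps)
    qed
    then have "z ` {\<sigma> + 1<..} \<subseteq> {y. eval2 G (of_nat p) y = 0}" by auto
    \<comment> \<open>Distinct real s give distinct p^(-s), so each such p contributes infinitely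
      many zeros.\<close>
    moreover have "inj_on z {\<sigma> + 1<..}"
    proof (rule inj_onI)
      fix s t assume "z s = z t"
      moreover have "z r = of_real (real p powr (- r))" for r
        using powr_of_real[of "real p" "- r"] by (simp add: z_def)
      ultimately have "real p powr (- s) = real p powr (- t)" by simp
      then show "s = t" using prime_gt_1_nat[OF p(1)] by (simp add: powr_inj)
    qed
    then have "infinite (z ` {\<sigma> + 1<..})" using infinite_Ioi finite_imageD by blast
    ultimately show ?thesis using finite_subset by blast
  qed
  have "infinite {p. Factorial_Ring.prime p \<and> f dvd p - 1}"
    unfolding infinite_nat_iff_unbounded using ex_prime_cong_1[OF assms(2)] by blast
  then have "infinite ((of_nat :: nat \<Rightarrow> complex) ` {p. Factorial_Ring.prime p \<and> f dvd p - 1})"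
    by (simp add: finite_image_iff inj_on_def)
  moreover have "of_nat ` {p. Factorial_Ring.prime p \<and> f dvd p - 1} \<subseteq> {x::complex. infinite {y. eval2 G x y = 0}}"
    using inf by blast
  ultimately have "G = 0" using eval2_eq_0 finite_subset by blast
  then have WND: "W = Fraction_Field.Fract N D"
    unfolding W(1) using W(2) D0 by (simp add: eq_fract G_def)
  interpret h: rhom "to_fract :: rat poly poly \<Rightarrow> ratfun2" by unfold_locales simp_all
  have W': "W = zeta_num e f ratfun_X ratfun_Y / zeta_den e f ratfun_X ratfun_Y"
    unfolding WND Fract_conv_to_fract N_def D_def h.hzeta ratfun_X_def ratfun_Y_def ..
  have XY: "ratfun_X \<noteq> 0" "ratfun_Y \<noteq> 0" by (simp_all add: ratfun_X_def ratfun_Y_def)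
  \<comment> \<open>This allows the value of W at (1/X, 1/Y) to be computed from the representation
    N/D.\<close>
  have "zeta_den e f (inverse ratfun_X) (inverse ratfun_Y) \<noteq> 0"
  proof (rule zeta_den_nonzero[OF assms(1,2)])
    fix i k :: nat assume "0 < i"
    then have "ratfun_Y ^ i * ratfun_X ^ k \<noteq> 1" by (rule ratfun_vars_generic)
    then have "inverse (ratfun_Y ^ i * ratfun_X ^ k) \<noteq> 1" by (simp only: inverse_eq_1_iff not_False_eq_True)
    then show "inverse ratfun_Y ^ i * inverse ratfun_X ^ k \<noteq> 1" by (simp add: power_inverse)
  qed
  then have "ratfun_eval W (inverse ratfun_X) (inverse ratfun_Y)
      = zeta_num e f (inverse ratfun_X) (inverse ratfun_Y) / zeta_den e f (inverse ratfun_X) (inverse ratfun_Y)"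
    using ratfun_eval_eq[OF WND D0, of "inverse ratfun_X" "inverse ratfun_Y"] by (simp add: ND)
  also have "\<dots> = (- 1) ^ (3 * n) * ratfun_X ^ (3 * n choose 2) *
           ratfun_Y ^ (5 * n + 2 * (e - 1) * f) * W"
    unfolding W' by (rule zeta_functional_equation[OF assms(1-3) XY ratfun_vars_generic])
  finally show ?thesis .
qed

end
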